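(* (I) A symmetric tensor $f\in\mathrm{Sym}^n\mathbb{C}^d$ for $d\le 3$ is a persistent tensor if and only if its Hessian is the $d(n-2)$-th power of a nonzero linear form $\ell$. - ($d=2$) $f=x_0^{n-1}x_1$ up to $\mathrm{GL}(2,\mathbb{C})$ (i.e., $f$ is an isobaric of weight $1$) $\Leftrightarrow$ $\mathrm{Hess}(f)=\ell^{2(n-2)}$ $\Leftrightarrow$ $f$ is persistent. - ($d=3$) $f=x_0^{n-1}x_2+x_0^{n-2}x_1^2$ up to $\mathrm{GL}(3,\mathbb{C})$ (i.e., $f$ is an isobaric of weight $2$) $\Leftrightarrow$ $\mathrm{Hess}(f)=\ell^{3(n-2)}$ $\Leftrightarrow$ $f$ is persistent. (II) A symmetric tensor $f\in\mathrm{Sym}^3\mathbb{C}^4$ is a persistent tensor if and only if its Hessian is the fourth power of a nonzero linear form $\ell$: $f=\lambda_1x_0^2x_3+\lambda_2x_0x_1x_2+\lambda_3x_1^3$ up to $\mathrm{GL}(4,\mathbb{C})$ for some scalars $\lambda_i$ with $\lambda_1\lambda_2\ne 0$ (i.e., $f$ is an isobaric of weight $3$) $\Leftrightarrow$ $\mathrm{Hess}(f)=\ell^4$ $\Leftrightarrow$ $f$ is persistent.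
   Context: Symmetric tensors in $\mathrm{Sym}^n\mathbb{C}^d$ are identified with homogeneous polynomials of degree $n$ in $\mathbb{C}[x_0,\ldots,x_{d-1}]$. The Hessian is $\mathrm{Hess}(f)=\det\left(\frac{\partial^2 f}{\partial x_i\partial x_j}\right)_{0\le i,j\le d-1}$. In the equivalences, $\ell$ denotes some nonzero linear form. "Up to $\mathrm{GL}(d,\mathbb{C})$" means up to an invertible linear change of the variables. A homogeneous polynomial is isobaric of weight $\delta$ if every monomial $x_0^{\alpha_0}\cdots x_{d-1}^{\alpha_{d-1}}$ in its support satisfies $\sum_{j=0}^{d-1} j\alpha_j=\delta$; the remarks in parentheses in the claim describe the displayed normal forms. A homogeneous polynomial $f$ is concise if its partial derivatives $\partial f/\partial x_0,\ldots,\partial f/\partial x_{d-1}$ are linearly independent. For $u\in(\mathbb{C}^d)^\vee$ with coordinates $(u_0,\ldots,u_{d-1})$ write $\frac{\partial f}{\partial u}=\sum_i u_i\frac{\partial f}{\partial x_i}$. Persistence is defined recursively, with $V=\mathbb{C}^d$ fixed: (i) $f\in\mathrm{Sym}^2V$ is persistent if it is a quadratic form of maximal rank (nonsingular); (ii) for $n>2$, $f\in\mathrm{Sym}^nV$ is persistent if it is concise and there exists a hyperplane (linear subspace of codimension one) $S\subsetneq V^\vee$ such that $\frac{\partial f}{\partial u}\in\mathrm{Sym}^{n-1}V$ is persistent whenever $u\notin S$.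
   Formalization: For n = 2 the exponent d(n-2) is 0 and "Hess(f) is the 0-th power of ℓ" is read as "Hess(f) is a nonzero constant", since literally Hess(f) = 1 fails for f = x_0x_1 (Hessian -1); for n > 2 the equality is literal. *)

theory Defs
  imports
    Complex_Main
    "HOL-Library.Poly_Mapping"
    "Jordan_Normal_Form.DL_Rank"
begin

text \<open>
  A polynomial is the finitely supported map from monomials (exponent vectors) to coefficients;
  ring operations are those of \<^theory>\<open>HOL-Library.Poly_Mapping\<close>. The type has infinitely many
  variables; membership in $\mathbb{C}[x_0,\ldots,x_{d-1}]$ is part of \<open>sym_tensor\<close> below.
\<close>

type_synonym cpoly = "(nat \<Rightarrow>\<^sub>0 nat) \<Rightarrow>\<^sub>0 complex"

definition Const :: "complex \<Rightarrow> cpoly" where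
  "Const c = Poly_Mapping.single 0 c"

definition Var :: "nat \<Rightarrow> cpoly" where
  "Var i = Poly_Mapping.single (Poly_Mapping.single i 1) 1"

text \<open>The space $\mathrm{Sym}^n\mathbb{C}^d$: homogeneous polynomials of degree \<open>n\<close> (including 0)
  in $x_0,\ldots,x_{d-1}$.\<close>

definition sym_tensor :: "nat \<Rightarrow> nat \<Rightarrow> cpoly \<Rightarrow> bool" where
  "sym_tensor d n f \<longleftrightarrow>
     (\<forall>m \<in> Poly_Mapping.keys f. Poly_Mapping.keys m \<subseteq> {..<d} \<and>
        (\<Sum>j<d. Poly_Mapping.lookup m j) = n)"

definition isobaric :: "nat \<Rightarrow> nat \<Rightarrow> cpoly \<Rightarrow> bool" where
  "isobaric d \<delta> f \<longleftrightarrow>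
     (\<exists>n. sym_tensor d n f) \<and>
     (\<forall>m \<in> Poly_Mapping.keys f. (\<Sum>j<d. j * Poly_Mapping.lookup m j) = \<delta>)"

text \<open>Formal partial derivative. If $x_i$ does not occur in \<open>m\<close>, the truncated subtraction of
  exponents is harmless because the coefficient is 0.\<close>

definition partial :: "nat \<Rightarrow> cpoly \<Rightarrow> cpoly" where
  "partial i f =
     (\<Sum>m \<in> Poly_Mapping.keys f.
        Poly_Mapping.single (m - Poly_Mapping.single i 1)
          (of_nat (Poly_Mapping.lookup m i) * Poly_Mapping.lookup f m))"

definition dir_deriv :: "nat \<Rightarrow> complex vec \<Rightarrow> cpoly \<Rightarrow> cpoly" where
  "dir_deriv d u f = (\<Sum>i<d. Const (u $ i) * partial i f)"

definition Hess :: "nat \<Rightarrow> cpoly \<Rightarrow> cpoly" where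
  "Hess d f = det (mat d d (\<lambda>(i, j). partial i (partial j f)))"

definition lin_subst :: "nat \<Rightarrow> complex mat \<Rightarrow> cpoly \<Rightarrow> cpoly" where
  "lin_subst d A f =
     (\<Sum>m \<in> Poly_Mapping.keys f.
        Const (Poly_Mapping.lookup f m) *
        (\<Prod>i<d. (\<Sum>j<d. Const (A $$ (i, j)) * Var j) ^ Poly_Mapping.lookup m i))"

definition GL_equiv :: "nat \<Rightarrow> cpoly \<Rightarrow> cpoly \<Rightarrow> bool" where
  "GL_equiv d f h \<longleftrightarrow>
     (\<exists>A \<in> carrier_mat d d. invertible_mat A \<and> f = lin_subst d A h)"

text \<open>
  The form \<open>h\<close> is the \<open>m\<close>-th power of a nonzero linear form. For \<open>m > 0\<close> this is literal.
  For \<open>m = 0\<close> (the Hessian of a quadratic form) the power is read up to a nonzero scalar, that is,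
  \<open>h\<close> is a nonzero constant; for \<open>m > 0\<close> such a scalar would be absorbed by the linear form.
\<close>

definition power_of_linear_form :: "nat \<Rightarrow> nat \<Rightarrow> cpoly \<Rightarrow> bool" where
  "power_of_linear_form d m h \<longleftrightarrow>
     (\<exists>l c. sym_tensor d 1 l \<and> l \<noteq> 0 \<and> c \<noteq> 0 \<and> (m > 0 \<longrightarrow> c = 1) \<and> h = Const c * l ^ m)"

text \<open>Linear independence of the family of partial derivatives (not of the set, so that repeated
  derivatives count as dependent).\<close>

definition concise :: "nat \<Rightarrow> cpoly \<Rightarrow> bool" where
  "concise d f \<longleftrightarrow>
     (\<forall>c. (\<Sum>i<d. Const (c i) * partial i f) = 0 \<longrightarrow> (\<forall>i<d. c i = 0))"

definition nonsingular_quadratic_form :: "nat \<Rightarrow> cpoly \<Rightarrow> bool" where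
  "nonsingular_quadratic_form d f \<longleftrightarrow>
     (\<exists>A \<in> carrier_mat d d. A\<^sup>T = A \<and>
        f = (\<Sum>i<d. \<Sum>j<d. Const (A $$ (i, j)) * Var i * Var j) \<and>
        vec_space.rank d A = d)"

text \<open>Linear subspaces of codimension one in the \<open>d\<close>-dimensional space \<open>carrier_vec d\<close> of
  coordinate vectors.\<close>

definition hyperplane :: "nat \<Rightarrow> complex vec set \<Rightarrow> bool" where
  "hyperplane d S \<longleftrightarrow>
     VectorSpace.subspace class_ring S (module_vec TYPE(complex) d) \<and>
     vectorspace.dim class_ring ((module_vec TYPE(complex) d)\<lparr>carrier := S\<rparr>) + 1 = d"

text \<open>Persistence is a notion for degree at least 2; the first two equations are dummies.\<close>

fun persistent :: "nat \<Rightarrow> nat \<Rightarrow> cpoly \<Rightarrow> bool" where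
  "persistent d 0 f \<longleftrightarrow> False"
| "persistent d (Suc 0) f \<longleftrightarrow> False"
| "persistent d (Suc (Suc 0)) f \<longleftrightarrow> sym_tensor d 2 f \<and> nonsingular_quadratic_form d f"
| "persistent d (Suc (Suc (Suc n))) f \<longleftrightarrow>
     sym_tensor d (Suc (Suc (Suc n))) f \<and> concise d f \<and>
     (\<exists>S. hyperplane d S \<and>
        (\<forall>u \<in> carrier_vec d - S. persistent d (Suc (Suc n)) (dir_deriv d u f)))"

end

theory Submission
  imports Defs "Jordan_Normal_Form.Char_Poly" "Jordan_Normal_Form.Schur_Decomposition"
begin

text \<open>
  Everything is equivariant under linear changes of variables: the chain rule gives
  Hess(f o A) = det(A)^2 (Hess f) o A (\<open>Hess_LS\<close>). Hence a Hessian that is a power of a linear form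
  may be taken to be c x_0^N, and normal forms need to be treated only in their given coordinates.
  
  In one variable both properties say that f is not zero.
  
  Cubics. A quadratic form is nonsingular iff its Hessian is a nonzero constant, and for a cubic f the
  Hessian of the derivative along u is the number (Hess f)(u). So a cubic in any number of variables
  is persistent iff it is concise and Hess f has no zero outside some hyperplane. A form
  without zeros outside the hyperplane l = 0 is constant on every line in the affine space l = 1, by
  the fundamental theorem of algebra, and is therefore c l^m (\<open>persistent_3_iff\<close>).
  
  From the Hessian to the normal form, d = 2, 3. The operators x_i x_j d_i d_j act diagonally on
  monomials, so x_0^2 ... x_{d-1}^2 Hess f is a sum over d-tuples of exponent vectors of f, weighted
  by explicit determinants, and this sum is a single monomial. If a vertex, or an edge, of the Newton
  polygon of f contributes a tuple whose exponent sum arises in no other way, this sum must be the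
  exponent of that monomial. Preparing f by linear changes that fix x_0, this forces f to be
  x_0^{n-1} L for d = 2 and x_0^{n-2} (x_0 L + c M^2) for d = 3, with linear forms L and M
  (\<open>binary_power_imp_GL_equiv\<close>, \<open>ternary_support\<close>, \<open>ternary_power_imp_GL_equiv\<close>).
  
  From persistence to the Hessian, d = 2, 3, by induction on n. The derivatives of f along directions
  outside a hyperplane are equivalent to the normal form of degree n - 1. In a pencil F + tG of such forms
  every Hessian is a d(n-3)-th power up to a scalar, and so, at a given point, the roots in t of its value,
  a polynomial of degree at most d, have order at least d(n-3). For n > 4 this excludes roots at points
  where Hess F does not vanish, so that the Hessian does not
  depend on t; for n = 4 the remaining possibility is excluded by explicit computation
  (\<open>pencil_constant\<close>). Hence all these derivatives have the same tangent form, say x_0, and f itself is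
  divisible by x_0^{n-d+1}, which leads to the normal form (\<open>normal_direction_imp_nf\<close>). Conversely,
  derivatives of a normal form along directions that do not annihilate x_0 are again normal forms
  (\<open>GL_equiv_nf_persistent\<close>).
  
  Quaternary cubics with Hess f = c x_0^4. Contracting the third-derivative tensor with vectors gives
  symmetric matrices M_x with det M_x = c x_0^4. If f does not vanish on x_0 = 0, take u there with
  f(u) \<noteq> 0; then N = M_e^{-1} M_u, for e the first unit vector, has characteristic polynomial z^4 and
  is nilpotent. In the basis e, Ne, N^2 e, N^3 e the tensor is of Hankel type, and
  the Hessian determines its remaining entries to be 0 (\<open>Hankel_cubic_GL_equiv\<close>). If f is divisible by x_0, the
  quadratic cofactor degenerates on x_0 = 0 and splits there into linear factors
  (\<open>cone_pencil_GL_equiv\<close>).\<close>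

(* Variable indices and exponents are often the literal 1, which is kept in this form. *)
declare One_nat_def [simp del]

section \<open>Polynomials\<close>

abbreviation lk :: "('a \<Rightarrow>\<^sub>0 'b::zero) \<Rightarrow> 'a \<Rightarrow> 'b" where "lk \<equiv> Poly_Mapping.lookup"
abbreviation supp :: "('a \<Rightarrow>\<^sub>0 'b::zero) \<Rightarrow> 'a set" where "supp \<equiv> Poly_Mapping.keys"

abbreviation ex :: "nat \<Rightarrow> nat \<Rightarrow>\<^sub>0 nat" where "ex i \<equiv> Poly_Mapping.single i 1"

lemma Const_0 [simp]: "Const 0 = 0" by (simp add: Const_def)
lemma Const_1 [simp]: "Const 1 = 1" by (simp add: Const_def)
lemma Const_add: "Const (a + b) = Const a + Const b" by (simp add: Const_def single_add)
lemma Const_mult: "Const (a * b) = Const a * Const b" by (simp add: Const_def mult_single)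

interpretation Const: comm_ring_hom Const
  by unfold_locales (simp_all add: Const_add Const_mult)

lemma lookup_Const_mult: "lk (Const a * f) m = a * lk f m"
proof -
  have "Const a * f = Poly_Mapping.map ((*) a) f"
    unfolding Const_def by (rule mult_map_scale_conv_mult[symmetric])
  then show ?thesis by (simp add: Poly_Mapping.map.rep_eq when_def)
qed

lemma lookup_Const: "lk (Const a) m = (if m = 0 then a else 0)"
  by (simp add: Const_def lookup_single when_def)

lemma Const_eq_iff [simp]: "Const a = Const b \<longleftrightarrow> a = b"
  by (metis lookup_Const)

lemma Const_eq_0_iff [simp]: "Const a = 0 \<longleftrightarrow> a = 0"
  using Const_eq_iff[of a 0] by simp

lemma cpoly_expand: "f = (\<Sum>m\<in>supp f. Poly_Mapping.single m (lk f m))"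
  by (rule poly_mapping_eqI)
     (simp add: lookup_sum lookup_single when_def sum.delta in_keys_iff)

text \<open>
  Additive statements about polynomials, in particular those about linear operators, reduce to monomials.\<close>
lemma cpoly_add_induct [case_names zero single add]:
  fixes f :: "'a \<Rightarrow>\<^sub>0 'b::comm_monoid_add"
  assumes z: "P 0" and s: "\<And>m a. P (Poly_Mapping.single m a)" and a: "\<And>f g. P f \<Longrightarrow> P g \<Longrightarrow> P (f + g)"
  shows "P f"
proof -
  have "finite S \<Longrightarrow> P (\<Sum>m\<in>S. Poly_Mapping.single m (lk f m))" for S
    by (induction S rule: finite_induct) (auto intro: z s a)
  moreover have "f = (\<Sum>m\<in>supp f. Poly_Mapping.single m (lk f m))"
    by (rule poly_mapping_eqI) (simp add: lookup_sum lookup_single when_def sum.delta in_keys_iff)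
  ultimately show ?thesis by (metis finite_keys)
qed

section \<open>Substitution homomorphisms\<close>

definition monom_val :: "(nat \<Rightarrow> 'a::comm_ring_1) \<Rightarrow> (nat \<Rightarrow>\<^sub>0 nat) \<Rightarrow> 'a" where
  "monom_val \<sigma> m = (\<Prod>i\<in>supp m. \<sigma> i ^ lk m i)"

lemma monom_val_superset:
  assumes "finite K" "supp m \<subseteq> K"
  shows "monom_val \<sigma> m = (\<Prod>i\<in>K. \<sigma> i ^ lk m i)"
  unfolding monom_val_def
  by (rule prod.mono_neutral_left) (use assms in \<open>auto simp: in_keys_iff\<close>)

lemma monom_val_0 [simp]: "monom_val \<sigma> 0 = 1" by (simp add: monom_val_def)

lemma monom_val_add: "monom_val \<sigma> (m + n) = monom_val \<sigma> m * monom_val \<sigma> n"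
proof -
  let ?K = "supp m \<union> supp n"
  have "monom_val \<sigma> (m + n) = (\<Prod>i\<in>?K. \<sigma> i ^ lk (m + n) i)"
    by (rule monom_val_superset) (auto dest: subsetD[OF Poly_Mapping.keys_add])
  also have "\<dots> = (\<Prod>i\<in>?K. \<sigma> i ^ lk m i) * (\<Prod>i\<in>?K. \<sigma> i ^ lk n i)"
    by (simp add: lookup_add power_add prod.distrib)
  also have "\<dots> = monom_val \<sigma> m * monom_val \<sigma> n"
    by (simp add: monom_val_superset[of ?K])
  finally show ?thesis .
qed

text \<open>
  A common source for evaluation, restriction to lines and linear substitution: \<open>c\<close> embeds the coefficients into a ring
  and \<open>\<sigma>\<close> gives the values of the variables.\<close>
definition msub :: "(complex \<Rightarrow> 'a::comm_ring_1) \<Rightarrow> (nat \<Rightarrow> 'a) \<Rightarrow> cpoly \<Rightarrow> 'a" where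
  "msub c \<sigma> f = (\<Sum>m\<in>supp f. c (lk f m) * monom_val \<sigma> m)"

context
  fixes c :: "complex \<Rightarrow> 'a::comm_ring_1"
  assumes c: "comm_ring_hom c"
begin

interpretation c: comm_ring_hom c by (rule c)

lemma msub_superset: "finite S \<Longrightarrow> supp f \<subseteq> S \<Longrightarrow> msub c \<sigma> f = (\<Sum>m\<in>S. c (lk f m) * monom_val \<sigma> m)"
  unfolding msub_def by (rule sum.mono_neutral_left) (auto simp: in_keys_iff)

lemma msub_single: "msub c \<sigma> (Poly_Mapping.single m a) = c a * monom_val \<sigma> m"
  by (subst msub_superset[of "{m}"]) (auto)

lemma msub_add: "msub c \<sigma> (f + g) = msub c \<sigma> f + msub c \<sigma> g"
proof -
  let ?S = "supp f \<union> supp g"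
  have "msub c \<sigma> (f + g) = (\<Sum>m\<in>?S. c (lk (f + g) m) * monom_val \<sigma> m)"
    by (rule msub_superset) (auto dest: subsetD[OF Poly_Mapping.keys_add])
  also have "\<dots> = (\<Sum>m\<in>?S. c (lk f m) * monom_val \<sigma> m) + (\<Sum>m\<in>?S. c (lk g m) * monom_val \<sigma> m)"
    by (simp add: lookup_add c.hom_add distrib_right sum.distrib)
  finally show ?thesis by (simp add: msub_superset[of ?S])
qed

lemma msub_0 [simp]: "msub c \<sigma> 0 = 0" by (simp add: msub_def)

lemma msub_mult: "msub c \<sigma> (f * g) = msub c \<sigma> f * msub c \<sigma> g"
proof (induction f rule: cpoly_add_induct)
  case (single m a)
  show ?case
  proof (induction g rule: cpoly_add_induct)
    case (single n b)
    then show ?case by (simp add: mult_single msub_single monom_val_add c.hom_mult algebra_simps)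
  qed (simp_all add: msub_add algebra_simps)
qed (simp_all add: msub_add algebra_simps)

lemma msub_1: "msub c \<sigma> 1 = 1"
  using msub_single[of \<sigma> 0 1] by simp

lemma msub_Const: "msub c \<sigma> (Const a) = c a"
  by (simp add: Const_def msub_single)

lemma msub_Var: "msub c \<sigma> (Var i) = \<sigma> i"
  by (simp add: Var_def msub_single monom_val_def)

lemma comm_ring_hom_msub: "comm_ring_hom (msub c \<sigma>)"
  by unfold_locales (simp_all add: msub_add msub_mult msub_1)

end

lemma single_eq_Const_mult_monom_val: "Poly_Mapping.single m a = Const a * monom_val Var m"
proof -
  have "monom_val Var m = Poly_Mapping.single m 1"
  proof (induction m rule: cpoly_add_induct)
    case (single i k)
    have "Var i ^ k = Poly_Mapping.single (Poly_Mapping.single i k) (1::complex)"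
      by (induction k) (simp_all add: Var_def mult_single single_add[symmetric] One_nat_def flip: single_one)
    then show ?case by (cases "k = 0") (simp_all add: monom_val_def)
  qed (simp_all add: monom_val_add mult_single)
  then show ?thesis by (simp add: Const_def mult_single)
qed

lemma cpoly_induct [case_names Const Var add mult]:
  assumes C: "\<And>a. P (Const a)" and V: "\<And>i. P (Var i)"
    and A: "\<And>f g. P f \<Longrightarrow> P g \<Longrightarrow> P (f + g)" and M: "\<And>f g. P f \<Longrightarrow> P g \<Longrightarrow> P (f * g)"
  shows "P f"
proof -
  have one: "P 1" using C[of 1] by simp
  have pw: "P g \<Longrightarrow> P (g ^ k)" for g k by (induction k) (auto intro: one M)
  have pr: "finite S \<Longrightarrow> (\<And>i. P (g i)) \<Longrightarrow> P (prod g S)" for S and g :: "nat \<Rightarrow> cpoly"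
    by (induction S rule: finite_induct) (auto intro: one M)
  show ?thesis
  proof (induction f rule: cpoly_add_induct)
    case zero show ?case using C[of 0] by simp
  next
    case (single m a)
    show ?case unfolding single_eq_Const_mult_monom_val monom_val_def
      by (intro M C pr pw V) simp
  qed (rule A)
qed

lemma hom_eq_msub:
  assumes h: "comm_ring_hom h"
  shows "h f = msub (\<lambda>a. h (Const a)) (\<lambda>i. h (Var i)) f"
proof -
  interpret h: comm_ring_hom h by (rule h)
  have c: "comm_ring_hom (\<lambda>a. h (Const a))"
    by unfold_locales (simp_all add: Const_add Const_mult h.hom_add h.hom_mult)
  show ?thesis
    by (induction f rule: cpoly_induct)
       (simp_all add: msub_add[OF c] msub_mult[OF c] msub_Const[OF c] msub_Var[OF c] h.hom_add h.hom_mult)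
qed

lemma hom_eqI:
  assumes "comm_ring_hom h" "comm_ring_hom k" "\<And>a. h (Const a) = k (Const a)" "\<And>i. h (Var i) = k (Var i)"
  shows "h f = k f"
  by (subst hom_eq_msub[OF assms(1)], subst hom_eq_msub[OF assms(2)]) (simp add: assms)

lemma comm_ring_hom_comp: "comm_ring_hom g \<Longrightarrow> comm_ring_hom h \<Longrightarrow> comm_ring_hom (\<lambda>x. g (h x))"
proof -
  assume a: "comm_ring_hom g" "comm_ring_hom h"
  interpret g: comm_ring_hom g by (rule a)
  interpret h: comm_ring_hom h by (rule a)
  show ?thesis by unfold_locales (simp_all add: h.hom_add g.hom_add h.hom_mult g.hom_mult)
qed

section \<open>Derivatives\<close>

lemma ex_cancel: "lk m i \<noteq> 0 \<Longrightarrow> m - ex i + ex i = m"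
  by (intro poly_mapping_eqI) (auto simp: lookup_add lookup_minus lookup_single when_def)

lemma lookup_partial: "lk (partial i f) m = of_nat (lk m i + 1) * lk f (m + ex i)"
proof -
  have "lk (partial i f) m = (\<Sum>n\<in>supp f. (of_nat (lk n i) * lk f n when n - ex i = m))"
    by (simp add: partial_def lookup_sum lookup_single)
  also have "\<dots> = (\<Sum>n\<in>supp f. if n = m + ex i then of_nat (lk n i) * lk f n else 0)"
  proof (rule sum.cong[OF refl])
    fix n
    have *: "n = m + ex i" if "n - ex i = m" "lk n i \<noteq> 0"
      using that(1) by (simp only: that(1)[symmetric] ex_cancel[OF that(2)])
    show "(of_nat (lk n i) * lk f n when n - ex i = m) = (if n = m + ex i then of_nat (lk n i) * lk f n else 0)"
    proof (cases "n = m + ex i")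
      case False
      then have "n - ex i \<noteq> m \<or> lk n i = 0" using * by blast
      with False show ?thesis by (auto simp only: when_simps if_False of_nat_0 mult_zero_left zero_when)
    qed simp
  qed
  also have "\<dots> = of_nat (lk m i + 1) * lk f (m + ex i)"
    by (simp add: sum.delta in_keys_iff lookup_add)
  finally show ?thesis .
qed

lemma partial_add: "partial i (f + g) = partial i f + partial i g"
  by (rule poly_mapping_eqI) (simp add: lookup_partial lookup_add algebra_simps)

lemma partial_0 [simp]: "partial i 0 = 0"
  by (simp add: partial_def)

lemma partial_single: "partial i (Poly_Mapping.single m a) = Poly_Mapping.single (m - ex i) (of_nat (lk m i) * a)"
  by (cases "a = 0") (simp_all add: partial_def)

lemma partial_mult: "partial i (f * g) = partial i f * g + f * partial i g"
proof (induction f rule: cpoly_add_induct)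
  case (single m a)
  show ?case
  proof (induction g rule: cpoly_add_induct)
    case (single n b)
    have 1: "lk m i \<noteq> 0 \<Longrightarrow> m + n - ex i = (m - ex i) + n"
      by (rule poly_mapping_eqI) (auto simp: lookup_add lookup_minus lookup_single when_def)
    have 2: "lk n i \<noteq> 0 \<Longrightarrow> m + n - ex i = m + (n - ex i)"
      by (rule poly_mapping_eqI) (auto simp: lookup_add lookup_minus lookup_single when_def)
    have L: "partial i (Poly_Mapping.single m a) * Poly_Mapping.single n b
        = Poly_Mapping.single (m + n - ex i) (of_nat (lk m i) * (a * b))"
      by (cases "lk m i = 0") (simp_all add: partial_single mult_single 1 mult.assoc)
    have R: "Poly_Mapping.single m a * partial i (Poly_Mapping.single n b)
        = Poly_Mapping.single (m + n - ex i) (of_nat (lk n i) * (a * b))"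
      by (cases "lk n i = 0") (simp_all add: partial_single mult_single 2 mult.left_commute)
    show ?case
      unfolding L R by (simp add: mult_single partial_single lookup_add distrib_right single_add)
  qed (simp_all add: partial_add algebra_simps)
qed (simp_all add: partial_add algebra_simps)

lemma partial_Const [simp]: "partial i (Const a) = 0"
  by (simp add: Const_def partial_single)

lemma partial_1 [simp]: "partial i 1 = 0"
  using partial_Const[of i 1] by simp

lemma partial_numeral [simp]: "partial i (numeral n) = 0"
  using partial_Const[of i "numeral n"] by (simp add: Const.hom_numeral)

lemma partial_of_nat [simp]: "partial i (of_nat n) = 0"
  using partial_Const[of i "of_nat n"] by (simp only: Const.hom_of_nat)

lemma partial_Var: "partial i (Var j) = (if i = j then 1 else 0)"
  by (auto simp: Var_def partial_single lookup_single when_def)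

lemma partial_sum: "partial i (sum f S) = (\<Sum>x\<in>S. partial i (f x))"
  by (induction S rule: infinite_finite_induct) (simp_all add: partial_add)

lemma partial_Const_mult: "partial i (Const a * f) = Const a * partial i f"
  by (simp add: partial_mult)

lemma partial_power: "partial i (f ^ k) = of_nat k * f ^ (k - 1) * partial i f"
proof (induction k)
  case (Suc k)
  then show ?case by (cases k) (simp_all add: partial_mult algebra_simps)
qed simp

lemma partial_commute: "partial i (partial j f) = partial j (partial i f)"
proof (rule poly_mapping_eqI)
  fix m
  have "m + ex i + ex j = m + ex j + ex i" by (simp add: add.assoc add.commute[of "ex i"])
  then show "lk (partial i (partial j f)) m = lk (partial j (partial i f)) m"
    by (simp add: lookup_partial lookup_add lookup_single when_def)
qed

lemma lookup_Var_mult: "lk (Var i * f) m = (if lk m i = 0 then 0 else lk f (m - ex i))"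
proof (induction f rule: cpoly_add_induct)
  case (single n a)
  have "(ex i + n = m) \<longleftrightarrow> (lk m i \<noteq> 0 \<and> n = m - ex i)"
  proof
    assume "ex i + n = m"
    then show "lk m i \<noteq> 0 \<and> n = m - ex i" by (auto simp: lookup_add)
  next
    assume "lk m i \<noteq> 0 \<and> n = m - ex i"
    then show "ex i + n = m" using ex_cancel[of m i] by (simp add: add.commute)
  qed
  then show ?case by (auto simp: Var_def mult_single lookup_single when_def)
qed (simp_all add: lookup_add algebra_simps)

text \<open>
  The operators \<open>x_i \<partial>_i\<close> are diagonal in the monomial basis.\<close>
lemma lookup_Var_mult_partial: "lk (Var i * partial i f) m = of_nat (lk m i) * lk f m"
  by (auto simp: lookup_Var_mult lookup_partial ex_cancel lookup_minus)

section \<open>Homogeneity\<close>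

lemma sym_tensorD:
  assumes "sym_tensor d n f" "m \<in> supp f"
  shows "supp m \<subseteq> {..<d}" "(\<Sum>j<d. lk m j) = n" "\<not> i < d \<Longrightarrow> lk m i = 0"
  using assms unfolding sym_tensor_def by (auto simp: in_keys_iff subset_iff)

lemma sym_tensor_0 [simp]: "sym_tensor d n 0" by (simp add: sym_tensor_def)

lemma sym_tensor_add: "sym_tensor d n f \<Longrightarrow> sym_tensor d n g \<Longrightarrow> sym_tensor d n (f + g)"
  unfolding sym_tensor_def using Poly_Mapping.keys_add[of f g] by blast

lemma sym_tensor_sum: "(\<And>x. x \<in> S \<Longrightarrow> sym_tensor d n (f x)) \<Longrightarrow> sym_tensor d n (sum f S)"
  by (induction S rule: infinite_finite_induct) (auto intro: sym_tensor_add)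

lemma sym_tensor_mult:
  assumes "sym_tensor d a f" "sym_tensor d b g" shows "sym_tensor d (a + b) (f * g)"
  unfolding sym_tensor_def
proof
  fix m assume "m \<in> supp (f * g)"
  then obtain p q where pq: "m = p + q" "p \<in> supp f" "q \<in> supp g"
    using Poly_Mapping.keys_mult[of f g] by auto
  then show "supp m \<subseteq> {..<d} \<and> (\<Sum>j<d. lk m j) = a + b"
    using sym_tensorD(1,2)[OF assms(1) pq(2)] sym_tensorD(1,2)[OF assms(2) pq(3)] Poly_Mapping.keys_add[of p q]
    by (auto simp: lookup_add sum.distrib)
qed

lemma sym_tensor_Const [simp]: "sym_tensor d 0 (Const a)"
  by (auto simp: sym_tensor_def Const_def split: if_splits)

lemma sym_tensor_1 [simp]: "sym_tensor d 0 1"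
  using sym_tensor_Const[of d 1] by simp

lemma sym_tensor_Const_mult: "sym_tensor d n f \<Longrightarrow> sym_tensor d n (Const a * f)"
  using sym_tensor_mult[OF sym_tensor_Const] by (metis add_0)

lemma sym_tensor_Var: "i < d \<Longrightarrow> sym_tensor d 1 (Var i)"
  by (auto simp: sym_tensor_def Var_def lookup_single when_def sum.delta)

lemma sym_tensor_power: "sym_tensor d a f \<Longrightarrow> sym_tensor d (k * a) (f ^ k)"
  by (induction k) (auto intro: sym_tensor_mult)

lemma sym_tensor_prod: "finite S \<Longrightarrow> (\<And>x. x \<in> S \<Longrightarrow> sym_tensor d (a x) (f x)) \<Longrightarrow> sym_tensor d (sum a S) (prod f S)"
  by (induction S rule: finite_induct) (auto intro: sym_tensor_mult)

lemma sym_tensor_uminus: "sym_tensor d n f \<Longrightarrow> sym_tensor d n (- f)"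
  by (simp add: sym_tensor_def)

lemma sym_tensor_diff: "sym_tensor d n f \<Longrightarrow> sym_tensor d n g \<Longrightarrow> sym_tensor d n (f - g)"
  using sym_tensor_add[OF _ sym_tensor_uminus] by (metis add_uminus_conv_diff)

lemma sym_tensor_partial: assumes "sym_tensor d n f" shows "sym_tensor d (n - 1) (partial i f)"
  unfolding sym_tensor_def
proof
  fix m assume "m \<in> supp (partial i f)"
  then have mm: "m + ex i \<in> supp f" by (auto simp: in_keys_iff lookup_partial)
  then have 1: "supp (m + ex i) \<subseteq> {..<d}" "(\<Sum>j<d. lk (m + ex i) j) = n"
    using assms by (auto simp: sym_tensor_def)
  have 2: "supp m \<subseteq> supp (m + ex i)" by (auto simp: in_keys_iff lookup_add)
  have 3: "i \<in> supp (m + ex i)" by (auto simp: in_keys_iff lookup_add)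
  then have "i < d" using 1 by auto
  then have "(\<Sum>j<d. lk (m + ex i) j) = (\<Sum>j<d. lk m j) + 1"
    by (simp add: lookup_add lookup_single when_def sum.distrib sum.delta)
  then show "supp m \<subseteq> {..<d} \<and> (\<Sum>j<d. lk m j) = n - 1" using 1 2 by auto
qed

lemma euler: assumes "sym_tensor d n f" shows "(\<Sum>i<d. Var i * partial i f) = of_nat n * f"
proof (rule poly_mapping_eqI)
  fix m
  have "lk (\<Sum>i<d. Var i * partial i f) m = of_nat (\<Sum>i<d. lk m i) * lk f m"
    by (simp add: lookup_sum lookup_Var_mult_partial sum_distrib_right)
  also have "\<dots> = of_nat n * lk f m"
    using assms by (cases "m \<in> supp f") (auto simp: sym_tensor_def in_keys_iff)
  also have "\<dots> = lk (of_nat n * f) m" by (metis Const.hom_of_nat lookup_Const_mult)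
  finally show "lk (\<Sum>i<d. Var i * partial i f) m = lk (of_nat n * f) m" .
qed

lemma sym_tensor_0D: assumes "sym_tensor d 0 f" shows "f = Const (lk f 0)"
proof (rule poly_mapping_eqI)
  fix m
  have "m = 0" if "m \<in> supp f"
  proof (rule poly_mapping_eqI)
    fix i show "lk m i = lk 0 i"
      using sym_tensorD(2)[OF assms that] sym_tensorD(3)[OF assms that, of i] by (cases "i < d") auto
  qed
  then show "lk f m = lk (Const (lk f 0)) m" by (auto simp: lookup_Const in_keys_iff)
qed

section \<open>Evaluation\<close>

definition ev :: "(nat \<Rightarrow> complex) \<Rightarrow> cpoly \<Rightarrow> complex" where "ev x = msub (\<lambda>a. a) x"

lemma comm_ring_hom_id: "comm_ring_hom (\<lambda>a. a)" by unfold_locales auto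

interpretation ev: comm_ring_hom "ev x" for x
  unfolding ev_def by (rule comm_ring_hom_msub[OF comm_ring_hom_id])

lemma ev_Const [simp]: "ev x (Const a) = a" by (simp add: ev_def msub_Const[OF comm_ring_hom_id])
lemma ev_Var [simp]: "ev x (Var i) = x i" by (simp add: ev_def msub_Var[OF comm_ring_hom_id])

lemma ev_scale: assumes "sym_tensor d n f" shows "ev (\<lambda>i. s * x i) f = s ^ n * ev x f"
proof -
  have "monom_val (\<lambda>i. s * x i) m = s ^ n * monom_val x m" if "m \<in> supp f" for m
  proof -
    have m: "supp m \<subseteq> {..<d}" "(\<Sum>j<d. lk m j) = n" using assms that by (auto simp: sym_tensor_def)
    show ?thesis using m(2)
      by (simp add: monom_val_superset[OF _ m(1)] power_mult_distrib prod.distrib flip: power_sum)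
  qed
  then show ?thesis by (simp add: ev_def msub_def sum_distrib_left algebra_simps)
qed

lemma ev_cong: assumes "sym_tensor d n f" "\<And>i. i < d \<Longrightarrow> x i = y i" shows "ev x f = ev y f"
proof -
  have "monom_val x m = monom_val y m" if "m \<in> supp f" for m
    unfolding monom_val_def by (rule prod.cong) (use assms(2) sym_tensorD(1)[OF assms(1) that] in auto)
  then show ?thesis by (simp add: ev_def msub_def)
qed

text \<open>
  The restriction of a polynomial to the line \<open>x + t v\<close>, as a polynomial in \<open>t\<close>.\<close>
definition evline :: "(nat \<Rightarrow> complex) \<Rightarrow> (nat \<Rightarrow> complex) \<Rightarrow> cpoly \<Rightarrow> complex poly" where
  "evline x v = msub (\<lambda>a. [:a:]) (\<lambda>i. [:x i, v i:])"

lemma comm_ring_hom_pC: "comm_ring_hom (\<lambda>a::'a::comm_ring_1. [:a:])"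
  by unfold_locales (auto simp: one_pCons)

interpretation evline: comm_ring_hom "evline x v" for x v
  unfolding evline_def by (rule comm_ring_hom_msub[OF comm_ring_hom_pC])

lemma evline_Const [simp]: "evline x v (Const a) = [:a:]" by (simp add: evline_def msub_Const[OF comm_ring_hom_pC])
lemma evline_Var [simp]: "evline x v (Var i) = [:x i, v i:]" by (simp add: evline_def msub_Var[OF comm_ring_hom_pC])

lemma poly_evline: "poly (evline x v f) t = ev (\<lambda>i. x i + t * v i) f"
  by (induction f rule: cpoly_induct) (simp_all add: evline.hom_add evline.hom_mult ev.hom_add ev.hom_mult)

text \<open>
  The derivative is the linear coefficient of the restriction to a coordinate line.\<close>
lemma coeff_evline_ex: "coeff (evline x (\<lambda>j. if j = i then 1 else 0) f) 1 = ev x (partial i f)"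
proof (induction f rule: cpoly_induct)
  case (mult f g)
  have "coeff (evline x (\<lambda>j. if j = i then 1 else 0) f) 0 = ev x f" for f
    using poly_evline[of x "\<lambda>j. if j = i then 1 else 0" f 0] by (simp add: poly_0_coeff_0)
  with mult show ?case
    by (simp add: evline.hom_mult coeff_mult partial_mult ev.hom_mult ev.hom_add One_nat_def)
qed (simp_all add: evline.hom_add ev.hom_add partial_add partial_Var One_nat_def)

lemma ev_eq_0_partial: assumes "\<And>x. ev x f = 0" shows "ev x (partial i f) = 0"
proof -
  have "evline x (\<lambda>j. if j = i then 1 else 0) f = 0"
    by (rule poly_all_0_iff_0[THEN iffD1]) (simp add: poly_evline assms)
  then show ?thesis by (metis coeff_0 coeff_evline_ex)
qed

text \<open>
  If all values of \<open>f\<close> vanish, so do those of its partial derivatives, whose degree is smaller; hence \<open>f\<close> is constant by induction on the degree.\<close>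
lemma ev_inj0: assumes "\<And>x. ev x f = 0" shows "f = 0"
proof -
  have "finite (supp f)" by simp
  obtain D where D: "\<And>m. m \<in> supp f \<Longrightarrow> (\<Sum>i\<in>supp m. lk m i) \<le> D"
    using finite_nat_set_iff_bounded_le[of "(\<lambda>m. \<Sum>i\<in>supp m. lk m i) ` supp f"] by auto
  then show ?thesis using assms
  proof (induction D arbitrary: f)
    case 0
    have "lk f m = 0" if "m \<noteq> 0" for m
    proof (rule ccontr)
      assume "lk f m \<noteq> 0"
      with 0(1)[of m] have "\<forall>i\<in>supp m. lk m i = 0" by (auto simp: in_keys_iff)
      then have "\<And>i. lk m i = 0" by (metis in_keys_iff)
      with poly_mapping_eqI[of m 0] that show False by simp
    qed
    then have f: "f = Const (lk f 0)" by (intro poly_mapping_eqI) (auto simp: lookup_Const)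
    with 0(2)[of "\<lambda>_. 0"] show ?case by (metis Const_0 ev_Const)
  next
    case (Suc D)
    have p: "partial i f = 0" for i
    proof (rule Suc.IH)
      fix m assume "m \<in> supp (partial i f)"
      then have "m + ex i \<in> supp f" by (auto simp: in_keys_iff lookup_partial)
      then have le: "(\<Sum>j\<in>supp (m + ex i). lk (m + ex i) j) \<le> Suc D" by (rule Suc.prems(1))
      have "(\<Sum>j\<in>supp (m + ex i). lk (m + ex i) j) = (\<Sum>j\<in>supp (m + ex i). lk m j) + 1"
        by (simp add: lookup_add lookup_single when_def sum.distrib sum.delta in_keys_iff)
      moreover have "(\<Sum>j\<in>supp (m + ex i). lk m j) = (\<Sum>j\<in>supp m. lk m j)"
        by (rule sum.mono_neutral_right) (auto simp: in_keys_iff lookup_add)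
      ultimately show "(\<Sum>j\<in>supp m. lk m j) \<le> D" using le by simp
    qed (use ev_eq_0_partial Suc.prems(2) in blast)
    have "lk f m = 0" if "m \<noteq> 0" for m
    proof -
      obtain i where i: "lk m i \<noteq> 0" using poly_mapping_eqI[of m 0] \<open>m \<noteq> 0\<close> by auto
      have "lk (partial i f) (m - ex i) = of_nat (lk m i) * lk f m"
        using i by (simp add: lookup_partial ex_cancel lookup_minus)
      with p i show ?thesis by simp
    qed
    then have f: "f = Const (lk f 0)" by (intro poly_mapping_eqI) (auto simp: lookup_Const)
    with Suc.prems(2)[of "\<lambda>_. 0"] show ?case by (metis Const_0 ev_Const)
  qed
qed

lemma ev_inj: assumes "\<And>x. ev x f = ev x g" shows "f = g"
  using ev_inj0[of "f - g"] assms by (simp add: ev.hom_minus)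

section \<open>Linear substitutions and the Hessian\<close>

definition lform :: "nat \<Rightarrow> (nat \<Rightarrow> complex) \<Rightarrow> cpoly" where
  "lform d a = (\<Sum>j<d. Const (a j) * Var j)"

lemma sym_tensor_lform [simp]: "sym_tensor d 1 (lform d a)"
  unfolding lform_def by (intro sym_tensor_sum sym_tensor_Const_mult sym_tensor_Var) simp

lemma ev_lform: "ev x (lform d a) = (\<Sum>j<d. a j * x j)"
  by (simp add: lform_def ev.hom_sum ev.hom_mult)

lemma partial_lform: "i < d \<Longrightarrow> partial i (lform d a) = Const (a i)"
  by (simp add: lform_def partial_sum partial_Const_mult partial_Var if_distrib sum.delta cong: if_cong)

lemma lform_cong: "(\<And>i. i < d \<Longrightarrow> a i = b i) \<Longrightarrow> lform d a = lform d b"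
  by (simp add: lform_def)

lemma sym_tensor_1_lform:
  assumes "sym_tensor d 1 l" obtains a where "l = lform d a"
proof -
  have "l = (\<Sum>i<d. Var i * partial i l)" using euler[OF assms] by simp
  also have "\<dots> = lform d (\<lambda>i. lk (partial i l) 0)"
    unfolding lform_def
  proof (rule sum.cong[OF refl])
    fix i
    have "sym_tensor d 0 (partial i l)" using sym_tensor_partial[OF assms, of i] by simp
    then show "Var i * partial i l = Const (lk (partial i l) 0) * Var i"
      using sym_tensor_0D by (metis mult.commute)
  qed
  finally show ?thesis using that by blast
qed

lemma lform_eq_0_iff: "lform d a = 0 \<longleftrightarrow> (\<forall>i<d. a i = 0)"
proof
  assume "lform d a = 0"
  then show "\<forall>i<d. a i = 0" using partial_lform[of _ d a] by (metis Const_eq_0_iff partial_0)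
qed (simp add: lform_def)

text \<open>
  Indices outside the \<open>d\<close> variables get the value 1, because \<open>lin_subst\<close> drops those variables from every monomial.
  With this value \<open>lin_subst\<close> is a ring homomorphism on all polynomials.\<close>
definition subst_value :: "nat \<Rightarrow> complex mat \<Rightarrow> nat \<Rightarrow> cpoly" where
  "subst_value d A i = (if i < d then lform d (\<lambda>j. A $$ (i, j)) else 1)"

lemma lin_subst_msub: "lin_subst d A = msub Const (subst_value d A)"
proof
  fix f
  have "(\<Prod>i<d. (\<Sum>j<d. Const (A $$ (i, j)) * Var j) ^ lk m i) = monom_val (subst_value d A) m" for m
  proof -
    let ?K = "supp m \<union> {..<d}"
    have "monom_val (subst_value d A) m = (\<Prod>i\<in>?K. subst_value d A i ^ lk m i)"
      by (rule monom_val_superset) auto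
    also have "\<dots> = (\<Prod>i<d. subst_value d A i ^ lk m i)"
      by (rule prod.mono_neutral_right) (auto simp: subst_value_def)
    finally show ?thesis by (simp add: subst_value_def lform_def)
  qed
  then show "lin_subst d A f = msub Const (subst_value d A) f"
    by (simp add: lin_subst_def msub_def)
qed

lemma comm_ring_hom_Const: "comm_ring_hom Const" by unfold_locales

lemma comm_ring_hom_LS: "comm_ring_hom (lin_subst d A)"
  unfolding lin_subst_msub by (rule comm_ring_hom_msub[OF comm_ring_hom_Const])

interpretation LS: comm_ring_hom "lin_subst d A" for d A by (rule comm_ring_hom_LS)

lemma LS_Const [simp]: "lin_subst d A (Const a) = Const a"
  by (simp add: lin_subst_msub msub_Const[OF comm_ring_hom_Const])

lemma LS_Var: "i < d \<Longrightarrow> lin_subst d A (Var i) = lform d (\<lambda>j. A $$ (i, j))"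
  by (simp add: lin_subst_msub msub_Var[OF comm_ring_hom_Const] subst_value_def)

lemma LS_Var': "lin_subst d A (Var i) = subst_value d A i"
  by (simp add: lin_subst_msub msub_Var[OF comm_ring_hom_Const] subst_value_def)

lemma LS_lform: "lin_subst d A (lform d a) = lform d (\<lambda>j. \<Sum>i<d. a i * A $$ (i, j))"
proof -
  have "lin_subst d A (lform d a) = (\<Sum>i<d. \<Sum>j<d. Const (a i * A $$ (i, j)) * Var j)"
    by (simp add: lform_def LS.hom_sum LS.hom_mult LS_Var sum_distrib_left Const_mult mult.assoc)
  also have "\<dots> = lform d (\<lambda>j. \<Sum>i<d. a i * A $$ (i, j))"
    by (subst sum.swap) (simp add: lform_def Const.hom_sum sum_distrib_right)
  finally show ?thesis .
qed

lemma LS_comp: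
  assumes "A \<in> carrier_mat d d" "B \<in> carrier_mat d d"
  shows "lin_subst d B (lin_subst d A f) = lin_subst d (A * B) f"
proof (rule hom_eqI[OF comm_ring_hom_comp[OF comm_ring_hom_LS comm_ring_hom_LS] comm_ring_hom_LS])
  fix i
  show "lin_subst d B (lin_subst d A (Var i)) = lin_subst d (A * B) (Var i)"
  proof (cases "i < d")
    case True
    then show ?thesis using assms
      by (simp add: LS_Var LS_lform) (auto intro!: lform_cong sum.cong simp: scalar_prod_def atLeast0LessThan)
  qed (simp add: LS_Var' subst_value_def)
qed simp

lemma sym_tensor_LS: assumes "sym_tensor d n f" shows "sym_tensor d n (lin_subst d A f)"
  unfolding lin_subst_def
proof (intro sym_tensor_sum sym_tensor_Const_mult)
  fix m assume m: "m \<in> supp f"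
  have "sym_tensor d (\<Sum>i<d. lk m i * 1) (\<Prod>i<d. (\<Sum>j<d. Const (A $$ (i, j)) * Var j) ^ lk m i)"
    by (intro sym_tensor_prod sym_tensor_power) (simp_all flip: lform_def)
  then show "sym_tensor d n (\<Prod>i<d. (\<Sum>j<d. Const (A $$ (i, j)) * Var j) ^ lk m i)"
    using sym_tensorD(2)[OF assms m] by simp
qed

lemma ev_LS: assumes "sym_tensor d n f"
  shows "ev x (lin_subst d A f) = ev (\<lambda>i. \<Sum>j<d. A $$ (i, j) * x j) f"
proof -
  have "ev x (lin_subst d A f) = ev (\<lambda>i. if i < d then \<Sum>j<d. A $$ (i, j) * x j else 1) f"
  proof (rule hom_eqI[OF comm_ring_hom_comp[OF ev.comm_ring_hom_axioms comm_ring_hom_LS] ev.comm_ring_hom_axioms])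
    fix i show "ev x (lin_subst d A (Var i)) = ev (\<lambda>i. if i < d then \<Sum>j<d. A $$ (i, j) * x j else 1) (Var i)"
      by (simp add: LS_Var' subst_value_def ev_lform)
  qed simp_all
  also have "\<dots> = ev (\<lambda>i. \<Sum>j<d. A $$ (i, j) * x j) f"
    by (rule ev_cong[OF assms]) simp
  finally show ?thesis .
qed

lemma LS_one: assumes "sym_tensor d n f" shows "lin_subst d (1\<^sub>m d) f = f"
proof (rule ev_inj)
  fix x
  show "ev x (lin_subst d (1\<^sub>m d) f) = ev x f"
    unfolding ev_LS[OF assms] by (rule ev_cong[OF assms]) (simp add: if_distrib if_distribR sum.delta cong: if_cong)
qed

text \<open>
  Both sides are derivations along the substitution homomorphism, so agreement on variables suffices.\<close>
lemma chain_rule: assumes "j < d"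
  shows "partial j (lin_subst d A f) = (\<Sum>i<d. Const (A $$ (i, j)) * lin_subst d A (partial i f))"
proof (induction f rule: cpoly_induct)
  case (Var k)
  show ?case
  proof (cases "k < d")
    case True
    then show ?thesis using assms
      by (simp add: LS_Var partial_lform partial_Var if_distrib sum.delta cong: if_cong)
  qed (auto simp: LS_Var' subst_value_def partial_Var)
next
  case (mult f g)
  then show ?case
    by (simp add: LS.hom_mult LS.hom_add partial_mult sum_distrib_left sum_distrib_right sum.distrib algebra_simps)
qed (simp_all add: LS.hom_add partial_add sum.distrib algebra_simps)

abbreviation cmat :: "complex mat \<Rightarrow> cpoly mat" where "cmat A \<equiv> map_mat Const A"

definition hess_mat :: "nat \<Rightarrow> cpoly \<Rightarrow> cpoly mat" where
  "hess_mat d f = mat d d (\<lambda>(i, j). partial i (partial j f))"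

lemma hess_mat_carrier [simp]: "hess_mat d f \<in> carrier_mat d d" by (simp add: hess_mat_def)
lemma Hess_det: "Hess d f = det (hess_mat d f)" by (simp add: Hess_def hess_mat_def)

lemma hess_mat_LS: assumes A: "A \<in> carrier_mat d d"
  shows "hess_mat d (lin_subst d A f) = (cmat A)\<^sup>T * map_mat (lin_subst d A) (hess_mat d f) * cmat A"
proof (rule eq_matI)
  fix i j assume "i < dim_row ((cmat A)\<^sup>T * map_mat (lin_subst d A) (hess_mat d f) * cmat A)"
    "j < dim_col ((cmat A)\<^sup>T * map_mat (lin_subst d A) (hess_mat d f) * cmat A)"
  then have ij: "i < d" "j < d" using A by auto
  have "partial i (partial j (lin_subst d A f)) = (\<Sum>k<d. \<Sum>l<d. Const (A $$ (k, j)) * (Const (A $$ (l, i)) * lin_subst d A (partial l (partial k f))))"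
    using ij by (simp add: chain_rule partial_sum partial_Const_mult sum_distrib_left)
  then have L: "hess_mat d (lin_subst d A f) $$ (i, j) = (\<Sum>k<d. \<Sum>l<d. Const (A $$ (k, j)) * (Const (A $$ (l, i)) * lin_subst d A (partial l (partial k f))))"
    using ij by (simp add: hess_mat_def)
  have R: "((cmat A)\<^sup>T * map_mat (lin_subst d A) (hess_mat d f) * cmat A) $$ (i, j)
      = (\<Sum>k<d. (\<Sum>l<d. Const (A $$ (l, i)) * lin_subst d A (partial l (partial k f))) * Const (A $$ (k, j)))"
    using A ij by (simp add: hess_mat_def scalar_prod_def atLeast0LessThan)
  show "hess_mat d (lin_subst d A f) $$ (i, j) = ((cmat A)\<^sup>T * map_mat (lin_subst d A) (hess_mat d f) * cmat A) $$ (i, j)"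
    unfolding L R sum_distrib_right by (intro sum.cong refl) (rule mult.commute)
qed (use A in \<open>auto simp: hess_mat_def\<close>)

text \<open>
  The chain rule applied twice gives \<open>A\<^sup>T (H \<circ> A) A\<close> for the Hessian matrix.\<close>
lemma Hess_LS: assumes A: "A \<in> carrier_mat d d"
  shows "Hess d (lin_subst d A f) = Const (det A ^ 2) * lin_subst d A (Hess d f)"
proof -
  have "Hess d (lin_subst d A f) = det ((cmat A)\<^sup>T) * det (map_mat (lin_subst d A) (hess_mat d f)) * det (cmat A)"
    unfolding Hess_det hess_mat_LS[OF A] using A
    by (subst det_mult[of _ d], simp, simp, subst det_mult[of _ d]) simp_all
  also have "\<dots> = Const (det A ^ 2) * lin_subst d A (Hess d f)"
    using A by (simp add: det_transpose[of _ d] Hess_det power2_eq_square Const_mult mult.assoc mult.left_commute mult.commute)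
  finally show ?thesis .
qed

lemma ex_inverse: fixes A :: "complex mat" assumes "A \<in> carrier_mat d d" "det A \<noteq> 0"
  obtains B where "B \<in> carrier_mat d d" "A * B = 1\<^sub>m d" "B * A = 1\<^sub>m d" "det B \<noteq> 0"
proof -
  from det_non_zero_imp_unit[OF assms, of "()"] obtain B where B: "B \<in> carrier_mat d d" "A * B = 1\<^sub>m d" "B * A = 1\<^sub>m d"
    by (auto simp: Units_def ring_mat_def)
  have "det A * det B = 1" using det_mult[OF assms(1) B(1)] B(2) by simp
  then have "det B \<noteq> 0" by auto
  with B that show ?thesis by blast
qed

lemma invertible_mat_iff_det: fixes A :: "complex mat" assumes "A \<in> carrier_mat d d"
  shows "invertible_mat A \<longleftrightarrow> det A \<noteq> 0"
proof
  assume "det A \<noteq> 0"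
  then obtain B where "B \<in> carrier_mat d d" "A * B = 1\<^sub>m d" "B * A = 1\<^sub>m d"
    using ex_inverse[OF assms] by blast
  then show "invertible_mat A" using assms by (auto simp: invertible_mat_def inverts_mat_def intro!: exI[of _ B])
next
  assume "invertible_mat A"
  then obtain B where B: "A * B = 1\<^sub>m d" "B * A = 1\<^sub>m (dim_row B)"
    using assms by (auto simp: invertible_mat_def inverts_mat_def)
  have dB: "dim_col B = d" using B(1) by (metis index_mult_mat(3) index_one_mat(3))
  have "dim_row B = d" using B(2) assms by (metis carrier_matD(2) index_mult_mat(3) index_one_mat(3))
  then have "B \<in> carrier_mat d d" using dB by auto
  then have "det A * det B = 1" using det_mult[OF assms] B(1) by (metis det_one)
  then show "det A \<noteq> 0" by auto
qed

lemma GL_equiv_iff: "GL_equiv d f h \<longleftrightarrow> (\<exists>A \<in> carrier_mat d d. det A \<noteq> 0 \<and> f = lin_subst d A h)"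
  unfolding GL_equiv_def using invertible_mat_iff_det by blast

lemma LS_inverse:
  assumes "A \<in> carrier_mat d d" "B \<in> carrier_mat d d" "A * B = 1\<^sub>m d" "sym_tensor d n f"
  shows "lin_subst d B (lin_subst d A f) = f"
  by (simp add: LS_comp[OF assms(1,2)] assms(3) LS_one[OF assms(4)])

lemma GL_equiv_LS: assumes "GL_equiv d f h" "A \<in> carrier_mat d d" "det A \<noteq> 0"
  shows "GL_equiv d (lin_subst d A f) h"
proof -
  obtain B where B: "B \<in> carrier_mat d d" "det B \<noteq> 0" "f = lin_subst d B h"
    using assms(1) GL_equiv_iff by blast
  then show ?thesis using assms unfolding GL_equiv_iff
    by (intro bexI[of _ "B * A"]) (auto simp: LS_comp det_mult)
qed

text \<open>
  Equivalence may be tested after any invertible change of variables.\<close>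
lemma GL_equiv_LS_cancel: assumes "GL_equiv d (lin_subst d A f) h" "A \<in> carrier_mat d d" "det A \<noteq> 0" "sym_tensor d n f"
  shows "GL_equiv d f h"
proof -
  obtain B where B: "B \<in> carrier_mat d d" "A * B = 1\<^sub>m d" "det B \<noteq> 0"
    using ex_inverse[OF assms(2,3)] by blast
  show ?thesis using GL_equiv_LS[OF assms(1) B(1,3)] LS_inverse[OF assms(2) B(1,2) assms(4)] by simp
qed

lemma LS_eq_0_iff: assumes "A \<in> carrier_mat d d" "det A \<noteq> 0" "sym_tensor d n f"
  shows "lin_subst d A f = 0 \<longleftrightarrow> f = 0"
proof -
  obtain B where B: "B \<in> carrier_mat d d" "A * B = 1\<^sub>m d" "det B \<noteq> 0"
    using ex_inverse[OF assms(1,2)] by blast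
  show ?thesis using LS_inverse[OF assms(1) B(1,2) assms(3)] by auto
qed

lemma sym_tensor_Hess: assumes "sym_tensor d n f" shows "sym_tensor d (d * (n - 2)) (Hess d f)"
proof -
  have "sym_tensor d (n - 2) (partial i (partial j f))" for i j
    using sym_tensor_partial[OF sym_tensor_partial[OF assms]] by (metis diff_diff_left nat_1_add_1)
  then have e: "sym_tensor d (\<Sum>i\<in>{0..<d}. n - 2) (\<Prod>i = 0..<d. hess_mat d f $$ (i, p i))" if "p permutes {0..<d}" for p
    using that by (intro sym_tensor_prod) (auto simp: hess_mat_def permutes_in_image)
  have s: "sym_tensor d k (signof p * g)" if "sym_tensor d k g" for k p g
    using that by (auto simp: sign_def sym_tensor_uminus)
  show ?thesis unfolding Hess_det det_def'[OF hess_mat_carrier]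
    by (intro sym_tensor_sum s) (use e in simp)
qed

lemma Hess_Const_mult: "Hess d (Const c * f) = Const (c ^ d) * Hess d f"
proof -
  have "hess_mat d (Const c * f) = Const c \<cdot>\<^sub>m hess_mat d f"
    by (rule eq_matI) (auto simp: hess_mat_def partial_Const_mult)
  then show ?thesis by (simp add: Hess_det det_smult Const.hom_power) (simp add: hess_mat_def)
qed

section \<open>Directional derivatives and conciseness\<close>

lemma dir_deriv_LS: assumes "A \<in> carrier_mat d d" "u \<in> carrier_vec d"
  shows "dir_deriv d u (lin_subst d A f) = lin_subst d A (dir_deriv d (A *\<^sub>v u) f)"
proof -
  have "dir_deriv d u (lin_subst d A f) = (\<Sum>j<d. \<Sum>i<d. Const (u $ j * A $$ (i, j)) * lin_subst d A (partial i f))"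
    unfolding dir_deriv_def by (rule sum.cong) (auto simp: chain_rule sum_distrib_left Const_mult mult.assoc)
  also have "\<dots> = (\<Sum>i<d. \<Sum>j<d. Const (u $ j * A $$ (i, j)) * lin_subst d A (partial i f))"
    by (rule sum.swap)
  also have "\<dots> = (\<Sum>i<d. Const ((A *\<^sub>v u) $ i) * lin_subst d A (partial i f))"
    using assms by (intro sum.cong) (auto simp: scalar_prod_def Const.hom_sum sum_distrib_right atLeast0LessThan mult.commute sum_distrib_left)
  finally show ?thesis by (simp add: dir_deriv_def LS.hom_sum LS.hom_mult)
qed

lemma sym_tensor_dir_deriv: "sym_tensor d n f \<Longrightarrow> sym_tensor d (n - 1) (dir_deriv d u f)"
  unfolding dir_deriv_def by (intro sym_tensor_sum sym_tensor_Const_mult sym_tensor_partial)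

lemma dir_deriv_add: "u \<in> carrier_vec d \<Longrightarrow> v \<in> carrier_vec d \<Longrightarrow>
  dir_deriv d (u + v) f = dir_deriv d u f + dir_deriv d v f"
  by (simp add: dir_deriv_def Const_add distrib_right sum.distrib)

lemma dir_deriv_smult: "v \<in> carrier_vec d \<Longrightarrow>
  dir_deriv d (s \<cdot>\<^sub>v v) f = Const s * dir_deriv d v f"
  by (simp add: dir_deriv_def Const_mult sum_distrib_left mult.assoc)

lemma dir_deriv_unit: "i < d \<Longrightarrow> dir_deriv d (unit_vec d i) f = partial i f"
  by (simp add: dir_deriv_def unit_vec_def if_distrib if_distribR sum.delta cong: if_cong)

lemma concise_iff: "concise d f \<longleftrightarrow> (\<forall>u\<in>carrier_vec d. dir_deriv d u f = 0 \<longrightarrow> u = 0\<^sub>v d)"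
proof
  assume c: "concise d f"
  show "\<forall>u\<in>carrier_vec d. dir_deriv d u f = 0 \<longrightarrow> u = 0\<^sub>v d"
  proof (intro ballI impI eq_vecI)
    fix u i assume "u \<in> carrier_vec d" "dir_deriv d u f = 0" "i < dim_vec (0\<^sub>v d :: complex vec)"
    then show "u $ i = 0\<^sub>v d $ i" using c[unfolded concise_def, rule_format, of "\<lambda>i. u $ i" i]
      by (simp add: dir_deriv_def)
  qed auto
next
  assume R: "\<forall>u\<in>carrier_vec d. dir_deriv d u f = 0 \<longrightarrow> u = 0\<^sub>v d"
  show "concise d f" unfolding concise_def
  proof (intro allI impI)
    fix c i assume z: "(\<Sum>i<d. Const (c i) * partial i f) = 0" and i: "i < d"
    have "dir_deriv d (vec d c) f = 0" using z by (simp add: dir_deriv_def)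
    then have "vec d c = 0\<^sub>v d" using R by simp
    then show "c i = 0" using i by (metis index_vec index_zero_vec(1))
  qed
qed

lemma concise_LS: assumes "A \<in> carrier_mat d d" "concise d (lin_subst d A f)" shows "det A \<noteq> 0"
proof
  assume "det A = 0"
  then obtain v where v: "v \<in> carrier_vec d" "v \<noteq> 0\<^sub>v d" "A *\<^sub>v v = 0\<^sub>v d"
    using det_0_iff_vec_prod_zero_field[OF assms(1)] by blast
  have "dir_deriv d v (lin_subst d A f) = 0"
    unfolding dir_deriv_LS[OF assms(1) v(1)] v(3) by (simp add: dir_deriv_def)
  then show False using assms(2) v by (simp add: concise_iff)
qed

text \<open>
  A relation between the first derivatives, differentiated once more, is a kernel vector of the Hessian matrix.\<close>
lemma Hess_concise: assumes "Hess d f \<noteq> 0" shows "concise d f"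
  unfolding concise_iff
proof (intro ballI impI, rule ccontr)
  fix u assume u: "u \<in> carrier_vec d" "dir_deriv d u f = 0" "u \<noteq> 0\<^sub>v d"
  let ?v = "map_vec Const u"
  have "hess_mat d f *\<^sub>v ?v = 0\<^sub>v d"
  proof (rule eq_vecI)
    fix i assume "i < dim_vec (0\<^sub>v d :: cpoly vec)"
    then have i: "i < d" by simp
    have "(hess_mat d f *\<^sub>v ?v) $ i = (\<Sum>j<d. partial i (partial j f) * Const (u $ j))"
      using i u(1) by (auto simp: hess_mat_def scalar_prod_def atLeast0LessThan)
    also have "\<dots> = partial i (dir_deriv d u f)"
      by (simp add: dir_deriv_def partial_sum partial_Const_mult) (intro sum.cong refl, rule mult.commute)
    finally have "(hess_mat d f *\<^sub>v ?v) $ i = partial i (dir_deriv d u f)" .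
    then show "(hess_mat d f *\<^sub>v ?v) $ i = 0\<^sub>v d $ i" using u(2) i by simp
  qed (simp add: hess_mat_def)
  moreover have "?v \<noteq> 0\<^sub>v d"
  proof
    assume v0: "?v = 0\<^sub>v d"
    have "u = 0\<^sub>v d"
    proof (rule eq_vecI)
      fix i assume "i < dim_vec (0\<^sub>v d :: complex vec)"
      then have i: "i < d" by simp
      have "?v $ i = 0" unfolding v0 using i by simp
      then show "u $ i = 0\<^sub>v d $ i" using i u(1) by simp
    qed (use u in simp)
    with u show False by simp
  qed
  ultimately have "det (hess_mat d f) = 0"
    using det_0_iff_vec_prod_zero[OF hess_mat_carrier, of d f] u(1) by (metis map_carrier_vec)
  with assms show False by (simp add: Hess_det)
qed

text \<open>
  A nonzero row is completed by unit vectors, leaving out the one that belongs to its nonzero entry \<open>a k\<close>.\<close>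
lemma ex_invertible_first_row:
  assumes "k < d" "a k \<noteq> (0::complex)"
  obtains A where "A \<in> carrier_mat d d" "det A \<noteq> 0" "\<And>j. j < d \<Longrightarrow> A $$ (0, j) = a j"
proof -
  define A where "A = mat d d (\<lambda>(i, j). if i = 0 then a j else if i = k then (if j = 0 then 1 else 0) else if i = j then 1 else 0)"
  have A: "A \<in> carrier_mat d d" by (simp add: A_def)
  have "v = 0\<^sub>v d" if v: "v \<in> carrier_vec d" "A *\<^sub>v v = 0\<^sub>v d" for v
  proof -
    have e: "(\<Sum>j<d. A $$ (i, j) * v $ j) = 0" if "i < d" for i
    proof -
      have "(A *\<^sub>v v) $ i = 0" using v that by simp
      then show ?thesis using that A v(1) by (simp add: scalar_prod_def atLeast0LessThan)
    qed
    have 1: "v $ i = 0" if "i < d" "i \<noteq> 0" "i \<noteq> k" for i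
    proof -
      have "(\<Sum>j<d. A $$ (i, j) * v $ j) = (\<Sum>j<d. if j = i then v $ i else 0)"
        by (rule sum.cong) (use that in \<open>auto simp: A_def\<close>)
      then show ?thesis using e[OF that(1)] that(1) by simp
    qed
    have 2: "v $ 0 = 0" if "k \<noteq> 0"
    proof -
      have "(\<Sum>j<d. A $$ (k, j) * v $ j) = (\<Sum>j<d. if j = 0 then v $ 0 else 0)"
        by (rule sum.cong) (use that assms(1) in \<open>auto simp: A_def\<close>)
      then show ?thesis using e[OF assms(1)] assms(1) by simp
    qed
    have "(\<Sum>j<d. a j * v $ j) = (\<Sum>j<d. if j = k then a k * v $ k else 0)"
      by (rule sum.cong) (use 1 2 in auto)
    then have "v $ k = 0" using e[of 0] assms by (auto simp: A_def sum.delta)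
    then have "v $ i = 0" if "i < d" for i using 1[OF that] 2 by (cases "i = k"; cases "i = 0") auto
    then show ?thesis using v(1) by (intro eq_vecI) auto
  qed
  then have "det A \<noteq> 0" using det_0_iff_vec_prod_zero_field[OF A] by blast
  moreover have "A $$ (0, j) = a j" if "j < d" for j using that assms(1) by (simp add: A_def)
  ultimately show ?thesis using A that by blast
qed

lemma normalize_lform:
  assumes "sym_tensor d 1 l" "l \<noteq> 0"
  obtains B where "B \<in> carrier_mat d d" "det B \<noteq> 0" "lin_subst d B l = Var 0" "0 < d"
proof -
  obtain a where a: "l = lform d a" using sym_tensor_1_lform[OF assms(1)] .
  then obtain k where k: "k < d" "a k \<noteq> 0" using assms(2) lform_eq_0_iff by blast
  obtain A where A: "A \<in> carrier_mat d d" "det A \<noteq> 0" "\<And>j. j < d \<Longrightarrow> A $$ (0, j) = a j"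
    using ex_invertible_first_row[of k d a] k by blast
  have d: "0 < d" using k by simp
  have "lin_subst d A (Var 0) = l" using d by (simp add: LS_Var a A(3) cong: lform_cong)
  moreover obtain B where B: "B \<in> carrier_mat d d" "A * B = 1\<^sub>m d" "det B \<noteq> 0"
    using ex_inverse[OF A(1,2)] by blast
  ultimately have "lin_subst d B l = Var 0"
    using LS_inverse[OF A(1) B(1,2) sym_tensor_Var[OF d]] by simp
  with that B d show ?thesis by blast
qed

section \<open>Powers of linear forms\<close>

lemma complex_root_exists: assumes "0 < m" obtains z :: complex where "z ^ m = c"
proof -
  have "degree (monom 1 m + [:-c:]) = m" using assms
    by (subst degree_add_eq_left) (auto simp: degree_monom_eq)
  then have "\<not> constant (poly (monom 1 m + [:-c:]))"
    using assms by (simp add: constant_degree)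
  then obtain z where "poly (monom 1 m + [:-c:]) z = 0"
    using fundamental_theorem_of_algebra by blast
  then show ?thesis using that by (auto simp: poly_monom)
qed

text \<open>
  For \<open>m > 0\<close> a nonzero scalar factor is absorbed by the linear form, since \<open>\<complex>\<close> contains \<open>m\<close>-th roots.\<close>
lemma power_of_linear_form_iff:
  "power_of_linear_form d m h \<longleftrightarrow> (\<exists>l c. sym_tensor d 1 l \<and> l \<noteq> 0 \<and> c \<noteq> 0 \<and> h = Const c * l ^ m)"
proof
  assume "\<exists>l c. sym_tensor d 1 l \<and> l \<noteq> 0 \<and> c \<noteq> 0 \<and> h = Const c * l ^ m"
  then obtain l c where h: "sym_tensor d 1 l" "l \<noteq> 0" "c \<noteq> 0" "h = Const c * l ^ m" by blast
  show "power_of_linear_form d m h"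
  proof (cases "m = 0")
    case True
    with h show ?thesis unfolding power_of_linear_form_def by (intro exI[of _ l] exI[of _ c]) simp
  next
    case False
    then obtain z where z: "z ^ m = c" using complex_root_exists by auto
    with h False have "z \<noteq> 0" by auto
    have "h = Const 1 * (Const z * l) ^ m"
      by (simp add: h(4) power_mult_distrib flip: z Const.hom_power)
    with h \<open>z \<noteq> 0\<close> show ?thesis unfolding power_of_linear_form_def
      by (intro exI[of _ "Const z * l"] exI[of _ 1]) (auto intro: sym_tensor_Const_mult)
  qed
qed (auto simp: power_of_linear_form_def)

text \<open>
  The linear form becomes the first coordinate.\<close>
lemma hess_power_normalize:
  assumes "power_of_linear_form d (d * (n - 2)) (Hess d f)"
  obtains B c where "B \<in> carrier_mat d d" "det B \<noteq> 0" "c \<noteq> 0" "0 < d"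
    "Hess d (lin_subst d B f) = Const c * Var 0 ^ (d * (n - 2))"
proof -
  obtain l c where h: "sym_tensor d 1 l" "l \<noteq> 0" "c \<noteq> 0" "Hess d f = Const c * l ^ (d * (n - 2))"
    using assms power_of_linear_form_iff by blast
  obtain B where B: "B \<in> carrier_mat d d" "det B \<noteq> 0" "lin_subst d B l = Var 0" "0 < d"
    using normalize_lform[OF h(1,2)] .
  have "Hess d (lin_subst d B f) = Const (det B ^ 2 * c) * Var 0 ^ (d * (n - 2))"
    by (simp add: Hess_LS[OF B(1)] h(4) LS.hom_mult LS.hom_power B(3) Const_mult mult.assoc)
  moreover have "det B ^ 2 * c \<noteq> 0" using B h by simp
  ultimately show ?thesis using that B by blast
qed

lemma Var_neq_0 [simp]: "Var i \<noteq> 0"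
proof
  assume "Var i = 0"
  then have "ev (\<lambda>_. 1) (Var i) = 0" by (simp only: ev.hom_zero)
  then show False by simp
qed

section \<open>Hyperplanes as kernels of linear forms\<close>

text \<open>
  Hyperplanes are handled through their equations: \<open>ann d a\<close> is the kernel of the functional \<open>u \<mapsto> a \<bullet> u\<close>.\<close>
definition ann :: "nat \<Rightarrow> complex vec \<Rightarrow> complex vec set" where
  "ann d a = {u \<in> carrier_vec d. a \<bullet> u = 0}"

lemma submodule_ann: assumes a: "a \<in> carrier_vec d"
  shows "submodule class_ring (ann d a) (module_vec TYPE(complex) d)"
proof -
  interpret V: vec_space "TYPE(complex)" d .
  have add: "a \<bullet> (u + v) = a \<bullet> u + a \<bullet> v" if "u \<in> carrier_vec d" "v \<in> carrier_vec d" for u v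
    using scalar_prod_add_distrib[OF a that] .
  show ?thesis
    by unfold_locales (use a in \<open>auto simp: ann_def add module_vec_simps\<close>)
qed

text \<open>
  A maximal independent subset of \<open>S\<close> has fewer than \<open>d\<close> elements, because otherwise \<open>S\<close> would be the whole space.
  Written as the rows of a square matrix and padded with zero rows, it gives a singular matrix, and any kernel
  vector is an equation of \<open>S\<close>.\<close>
lemma hyperplane_subset_ann:
  assumes "hyperplane d S"
  obtains a where "a \<in> carrier_vec d" "a \<noteq> 0\<^sub>v d" "S \<subseteq> ann d a"
proof -
  interpret V: vec_space "TYPE(complex)" d .
  have sub: "VectorSpace.subspace class_ring S V.V" and dm: "vectorspace.dim class_ring (V.V\<lparr>carrier := S\<rparr>) + 1 = d"
    using assms by (auto simp: hyperplane_def)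
  have SC: "S \<subseteq> carrier_vec d" using sub unfolding VectorSpace.subspace_def submodule_def by auto
  let ?P = "\<lambda>B. finite B \<and> B \<subseteq> S \<and> V.lin_indpt B"
  have card_le: "card B \<le> d" if "?P B" for B
    using V.li_le_dim(2)[of B] that SC V.dim_is_n by auto
  have P0: "?P {}" by (auto simp: V.lin_dep_def)
  obtain B where B: "?P B" and Bmax: "\<And>C. ?P C \<Longrightarrow> card C \<le> card B"
  proof -
    have "\<forall>B. ?P B \<longrightarrow> card B < Suc d" using card_le by (auto simp: less_Suc_eq_le)
    from ex_has_greatest_nat[of ?P "{}" card "Suc d", OF P0 this] that show ?thesis by blast
  qed
  have BC: "B \<subseteq> carrier_vec d" using B SC by auto
  have span: "x \<in> V.span B" if "x \<in> S" for x
  proof (rule ccontr)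
    assume n: "x \<notin> V.span B"
    then have nB: "x \<notin> B" using V.in_own_span[OF BC] by auto
    have "V.lin_indpt (B \<union> {x})"
      using V.lin_dep_iff_in_span[of B x] BC B n nB that SC by auto
    then have "card (B \<union> {x}) \<le> card B" using B that by (intro Bmax) auto
    then show False using B nB by simp
  qed
  have cB: "card B < d"
  proof (rule ccontr)
    assume "\<not> card B < d"
    then have "card B = d" using card_le[OF B] by simp
    then have "V.basis B" using V.dim_li_is_basis[of B] B BC V.dim_is_n by auto
    then have "V.span B = carrier_vec d" by (auto simp: V.basis_def)
    moreover have "V.span B \<subseteq> S"
      by (rule V.span_is_subset) (use B sub in \<open>auto simp: VectorSpace.subspace_def\<close>)
    ultimately have SV: "S = carrier_vec d" using SC by auto
    have VV: "V.V\<lparr>carrier := carrier_vec d\<rparr> = V.V" by (simp add: module_vec_def)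
    show False using dm unfolding SV VV V.dim_is_n by simp
  qed
  obtain bs where bs: "set bs = B" "distinct bs" using finite_distinct_list B by blast
  have len: "length bs < d" using cB bs by (metis distinct_card)
  define M where "M = mat d d (\<lambda>(i, j). if i < length bs then (bs ! i) $ j else 0)"
  have M: "M \<in> carrier_mat d d" by (simp add: M_def)
  have "M\<^sup>T *\<^sub>v unit_vec d (d - 1) = 0\<^sub>v d"
    using len by (intro eq_vecI) (auto simp: M_def row_def scalar_prod_def unit_vec_def sum.delta intro!: sum.neutral)
  moreover have "unit_vec d (d - 1) \<noteq> (0\<^sub>v d :: complex vec)"
    using len unit_vec_nonzero[of "d - 1" d] by simp
  ultimately have "det (M\<^sup>T) = 0"
    using M by (subst det_0_iff_vec_prod_zero_field[of _ d]) (auto intro!: exI[of _ "unit_vec d (d - 1)"])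
  then have "det M = 0" using det_transpose[OF M] by simp
  then obtain a where a: "a \<in> carrier_vec d" "a \<noteq> 0\<^sub>v d" "M *\<^sub>v a = 0\<^sub>v d"
    using det_0_iff_vec_prod_zero_field[OF M] by blast
  have "b \<in> ann d a" if bB: "b \<in> B" for b
  proof -
    obtain i where i: "i < length bs" "bs ! i = b" using bB bs(1) by (metis in_set_conv_nth)
    have b: "b \<in> carrier_vec d" using bB BC by auto
    have "row M i = b" using i len b by (intro eq_vecI) (auto simp: M_def)
    moreover have "(M *\<^sub>v a) $ i = 0" using a(3) i len by simp
    ultimately have "b \<bullet> a = 0" using i len M by simp
    then show ?thesis using b comm_scalar_prod[OF b a(1)] by (simp add: ann_def)
  qed
  then have "V.span B \<subseteq> ann d a" by (intro V.span_is_subset submodule_ann a) auto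
  then have "S \<subseteq> ann d a" using span by auto
  with that a show ?thesis by blast
qed

text \<open>
  Rank and nullity of the functional \<open>u \<mapsto> a \<bullet> u\<close>, which is onto a one-dimensional space.\<close>
lemma hyperplane_ann:
  assumes a: "a \<in> carrier_vec d" "a \<noteq> 0\<^sub>v d" shows "hyperplane d (ann d a)"
proof -
  interpret V: vec_space "TYPE(complex)" d .
  interpret W: vec_space "TYPE(complex)" 1 .
  define T where "T = (\<lambda>u. vec 1 (\<lambda>_. a \<bullet> u))"
  have add: "a \<bullet> (u + v) = a \<bullet> u + a \<bullet> v" if "u \<in> carrier_vec d" "v \<in> carrier_vec d" for u v
    using scalar_prod_add_distrib[OF a(1) that] .
  have lin: "linear_map class_ring V.V W.V T"
    unfolding linear_map_def mod_hom_def mod_hom_axioms_def LinearCombinations.module_hom_def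
    using V.vectorspace_axioms W.vectorspace_axioms V.module_axioms W.module_axioms a
    by (auto simp: T_def module_vec_simps add intro!: eq_vecI)
  interpret L: linear_map class_ring V.V W.V T by (rule lin)
  obtain k where k: "k < d" "a $ k \<noteq> 0" using a
    by (metis carrier_vecD eq_vecI index_zero_vec(1) index_zero_vec(2))
  have ker: "L.ker = ann d a"
    unfolding L.ker_def by (auto simp: T_def ann_def module_vec_simps vec_eq_iff One_nat_def)
  have im: "L.im = carrier_vec 1"
  proof -
    have "w \<in> T ` carrier_vec d" if w: "w \<in> carrier_vec 1" for w
    proof
      show "w = T ((w $ 0 / a $ k) \<cdot>\<^sub>v unit_vec d k)"
        using k a w by (intro eq_vecI) (auto simp: T_def One_nat_def)
    qed simp
    moreover have "T ` carrier_vec d \<subseteq> carrier_vec 1" by (auto simp: T_def)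
    ultimately show ?thesis unfolding L.im_def by (auto simp: module_vec_simps)
  qed
  have WW: "W.V\<lparr>carrier := carrier_vec 1\<rparr> = W.V" by (simp add: module_vec_def)
  have "vectorspace.dim class_ring (W.V\<lparr>carrier := L.im\<rparr>) + vectorspace.dim class_ring (V.V\<lparr>carrier := L.ker\<rparr>) = V.dim"
    by (rule L.rank_nullity) simp
  then have "vectorspace.dim class_ring (V.V\<lparr>carrier := ann d a\<rparr>) + 1 = d"
    unfolding ker im WW V.dim_is_n W.dim_is_n by simp
  moreover have "VectorSpace.subspace class_ring (ann d a) V.V"
    using L.kerT_is_subspace by (simp add: ker)
  ultimately show ?thesis by (simp add: hyperplane_def)
qed

section \<open>Determinants of size at most four\<close>

text \<open>
  Laplace expansion along the first row, with minors again in the form of a \<open>mat\<close> expression.\<close>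
lemma det_mat_Suc:
  fixes F :: "nat \<times> nat \<Rightarrow> 'a::comm_ring_1"
  shows "det (mat (Suc n) (Suc n) F) =
    (\<Sum>j<Suc n. F (0, j) * ((-1) ^ j * det (mat n n (\<lambda>(i, k). F (Suc i, if k < j then k else Suc k)))))"
proof -
  have "det (mat (Suc n) (Suc n) F) = (\<Sum>j<Suc n. mat (Suc n) (Suc n) F $$ (0, j) * cofactor (mat (Suc n) (Suc n) F) 0 j)"
    by (rule laplace_expansion_row) auto
  also have "\<dots> = (\<Sum>j<Suc n. F (0, j) * ((-1) ^ j * det (mat n n (\<lambda>(i, k). F (Suc i, if k < j then k else Suc k)))))"
  proof (rule sum.cong[OF refl])
    fix j assume "j \<in> {..<Suc n}"
    moreover have "mat_delete (mat (Suc n) (Suc n) F) 0 j = mat n n (\<lambda>(i, k). F (Suc i, if k < j then k else Suc k))"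
      by (rule eq_matI) (auto simp: mat_delete_def)
    ultimately show "mat (Suc n) (Suc n) F $$ (0, j) * cofactor (mat (Suc n) (Suc n) F) 0 j
      = F (0, j) * ((-1) ^ j * det (mat n n (\<lambda>(i, k). F (Suc i, if k < j then k else Suc k))))"
      by (simp add: cofactor_def)
  qed
  finally show ?thesis .
qed

lemma det_mat_1: fixes F :: "nat \<times> nat \<Rightarrow> 'a::comm_ring_1" shows "det (mat 1 1 F) = F (0, 0)"
  by (subst det_single) auto

lemma det_mat_2: fixes F :: "nat \<times> nat \<Rightarrow> 'a::comm_ring_1"
  shows "det (mat 2 2 F) = F (0,0) * F (1,1) - F (0,1) * F (1,0)"
proof -
  have "Suc 1 = 2" "{..<2::nat} = {0,1}" by auto
  then show ?thesis using det_mat_Suc[of 1 F] by (simp add: det_mat_1 One_nat_def[symmetric])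
qed

lemma det_mat_3: fixes F :: "nat \<times> nat \<Rightarrow> 'a::comm_ring_1"
  shows "det (mat 3 3 F) = F (0,0) * (F (1,1) * F (2,2) - F (1,2) * F (2,1))
    - F (0,1) * (F (1,0) * F (2,2) - F (1,2) * F (2,0))
    + F (0,2) * (F (1,0) * F (2,1) - F (1,1) * F (2,0))"
proof -
  have "Suc 2 = 3" "{..<3::nat} = {0,1,2}" by auto
  then show ?thesis using det_mat_Suc[of 2 F]
    by (simp add: det_mat_2 One_nat_def[symmetric]) (simp add: right_diff_distrib)
qed

lemma det_mat_4: fixes F :: "nat \<times> nat \<Rightarrow> 'a::comm_ring_1"
  shows "det (mat 4 4 F) =
      F (0,0) * (F (1,1) * (F (2,2) * F (3,3) - F (2,3) * F (3,2))
        - F (1,2) * (F (2,1) * F (3,3) - F (2,3) * F (3,1)) + F (1,3) * (F (2,1) * F (3,2) - F (2,2) * F (3,1)))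
    - F (0,1) * (F (1,0) * (F (2,2) * F (3,3) - F (2,3) * F (3,2))
        - F (1,2) * (F (2,0) * F (3,3) - F (2,3) * F (3,0)) + F (1,3) * (F (2,0) * F (3,2) - F (2,2) * F (3,0)))
    + F (0,2) * (F (1,0) * (F (2,1) * F (3,3) - F (2,3) * F (3,1))
        - F (1,1) * (F (2,0) * F (3,3) - F (2,3) * F (3,0)) + F (1,3) * (F (2,0) * F (3,1) - F (2,1) * F (3,0)))
    - F (0,3) * (F (1,0) * (F (2,1) * F (3,2) - F (2,2) * F (3,1))
        - F (1,1) * (F (2,0) * F (3,2) - F (2,2) * F (3,0)) + F (1,2) * (F (2,0) * F (3,1) - F (2,1) * F (3,0)))"
proof -
  have "Suc 3 = 4" "{..<4::nat} = {0,1,2,3}" "Suc 2 = 3" by auto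
  then show ?thesis using det_mat_Suc[of 3 F]
    by (simp add: det_mat_3 One_nat_def[symmetric]) (simp add: right_diff_distrib distrib_left)
qed

section \<open>Quadratic forms\<close>

lemma quadratic_form:
  assumes "sym_tensor d 2 f"
  obtains A where "A \<in> carrier_mat d d" "A\<^sup>T = A"
    "f = (\<Sum>i<d. \<Sum>j<d. Const (A $$ (i, j)) * Var i * Var j)"
proof -
  have "sym_tensor d 1 (partial i f)" for i using sym_tensor_partial[OF assms, of i] by (simp add: One_nat_def)
  then have "\<exists>a. partial i f = lform d a" for i by (meson sym_tensor_1_lform)
  then obtain a where a: "\<And>i. partial i f = lform d (a i)" by metis
  have sym: "a i j = a j i" if "i < d" "j < d" for i j
    using partial_commute[of i j f] that by (simp add: a partial_lform)
  define A where "A = mat d d (\<lambda>(i, j). a i j / 2)"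
  have half: "Const (1/2) * (2 * g) = g" for g
    by (simp add: mult.assoc[symmetric] flip: Const.hom_numeral Const_mult)
  have "of_nat 2 * f = (\<Sum>i<d. Var i * lform d (a i))"
    using euler[OF assms] by (simp add: a)
  then have "f = Const (1/2) * (\<Sum>i<d. Var i * lform d (a i))" using half[of f] by simp
  also have "\<dots> = (\<Sum>i<d. \<Sum>j<d. Const (A $$ (i, j)) * Var i * Var j)"
    unfolding lform_def sum_distrib_left
  proof (intro sum.cong refl)
    fix i j assume "i \<in> {..<d}" "j \<in> {..<d}"
    then have "Const (A $$ (i, j)) = Const (1/2) * Const (a i j)" by (simp add: A_def flip: Const_mult)
    then show "Const (1/2) * (Var i * (Const (a i j) * Var j)) = Const (A $$ (i, j)) * Var i * Var j"
      by (simp add: mult.assoc mult.left_commute)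
  qed
  finally have "f = (\<Sum>i<d. \<Sum>j<d. Const (A $$ (i, j)) * Var i * Var j)" .
  moreover have "A\<^sup>T = A" by (rule eq_matI) (auto simp: A_def sym)
  moreover have "A \<in> carrier_mat d d" by (simp add: A_def)
  ultimately show ?thesis using that by blast
qed

lemma Hess_quadratic_form:
  assumes A: "A \<in> carrier_mat d d" "A\<^sup>T = A"
  shows "Hess d (\<Sum>i<d. \<Sum>j<d. Const (A $$ (i, j)) * Var i * Var j) = Const (2 ^ d * det A)"
proof -
  let ?f = "\<Sum>i<d. \<Sum>j<d. Const (A $$ (i, j)) * Var i * Var j"
  have s: "A $$ (i, j) = A $$ (j, i)" if "i < d" "j < d" for i j
    using A that by (metis carrier_matD index_transpose_mat(1))
  have p: "partial l ?f = lform d (\<lambda>j. 2 * A $$ (l, j))" if l: "l < d" for l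
  proof -
    have "partial l (Const (A $$ (i, j)) * Var i * Var j)
      = (if i = l then Const (A $$ (l, j)) * Var j else 0) + (if j = l then Const (A $$ (i, l)) * Var i else 0)" for i j
      by (auto simp: partial_mult partial_Var)
    then have "partial l ?f = (\<Sum>i<d. (\<Sum>j<d. if i = l then Const (A $$ (l, j)) * Var j else 0)
        + (\<Sum>j<d. if j = l then Const (A $$ (i, l)) * Var i else 0))"
      by (simp add: partial_sum sum.distrib)
    also have "\<dots> = (\<Sum>i<d. (if i = l then (\<Sum>j<d. Const (A $$ (l, j)) * Var j) else 0) + Const (A $$ (i, l)) * Var i)"
      using l by (intro sum.cong refl) (simp add: sum.delta)
    also have "\<dots> = (\<Sum>j<d. Const (A $$ (l, j)) * Var j) + (\<Sum>i<d. Const (A $$ (i, l)) * Var i)"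
      using l by (simp add: sum.distrib sum.delta)
    also have "(\<Sum>i<d. Const (A $$ (i, l)) * Var i) = (\<Sum>j<d. Const (A $$ (l, j)) * Var j)"
      by (rule sum.cong) (use s l in auto)
    finally show ?thesis by (simp add: lform_def Const_mult Const.hom_numeral sum_distrib_left mult.assoc flip: mult_2)
  qed
  have "hess_mat d ?f = cmat (2 \<cdot>\<^sub>m A)"
    by (rule eq_matI) (use A in \<open>auto simp: hess_mat_def p partial_lform s\<close>)
  then show ?thesis using A by (simp add: Hess_det det_smult)
qed

text \<open>
  The Hessian of \<open>x\<^sup>T A x\<close> is the constant \<open>2^d det A\<close>, and a square matrix has full rank iff its determinant is nonzero.\<close>
lemma persistent_2_iff:
  assumes "sym_tensor d 2 f"
  shows "persistent d 2 f \<longleftrightarrow> (\<exists>c. c \<noteq> 0 \<and> Hess d f = Const c)"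
proof -
  have *: "vec_space.rank d A = d \<longleftrightarrow> det A \<noteq> 0" if "A \<in> carrier_mat d d" for A :: "complex mat"
    using vec_space.det_rank_iff[OF that] by simp
  have "persistent d 2 f \<longleftrightarrow> nonsingular_quadratic_form d f"
    using assms by (simp add: numeral_2_eq_2)
  also have "\<dots> \<longleftrightarrow> (\<exists>c. c \<noteq> 0 \<and> Hess d f = Const c)"
  proof
    assume "nonsingular_quadratic_form d f"
    then obtain A where A: "A \<in> carrier_mat d d" "A\<^sup>T = A" "vec_space.rank d A = d"
      "f = (\<Sum>i<d. \<Sum>j<d. Const (A $$ (i, j)) * Var i * Var j)"
      unfolding nonsingular_quadratic_form_def by blast
    then have "2 ^ d * det A \<noteq> 0" using * by simp
    then show "\<exists>c. c \<noteq> 0 \<and> Hess d f = Const c"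
      using Hess_quadratic_form[OF A(1,2)] unfolding A(4)[symmetric] by blast
  next
    assume c: "\<exists>c. c \<noteq> 0 \<and> Hess d f = Const c"
    obtain A where A: "A \<in> carrier_mat d d" "A\<^sup>T = A"
      "f = (\<Sum>i<d. \<Sum>j<d. Const (A $$ (i, j)) * Var i * Var j)" using quadratic_form[OF assms] .
    have "det A \<noteq> 0" using c Hess_quadratic_form[OF A(1,2)] A(3) by auto
    then show "nonsingular_quadratic_form d f"
      unfolding nonsingular_quadratic_form_def using A * by blast
  qed
  finally show ?thesis .
qed

lemma persistent_sym_tensor: "persistent d n f \<Longrightarrow> sym_tensor d n f"
  by (cases "(d, n, f)" rule: persistent.cases) (auto simp: numeral_2_eq_2)

lemma persistent_Suc_iff: assumes "2 \<le> n"
  shows "persistent d (Suc n) f \<longleftrightarrow> sym_tensor d (Suc n) f \<and> concise d f \<and>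
     (\<exists>S. hyperplane d S \<and> (\<forall>u \<in> carrier_vec d - S. persistent d n (dir_deriv d u f)))"
proof -
  obtain k where "n = Suc (Suc k)" using assms by (metis add_2_eq_Suc le_Suc_ex)
  then show ?thesis by simp
qed

section \<open>Persistent cubics\<close>

text \<open>
  The second derivatives of a cubic are linear forms, and differentiating a linear form along \<open>u\<close> evaluates it at \<open>u\<close>.\<close>
lemma Hess_dir_deriv_cubic:
  assumes "sym_tensor d 3 f" "u \<in> carrier_vec d"
  shows "Hess d (dir_deriv d u f) = Const (ev (\<lambda>i. u $ i) (Hess d f))"
proof -
  let ?h = "\<lambda>g. Const (ev (\<lambda>i. u $ i) g)"
  interpret h: comm_ring_hom ?h
    by (rule comm_ring_hom_comp[OF comm_ring_hom_Const ev.comm_ring_hom_axioms])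
  have "partial i (partial j (dir_deriv d u f)) = ?h (partial i (partial j f))" for i j
  proof -
    have "sym_tensor d 1 (partial i (partial j f))"
      using sym_tensor_partial[OF sym_tensor_partial[OF assms(1)], of i j] by (simp add: One_nat_def)
    then obtain a where a: "partial i (partial j f) = lform d a" using sym_tensor_1_lform by blast
    have "partial i (partial j (dir_deriv d u f)) = (\<Sum>k<d. Const (u $ k) * partial k (partial i (partial j f)))"
    proof -
      have "partial i (partial j (partial k f)) = partial k (partial i (partial j f))" for k
        unfolding partial_commute[of j k] by (rule partial_commute)
      then show ?thesis by (simp add: dir_deriv_def partial_sum partial_Const_mult)
    qed
    also have "\<dots> = ?h (partial i (partial j f))"
      by (simp add: a partial_lform ev_lform Const.hom_sum Const_mult mult.commute)
    finally show ?thesis .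
  qed
  then have "hess_mat d (dir_deriv d u f) = map_mat ?h (hess_mat d f)"
    by (intro eq_matI) (auto simp: hess_mat_def)
  then show ?thesis by (simp add: Hess_det)
qed

text \<open>
  On a line inside the affine hyperplane \<open>l = 1\<close> the form \<open>h\<close> restricts to a polynomial without zeros, which is
  constant. So \<open>h\<close> is constant on \<open>l = 1\<close>, and homogeneity gives its value wherever \<open>l\<close> does not vanish.\<close>
lemma nonvanishing_off_hyperplane:
  assumes h: "sym_tensor d m h" and l: "sym_tensor d 1 l" "l \<noteq> 0"
    and nz: "\<And>x. ev x l \<noteq> 0 \<Longrightarrow> ev x h \<noteq> 0"
  obtains c where "c \<noteq> 0" "h = Const c * l ^ m"
proof -
  obtain a where a: "l = lform d a" using sym_tensor_1_lform[OF l(1)] .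
  then obtain k where k: "k < d" "a k \<noteq> 0" using l(2) lform_eq_0_iff by blast
  define p where "p = (\<lambda>i. if i = k then 1 / a k else 0)"
  have "(\<Sum>j<d. a j * p j) = (\<Sum>j<d. if j = k then 1 else 0)"
    by (rule sum.cong) (use k in \<open>auto simp: p_def\<close>)
  then have lp: "ev p l = 1" using k by (simp add: a ev_lform sum.delta)
  have one: "ev y h = ev p h" if y: "ev y l = 1" for y
  proof -
    let ?q = "evline p (\<lambda>i. y i - p i) h"
    have "ev (\<lambda>i. p i + t * (y i - p i)) l = (1 - t) * ev p l + t * ev y l" for t
      by (simp add: a ev_lform sum_distrib_left sum.distrib[symmetric] algebra_simps)
    then have "poly ?q t \<noteq> 0" for t
      unfolding poly_evline by (intro nz) (simp add: lp y)
    then have "constant (poly ?q)" using fundamental_theorem_of_algebra by blast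
    then have "poly ?q 1 = poly ?q 0" by (simp add: constant_def)
    then show ?thesis by (simp add: poly_evline)
  qed
  define c where "c = ev p h"
  have "c \<noteq> 0" using nz[of p] lp by (simp add: c_def)
  have "l * (h - Const c * l ^ m) = 0"
  proof (rule ev_inj0)
    fix x
    show "ev x (l * (h - Const c * l ^ m)) = 0"
    proof (cases "ev x l = 0")
      case False
      let ?y = "\<lambda>i. (1 / ev x l) * x i"
      have "ev ?y l = 1" using ev_scale[OF l(1), of "1 / ev x l" x] False by simp
      then have "c = (1 / ev x l) ^ m * ev x h" using one[of ?y] ev_scale[OF h, of "1 / ev x l" x] by (simp add: c_def)
      then have "ev x h = c * ev x l ^ m" using False by (simp add: power_divide)
      then show ?thesis by (simp add: ev.hom_mult ev.hom_minus ev.hom_power)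
    qed (simp add: ev.hom_mult)
  qed
  then have "h = Const c * l ^ m" using l(2) by simp
  with \<open>c \<noteq> 0\<close> that show ?thesis by blast
qed

lemma ev_vec_lform: "a \<in> carrier_vec d \<Longrightarrow> u \<in> carrier_vec d \<Longrightarrow> ev (\<lambda>i. u $ i) (lform d (\<lambda>i. a $ i)) = a \<bullet> u"
  by (simp add: ev_lform scalar_prod_def atLeast0LessThan)

lemma lform_vec_neq_0: "a \<in> carrier_vec d \<Longrightarrow> a \<noteq> 0\<^sub>v d \<Longrightarrow> lform d (\<lambda>i. a $ i) \<noteq> 0"
  by (auto simp: lform_eq_0_iff intro!: eq_vecI)

text \<open>
  Persistence of a cubic only asks for the location of the zeros of its Hessian, since the Hessian of the derivative
  along \<open>u\<close> is the value of the Hessian at \<open>u\<close>.\<close>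
lemma persistent_3_iff:
  assumes f: "sym_tensor d 3 f"
  shows "persistent d 3 f \<longleftrightarrow> power_of_linear_form d d (Hess d f)"
proof -
  have sH: "sym_tensor d d (Hess d f)" using sym_tensor_Hess[OF f] by simp
  have s2: "sym_tensor d 2 (dir_deriv d u f)" for u using sym_tensor_dir_deriv[OF f] by simp
  have P: "persistent d 2 (dir_deriv d u f) \<longleftrightarrow> ev (\<lambda>i. u $ i) (Hess d f) \<noteq> 0" if "u \<in> carrier_vec d" for u
    using Hess_dir_deriv_cubic[OF f that] by (auto simp: persistent_2_iff[OF s2])
  have "persistent d 3 f \<longleftrightarrow> concise d f \<and> (\<exists>S. hyperplane d S \<and>
       (\<forall>u \<in> carrier_vec d - S. ev (\<lambda>i. u $ i) (Hess d f) \<noteq> 0))"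
    using persistent_Suc_iff[of 2 d f] f P by (simp add: numeral_3_eq_3 numeral_2_eq_2 cong: conj_cong)
  also have "\<dots> \<longleftrightarrow> power_of_linear_form d d (Hess d f)"
  proof
    assume "concise d f \<and> (\<exists>S. hyperplane d S \<and> (\<forall>u \<in> carrier_vec d - S. ev (\<lambda>i. u $ i) (Hess d f) \<noteq> 0))"
    then obtain S where S: "hyperplane d S" "\<And>u. u \<in> carrier_vec d - S \<Longrightarrow> ev (\<lambda>i. u $ i) (Hess d f) \<noteq> 0" by blast
    obtain a where a: "a \<in> carrier_vec d" "a \<noteq> 0\<^sub>v d" "S \<subseteq> ann d a" using hyperplane_subset_ann[OF S(1)] .
    let ?l = "lform d (\<lambda>i. a $ i)"
    have "ev x (Hess d f) \<noteq> 0" if x: "ev x ?l \<noteq> 0" for x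
    proof -
      have e: "ev (\<lambda>i. vec d x $ i) g = ev x g" if "sym_tensor d n g" for n g
        by (rule ev_cong[OF that]) simp
      have "a \<bullet> vec d x \<noteq> 0" using x e[OF sym_tensor_lform] ev_vec_lform[OF a(1), of "vec d x"] by simp
      then show ?thesis using S(2)[of "vec d x"] a(3) e[OF sH] by (auto simp: ann_def)
    qed
    then obtain c where "c \<noteq> 0" "Hess d f = Const c * ?l ^ d"
      using nonvanishing_off_hyperplane[OF sH sym_tensor_lform lform_vec_neq_0[OF a(1,2)]] by blast
    then show "power_of_linear_form d d (Hess d f)"
      unfolding power_of_linear_form_iff using lform_vec_neq_0[OF a(1,2)] sym_tensor_lform by blast
  next
    assume "power_of_linear_form d d (Hess d f)"
    then obtain l c where h: "sym_tensor d 1 l" "l \<noteq> 0" "c \<noteq> 0" "Hess d f = Const c * l ^ d"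
      using power_of_linear_form_iff by blast
    obtain b where b: "l = lform d b" using sym_tensor_1_lform[OF h(1)] .
    define a where "a = vec d b"
    have a: "a \<in> carrier_vec d" "l = lform d (\<lambda>i. a $ i)" by (auto simp: a_def b intro: lform_cong)
    have a0: "a \<noteq> 0\<^sub>v d" using h(2) a(2) by (auto simp: lform_eq_0_iff)
    have "Hess d f \<noteq> 0" using h by simp
    then have "concise d f" by (rule Hess_concise)
    moreover have "ev (\<lambda>i. u $ i) (Hess d f) \<noteq> 0" if "u \<in> carrier_vec d - ann d a" for u
      using that h(3) ev_vec_lform[OF a(1), of u] by (auto simp: h(4) a(2) ann_def ev.hom_mult ev.hom_power)
    ultimately show "concise d f \<and> (\<exists>S. hyperplane d S \<and> (\<forall>u \<in> carrier_vec d - S. ev (\<lambda>i. u $ i) (Hess d f) \<noteq> 0))"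
      using hyperplane_ann[OF a(1) a0] by blast
  qed
  finally show ?thesis .
qed

section \<open>Monomial expansion of the Hessian\<close>

text \<open>
  Both normal forms under one name, since the two cases are treated together in the induction on the degree; every \<open>d \<noteq> 2\<close>
  gives the ternary form.\<close>
definition nf :: "nat \<Rightarrow> nat \<Rightarrow> cpoly" where
  "nf d n = (if d = 2 then Var 0 ^ (n - 1) * Var 1 else Var 0 ^ (n - 1) * Var 2 + Var 0 ^ (n - 2) * Var 1 ^ 2)"

lemma argmin_ex: fixes h :: "'a \<Rightarrow> 'b::linorder"
  assumes "finite S" "S \<noteq> {}" obtains x where "x \<in> S" "\<And>y. y \<in> S \<Longrightarrow> h x \<le> h y"
proof -
  have "Min (h ` S) \<in> h ` S" using assms by (intro Min_in) auto
  then obtain x where x: "x \<in> S" "h x = Min (h ` S)" by auto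
  then have "h x \<le> h y" if "y \<in> S" for y using that assms(1) by simp
  with x that show ?thesis by blast
qed

lemma argmax_ex: fixes h :: "'a \<Rightarrow> 'b::linorder"
  assumes "finite S" "S \<noteq> {}" obtains x where "x \<in> S" "\<And>y. y \<in> S \<Longrightarrow> h y \<le> h x"
proof -
  have "Max (h ` S) \<in> h ` S" using assms by (intro Max_in) auto
  then obtain x where x: "x \<in> S" "h x = Max (h ` S)" by auto
  then have "h y \<le> h x" if "y \<in> S" for y using that assms(1) by simp
  with x that show ?thesis by blast
qed

lemma lookup_mult2:
  fixes P Q :: cpoly
  assumes S: "finite S" "supp P \<subseteq> S" "supp Q \<subseteq> S"
  shows "lk (P * Q) T = (\<Sum>(a, b)\<in>{(a, b). a \<in> S \<and> b \<in> S \<and> a + b = T}. lk P a * lk Q b)"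
proof -
  have e: "f = (\<Sum>m\<in>S. Poly_Mapping.single m (lk f m))" if "supp f \<subseteq> S" for f :: cpoly
    by (subst cpoly_expand, rule sum.mono_neutral_left) (use S(1) that in \<open>auto simp: in_keys_iff\<close>)
  have "lk (P * Q) T = (\<Sum>a\<in>S. \<Sum>b\<in>S. if a + b = T then lk P a * lk Q b else 0)"
    by (subst e[OF S(2)], subst e[OF S(3)])
       (simp add: sum_product lookup_sum mult_single lookup_single when_def)
  also have "\<dots> = (\<Sum>(a, b)\<in>S \<times> S. if a + b = T then lk P a * lk Q b else 0)"
    by (simp add: sum.cartesian_product)
  also have "\<dots> = (\<Sum>p\<in>{p \<in> S \<times> S. fst p + snd p = T}. lk P (fst p) * lk Q (snd p))"
    using S(1) by (simp add: sum.inter_filter case_prod_beta)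
  also have "{p \<in> S \<times> S. fst p + snd p = T} = {(a, b). a \<in> S \<and> b \<in> S \<and> a + b = T}" by auto
  finally show ?thesis by (simp add: case_prod_beta)
qed

lemma lookup_mult3:
  fixes P Q R :: cpoly
  assumes S: "finite S" "supp P \<subseteq> S" "supp Q \<subseteq> S" "supp R \<subseteq> S"
  shows "lk (P * (Q * R)) T = (\<Sum>(a, b, c)\<in>{(a, b, c). a \<in> S \<and> b \<in> S \<and> c \<in> S \<and> a + b + c = T}. lk P a * (lk Q b * lk R c))"
proof -
  have e: "f = (\<Sum>m\<in>S. Poly_Mapping.single m (lk f m))" if "supp f \<subseteq> S" for f :: cpoly
    by (subst cpoly_expand, rule sum.mono_neutral_left) (use S(1) that in \<open>auto simp: in_keys_iff\<close>)
  have QR: "Q * R = (\<Sum>b\<in>S. \<Sum>c\<in>S. Poly_Mapping.single (b + c) (lk Q b * lk R c))"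
    by (subst e[OF S(3)], subst e[OF S(4)]) (simp add: sum_product mult_single)
  have "P * (Q * R) = (\<Sum>a\<in>S. \<Sum>b\<in>S. \<Sum>c\<in>S. Poly_Mapping.single (a + (b + c)) (lk P a * (lk Q b * lk R c)))"
    unfolding QR by (subst e[OF S(2)]) (simp only: sum_distrib_right, simp only: sum_distrib_left mult_single)
  then have "lk (P * (Q * R)) T = (\<Sum>a\<in>S. \<Sum>b\<in>S. \<Sum>c\<in>S. if a + b + c = T then lk P a * (lk Q b * lk R c) else 0)"
    by (simp add: lookup_sum lookup_single when_def add.assoc)
  also have "\<dots> = (\<Sum>(a, b, c)\<in>S \<times> S \<times> S. if a + b + c = T then lk P a * (lk Q b * lk R c) else 0)"
    by (simp add: sum.cartesian_product)
  also have "\<dots> = (\<Sum>p\<in>{p \<in> S \<times> S \<times> S. fst p + fst (snd p) + snd (snd p) = T}. lk P (fst p) * (lk Q (fst (snd p)) * lk R (snd (snd p))))"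
    using S(1) by (simp add: sum.inter_filter case_prod_beta)
  also have "{p \<in> S \<times> S \<times> S. fst p + fst (snd p) + snd (snd p) = T} = {(a, b, c). a \<in> S \<and> b \<in> S \<and> c \<in> S \<and> a + b + c = T}" by auto
  finally show ?thesis by (simp add: case_prod_beta)
qed

text \<open>
  The eigenvalue of \<open>x_i x_j \<partial>_i \<partial>_j\<close> on the monomial with exponent vector \<open>m\<close>.\<close>
definition euler2_weight :: "nat \<Rightarrow> nat \<Rightarrow> (nat \<Rightarrow>\<^sub>0 nat) \<Rightarrow> complex" where
  "euler2_weight i j m = of_nat (lk m i) * of_nat (lk m j) - (if i = j then of_nat (lk m i) else 0)"

definition euler2 :: "nat \<Rightarrow> nat \<Rightarrow> cpoly \<Rightarrow> cpoly" where
  "euler2 i j f = Var i * (Var j * partial i (partial j f))"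

lemma lookup_euler2: "lk (euler2 i j f) m = euler2_weight i j m * lk f m"
proof -
  have "euler2 i j f = Var i * partial i (Var j * partial j f) - (if i = j then Var i * partial i f else 0)"
    by (auto simp: euler2_def partial_mult partial_Var distrib_left)
  then show ?thesis by (simp add: lookup_minus lookup_Var_mult_partial euler2_weight_def left_diff_distrib mult.assoc mult.left_commute)
qed

lemma supp_euler2: "supp (euler2 i j f) \<subseteq> supp f"
  by (auto simp: in_keys_iff lookup_euler2)

definition pair_sums :: "cpoly \<Rightarrow> (nat \<Rightarrow>\<^sub>0 nat) \<Rightarrow> ((nat \<Rightarrow>\<^sub>0 nat) \<times> (nat \<Rightarrow>\<^sub>0 nat)) set" where
  "pair_sums f T = {(a, b). a \<in> supp f \<and> b \<in> supp f \<and> a + b = T}"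
definition triple_sums :: "cpoly \<Rightarrow> (nat \<Rightarrow>\<^sub>0 nat) \<Rightarrow> ((nat \<Rightarrow>\<^sub>0 nat) \<times> (nat \<Rightarrow>\<^sub>0 nat) \<times> (nat \<Rightarrow>\<^sub>0 nat)) set" where
  "triple_sums f T = {(a, b, c). a \<in> supp f \<and> b \<in> supp f \<and> c \<in> supp f \<and> a + b + c = T}"

text \<open>
  The contribution of an ordered tuple of exponent vectors to \<open>x_0\<^sup>2 x_1\<^sup>2 Hess f\<close>; likewise \<open>hess_weight3\<close> for three variables.\<close>
definition hess_weight2 where "hess_weight2 a b = euler2_weight 0 0 a * euler2_weight 1 1 b - euler2_weight 0 1 a * euler2_weight 0 1 b"
definition hess_weight3 where "hess_weight3 a b c = euler2_weight 0 0 a * (euler2_weight 1 1 b * euler2_weight 2 2 c) - euler2_weight 0 0 a * (euler2_weight 1 2 b * euler2_weight 1 2 c)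
  - euler2_weight 0 1 a * (euler2_weight 0 1 b * euler2_weight 2 2 c) + euler2_weight 0 1 a * (euler2_weight 1 2 b * euler2_weight 0 2 c)
  + euler2_weight 0 2 a * (euler2_weight 0 1 b * euler2_weight 1 2 c) - euler2_weight 0 2 a * (euler2_weight 1 1 b * euler2_weight 0 2 c)"

lemma Hess_2: "Hess 2 f = partial 0 (partial 0 f) * partial 1 (partial 1 f) - partial 0 (partial 1 f) * partial 0 (partial 1 f)"
  by (simp add: Hess_def det_mat_2 partial_commute[of 1 0])

text \<open>
  Multiplying by \<open>x_0\<^sup>2 x_1\<^sup>2\<close> turns all second derivatives into the diagonal operators \<open>euler2\<close>.\<close>
lemma Hess_2_coeff:
  "lk (Var 0 * Var 0 * Var 1 * Var 1 * Hess 2 f) T = (\<Sum>(a, b)\<in>pair_sums f T. lk f a * lk f b * hess_weight2 a b)"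
proof -
  have "Var 0 * Var 0 * Var 1 * Var 1 * Hess 2 f = euler2 0 0 f * euler2 1 1 f - euler2 0 1 f * euler2 0 1 f"
    unfolding Hess_2 euler2_def by (simp add: algebra_simps)
  then have "lk (Var 0 * Var 0 * Var 1 * Var 1 * Hess 2 f) T = lk (euler2 0 0 f * euler2 1 1 f - euler2 0 1 f * euler2 0 1 f) T"
    by (rule arg_cong)
  also have "\<dots> = (\<Sum>(a, b)\<in>pair_sums f T. lk f a * lk f b * hess_weight2 a b)"
    unfolding lookup_minus lookup_mult2[OF finite_keys supp_euler2 supp_euler2] pair_sums_def[symmetric] sum_subtractf[symmetric]
    by (intro sum.cong refl) (auto simp: lookup_euler2 hess_weight2_def algebra_simps)
  finally show ?thesis .
qed

lemma Hess_3: "Hess 3 f =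
    partial 0 (partial 0 f) * (partial 1 (partial 1 f) * partial 2 (partial 2 f)) - partial 0 (partial 0 f) * (partial 1 (partial 2 f) * partial 1 (partial 2 f))
    - partial 0 (partial 1 f) * (partial 0 (partial 1 f) * partial 2 (partial 2 f)) + partial 0 (partial 1 f) * (partial 1 (partial 2 f) * partial 0 (partial 2 f))
    + partial 0 (partial 2 f) * (partial 0 (partial 1 f) * partial 1 (partial 2 f)) - partial 0 (partial 2 f) * (partial 1 (partial 1 f) * partial 0 (partial 2 f))"
  by (simp add: Hess_def det_mat_3 partial_commute[of 1 0] partial_commute[of 2 0] partial_commute[of 2 1] right_diff_distrib mult.assoc mult.left_commute)

lemma Hess_3_coeff:
  "lk (Var 0 * Var 0 * Var 1 * Var 1 * Var 2 * Var 2 * Hess 3 f) T = (\<Sum>(a, b, c)\<in>triple_sums f T. lk f a * lk f b * lk f c * hess_weight3 a b c)"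
proof -
  have "Var 0 * Var 0 * Var 1 * Var 1 * Var 2 * Var 2 * Hess 3 f =
    euler2 0 0 f * (euler2 1 1 f * euler2 2 2 f) - euler2 0 0 f * (euler2 1 2 f * euler2 1 2 f) - euler2 0 1 f * (euler2 0 1 f * euler2 2 2 f)
    + euler2 0 1 f * (euler2 1 2 f * euler2 0 2 f) + euler2 0 2 f * (euler2 0 1 f * euler2 1 2 f) - euler2 0 2 f * (euler2 1 1 f * euler2 0 2 f)"
    unfolding Hess_3 euler2_def by (simp add: algebra_simps)
  then have "lk (Var 0 * Var 0 * Var 1 * Var 1 * Var 2 * Var 2 * Hess 3 f) T = lk (
    euler2 0 0 f * (euler2 1 1 f * euler2 2 2 f) - euler2 0 0 f * (euler2 1 2 f * euler2 1 2 f) - euler2 0 1 f * (euler2 0 1 f * euler2 2 2 f)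
    + euler2 0 1 f * (euler2 1 2 f * euler2 0 2 f) + euler2 0 2 f * (euler2 0 1 f * euler2 1 2 f) - euler2 0 2 f * (euler2 1 1 f * euler2 0 2 f)) T"
    by (rule arg_cong)
  also have "\<dots> = (\<Sum>(a, b, c)\<in>triple_sums f T. lk f a * lk f b * lk f c * hess_weight3 a b c)"
    unfolding lookup_minus lookup_add lookup_mult3[OF finite_keys supp_euler2 supp_euler2 supp_euler2] triple_sums_def[symmetric] sum_subtractf[symmetric] sum.distrib[symmetric]
    by (intro sum.cong refl) (auto simp: lookup_euler2 hess_weight3_def algebra_simps)
  finally show ?thesis .
qed

lemma Var_power_single: "Var i ^ k = Poly_Mapping.single (Poly_Mapping.single i k) 1"
  using single_eq_Const_mult_monom_val[of "Poly_Mapping.single i k" 1]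
  by (cases "k = 0") (simp_all add: monom_val_def)

text \<open>
  The exponent of \<open>x_0^N\<close> after multiplication by the squares of all variables.\<close>
definition target2 where "target2 N = Poly_Mapping.single (0::nat) (N + 2) + Poly_Mapping.single 1 (2::nat)"
definition target3 where "target3 N = Poly_Mapping.single (0::nat) (N + 2) + Poly_Mapping.single 1 (2::nat) + Poly_Mapping.single 2 2"

text \<open>
  The working form of the hypothesis on the Hessian: only one exponent sum carries a nonzero total weight.\<close>
lemma Hess_2_power_coeff:
  assumes "Hess 2 f = Const c * Var 0 ^ N"
  shows "(\<Sum>(a, b)\<in>pair_sums f T. lk f a * lk f b * hess_weight2 a b) = (if T = target2 N then c else 0)"
proof -
  have "Var 0 * Var 0 * Var 1 * Var 1 * Hess 2 f = Const c * (Var 0 ^ (N + 2) * Var 1 ^ 2)"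
    unfolding assms by (simp add: power_add power2_eq_square algebra_simps)
  also have "\<dots> = Poly_Mapping.single (target2 N) c"
    by (simp only: Var_power_single mult_single Const_def target2_def) simp
  finally show ?thesis by (auto simp: lookup_single when_def simp flip: Hess_2_coeff)
qed

text \<open>
  The ternary analogue of \<open>Hess_2_power_coeff\<close>.\<close>
lemma Hess_3_power_coeff:
  assumes "Hess 3 f = Const c * Var 0 ^ N"
  shows "(\<Sum>(a, b, e)\<in>triple_sums f T. lk f a * lk f b * lk f e * hess_weight3 a b e) = (if T = target3 N then c else 0)"
proof -
  have "Var 0 * Var 0 * Var 1 * Var 1 * Var 2 * Var 2 * Hess 3 f = Const c * (Var 0 ^ (N + 2) * Var 1 ^ 2 * Var 2 ^ 2)"
    unfolding assms by (simp add: power_add power2_eq_square algebra_simps)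
  also have "\<dots> = Poly_Mapping.single (target3 N) c"
    by (simp only: Var_power_single mult_single Const_def target3_def) simp
  finally show ?thesis by (auto simp: lookup_single when_def simp flip: Hess_3_coeff)
qed

section \<open>Restriction to a hyperplane and shears\<close>

lemma msub_cong:
  assumes "sym_tensor d n f" "\<And>i. i < d \<Longrightarrow> \<sigma> i = \<tau> i" shows "msub c \<sigma> f = msub c \<tau> f"
proof -
  have "monom_val \<sigma> m = monom_val \<tau> m" if "m \<in> supp f" for m
    unfolding monom_val_def by (rule prod.cong) (use assms(2) sym_tensorD(1)[OF assms(1) that] in auto)
  then show ?thesis by (simp add: msub_def)
qed

text \<open>
  The restriction to \<open>x_0 = 0\<close>, the line or plane at infinity for the linear form \<open>x_0\<close>.\<close>
definition r0 :: "cpoly \<Rightarrow> cpoly" where "r0 = msub Const (\<lambda>i. if i = 0 then 0 else Var i)"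

interpretation r0: comm_ring_hom r0
  unfolding r0_def by (rule comm_ring_hom_msub[OF comm_ring_hom_Const])

lemma r0_Const [simp]: "r0 (Const a) = Const a" by (simp add: r0_def msub_Const[OF comm_ring_hom_Const])
lemma r0_Var [simp]: "r0 (Var i) = (if i = 0 then 0 else Var i)" by (simp add: r0_def msub_Var[OF comm_ring_hom_Const])

lemma lookup_r0: "lk (r0 f) m = (if lk m 0 = 0 then lk f m else 0)"
proof (induction f rule: cpoly_add_induct)
  case (single n a)
  have "r0 (Poly_Mapping.single n a) = (if lk n 0 = 0 then Poly_Mapping.single n a else 0)"
  proof (cases "lk n 0 = 0")
    case True
    then have "monom_val (\<lambda>i. if i = 0 then 0 else Var i) n = monom_val Var n"
      unfolding monom_val_def by (intro prod.cong) (auto simp: in_keys_iff)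
    then show ?thesis using True
      unfolding r0_def msub_single[OF comm_ring_hom_Const] by (simp add: single_eq_Const_mult_monom_val)
  next
    case False
    then have "monom_val (\<lambda>i. if i = 0 then 0 else Var i) n = 0"
      unfolding monom_val_def by (intro prod_zero) (auto simp: in_keys_iff intro!: bexI[of _ 0])
    then show ?thesis using False by (simp add: r0_def msub_single[OF comm_ring_hom_Const])
  qed
  then show ?case by (auto simp: lookup_single when_def)
qed (simp_all add: lookup_add r0.hom_add)

text \<open>
  The substitution \<open>x_i \<mapsto> x_i + t_i x_0\<close> for \<open>i > 0\<close>; it preserves \<open>x_0\<close> and the restriction to \<open>x_0 = 0\<close>.\<close>
definition shear :: "nat \<Rightarrow> (nat \<Rightarrow> complex) \<Rightarrow> complex mat" where
  "shear d t = mat d d (\<lambda>(i, j). if i = j then 1 else if j = 0 then t i else 0)"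

lemma shear_carrier [simp]: "shear d t \<in> carrier_mat d d" by (simp add: shear_def)

lemma det_shear: "det (shear d t) = 1"
proof -
  have "det ((shear d t)\<^sup>T) = prod_list (diag_mat ((shear d t)\<^sup>T))"
    by (rule det_upper_triangular[of _ d]) (auto simp: shear_def)
  also have "diag_mat ((shear d t)\<^sup>T) = replicate d 1"
    by (rule nth_equalityI) (auto simp: diag_mat_def shear_def)
  finally show ?thesis by (simp add: det_transpose[OF shear_carrier])
qed

lemma lform_shear_row: "i < d \<Longrightarrow> lform d (\<lambda>j. shear d t $$ (i, j)) = (if i = 0 then Var 0 else Var i + Const (t i) * Var 0)"
proof -
  assume i: "i < d"
  have "lform d (\<lambda>j. shear d t $$ (i, j)) = (\<Sum>j<d. (if j = i then Var i else 0) + (if j = 0 then (if i = 0 then 0 else Const (t i) * Var 0) else 0))"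
    unfolding lform_def by (rule sum.cong) (use i in \<open>auto simp: shear_def\<close>)
  then show ?thesis using i by (auto simp: sum.distrib sum.delta)
qed

lemma LS_shear_Var0: "0 < d \<Longrightarrow> lin_subst d (shear d t) (Var 0) = Var 0"
  by (simp add: LS_Var lform_shear_row)

lemma r0_shear: assumes "sym_tensor d n f" shows "r0 (lin_subst d (shear d t) f) = r0 f"
proof -
  have "r0 (lin_subst d (shear d t) f) = msub Const (\<lambda>i. r0 (subst_value d (shear d t) i)) f"
    using hom_eq_msub[OF comm_ring_hom_comp[OF r0.comm_ring_hom_axioms comm_ring_hom_LS]] by (simp add: LS_Var')
  also have "\<dots> = r0 f"
    unfolding r0_def[of, THEN fun_cong]
    by (rule msub_cong[OF assms]) (simp add: subst_value_def lform_shear_row r0.hom_add r0.hom_mult flip: r0_def)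
  finally show ?thesis .
qed

lemma lookup_shear_0:
  assumes "sym_tensor d n f" "lk m 0 = 0" shows "lk (lin_subst d (shear d t) f) m = lk f m"
  using r0_shear[OF assms(1), of t] lookup_r0[of "lin_subst d (shear d t) f" m] lookup_r0[of f m] assms(2) by simp

text \<open>
  To first order in \<open>x_0\<close> a shear adds derivatives of the part of \<open>f\<close> that is free of \<open>x_0\<close>. This is used to remove a chosen coefficient.\<close>
lemma lookup_shear_1:
  assumes f: "sym_tensor d n f" and m: "lk m 0 = 0" and d: "0 < d"
  shows "lk (lin_subst d (shear d t) f) (m + ex 0)
    = lk f (m + ex 0) + (\<Sum>i\<in>{1..<d}. t i * (of_nat (lk m i + 1) * lk f (m + ex i)))"
proof -
  have "lk (lin_subst d (shear d t) f) (m + ex 0) = lk (partial 0 (lin_subst d (shear d t) f)) m"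
    using m by (simp add: lookup_partial)
  also have "\<dots> = (\<Sum>i<d. shear d t $$ (i, 0) * lk (lin_subst d (shear d t) (partial i f)) m)"
    using d by (simp add: chain_rule lookup_sum lookup_Const_mult)
  also have "\<dots> = (\<Sum>i<d. shear d t $$ (i, 0) * lk (partial i f) m)"
    by (simp add: lookup_shear_0[OF sym_tensor_partial[OF f] m])
  also have "{..<d} = insert 0 {1..<d}" using d by auto
  also have "(\<Sum>i\<in>insert 0 {1..<d}. shear d t $$ (i, 0) * lk (partial i f) m)
      = lk f (m + ex 0) + (\<Sum>i\<in>{1..<d}. shear d t $$ (i, 0) * lk (partial i f) m)"
    using d m by (simp add: shear_def lookup_partial)
  also have "(\<Sum>i\<in>{1..<d}. shear d t $$ (i, 0) * lk (partial i f) m)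
      = (\<Sum>i\<in>{1..<d}. t i * (of_nat (lk m i + 1) * lk f (m + ex i)))"
    by (rule sum.cong) (auto simp: shear_def lookup_partial)
  finally show ?thesis .
qed

lemma Hess_shear:
  assumes "0 < d" "Hess d f = Const c * Var 0 ^ N"
  shows "Hess d (lin_subst d (shear d t) f) = Const c * Var 0 ^ N"
  using assms by (simp add: Hess_LS[OF shear_carrier] det_shear LS.hom_mult LS.hom_power LS_shear_Var0)

text \<open>
  Divisibility by a power of \<open>x_0\<close> is read off from the support.\<close>
lemma divide_Var0_power:
  assumes f: "sym_tensor d n f" and k: "\<And>m. m \<in> supp f \<Longrightarrow> k \<le> lk m 0" and d: "0 < d"
  obtains g where "f = Var 0 ^ k * g" "sym_tensor d (n - k) g"
proof -
  let ?s = "Poly_Mapping.single 0 k"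
  define g where "g = (\<Sum>m\<in>supp f. Poly_Mapping.single (m - ?s) (lk f m))"
  have e: "m - ?s + ?s = m" if "m \<in> supp f" for m
    using k[OF that] by (intro poly_mapping_eqI) (auto simp: lookup_add lookup_minus lookup_single when_def)
  have "Var 0 ^ k * g = (\<Sum>m\<in>supp f. Poly_Mapping.single m (lk f m))"
    unfolding g_def Var_power_single sum_distrib_left
    by (intro sum.cong refl) (simp add: mult_single e[unfolded add.commute[of _ ?s]])
  then have "f = Var 0 ^ k * g" using cpoly_expand[of f] by simp
  moreover have "sym_tensor d (n - k) g"
    unfolding g_def
  proof (rule sym_tensor_sum)
    fix m assume m: "m \<in> supp f"
    have "(\<Sum>j<d. lk (m - ?s) j) + k = n"
    proof -
      have "(\<Sum>j<d. lk (m - ?s) j) + k = (\<Sum>j<d. lk (m - ?s + ?s) j)"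
        using d by (simp add: lookup_add lookup_single when_def sum.distrib sum.delta)
      then show ?thesis using e[OF m] sym_tensorD(2)[OF f m] by simp
    qed
    moreover have "supp (m - ?s) \<subseteq> {..<d}"
      using sym_tensorD(1)[OF f m] by (auto simp: in_keys_iff lookup_minus subset_iff)
    ultimately show "sym_tensor d (n - k) (Poly_Mapping.single (m - ?s) (lk f m))"
      by (auto simp: sym_tensor_def)
  qed
  ultimately show ?thesis using that by blast
qed

lemma lookup_Var0_power_mult: "lk (Var 0 ^ k * g) (m + Poly_Mapping.single 0 k) = lk g m"
proof (induction g rule: cpoly_add_induct)
  case (single n a)
  have "Poly_Mapping.single 0 k + n = m + Poly_Mapping.single 0 k \<longleftrightarrow> n = m"
    by (metis add.commute add_right_cancel)
  then show ?case by (simp add: Var_power_single mult_single lookup_single when_def)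
qed (simp_all add: lookup_add distrib_left)

lemma supp_Var0_power_mult:
  assumes "m \<in> supp (Var 0 ^ k * g)" obtains n where "m = n + Poly_Mapping.single 0 k" "n \<in> supp g"
proof -
  have "supp (Var 0 ^ k) = {Poly_Mapping.single 0 k}" by (simp add: Var_power_single)
  then show ?thesis using assms Poly_Mapping.keys_mult[of "Var 0 ^ k" g] that by (auto simp: add.commute)
qed

lemma lform_2: "lform 2 a = Const (a 0) * Var 0 + Const (a 1) * Var 1"
proof -
  have "{..<2::nat} = {0, 1}" by auto
  then show ?thesis by (simp add: lform_def)
qed

lemma lform_3: "lform 3 a = Const (a 0) * Var 0 + Const (a 1) * Var 1 + Const (a 2) * Var 2"
proof -
  have "{..<3::nat} = {0, 1, 2}" by auto
  then show ?thesis by (simp add: lform_def add.assoc)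
qed

lemma sum_lessThan_2: "sum h {..<2::nat} = h 0 + h 1" for h :: "nat \<Rightarrow> 'a::comm_monoid_add"
proof -
  have "{..<2::nat} = {0, 1}" by auto
  then show ?thesis by simp
qed

lemma sum_lessThan_3: "sum h {..<3::nat} = h 0 + h 1 + h 2" for h :: "nat \<Rightarrow> 'a::comm_monoid_add"
proof -
  have "{..<3::nat} = {0, 1, 2}" by auto
  then show ?thesis by (simp add: add.assoc)
qed

text \<open>
  The matrix of a substitution that produces a form with nonzero Hessian is automatically invertible, because the
  Hessian carries the factor \<open>det R ^ 2\<close>.\<close>
lemma GL_equivI:
  assumes "R \<in> carrier_mat d d" "f = lin_subst d R h" "Hess d f \<noteq> 0"
  shows "GL_equiv d f h"
proof -
  have "det R \<noteq> 0" using assms(3) unfolding assms(2) Hess_LS[OF assms(1)] by auto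
  with assms show ?thesis unfolding GL_equiv_iff by blast
qed

section \<open>Binary forms with power Hessian\<close>

lemma binary_exponents: assumes "sym_tensor 2 n f" "m \<in> supp f"
  shows "lk m 0 + lk m 1 = n" "i \<noteq> 0 \<Longrightarrow> i \<noteq> 1 \<Longrightarrow> lk m i = 0"
  using sym_tensorD(2)[OF assms] sym_tensorD(3)[OF assms] by (auto simp: sum_lessThan_2)

lemma binary_exponents_eqI: assumes "sym_tensor 2 n f" "m \<in> supp f" "m' \<in> supp f" "lk m 1 = lk m' 1"
  shows "m = m'"
proof (rule poly_mapping_eqI)
  fix i show "lk m i = lk m' i"
    using binary_exponents(1)[OF assms(1,2)] binary_exponents(2)[OF assms(1,2), of i]
      binary_exponents(1)[OF assms(1,3)] binary_exponents(2)[OF assms(1,3), of i] assms(4) by (cases "i = 0"; cases "i = 1") auto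
qed

lemma hess_weight2_diag: "hess_weight2 a a = - (of_nat (lk a 0) * of_nat (lk a 1) * (of_nat (lk a 0) + of_nat (lk a 1) - 1))"
  by (simp add: hess_weight2_def euler2_weight_def algebra_simps)

lemma lookup_target2: "lk (target2 N) 0 = N + 2" "lk (target2 N) 1 = 2"
  by (simp_all add: target2_def lookup_add lookup_single when_def)

lemma lookup_target3: "lk (target3 N) 0 = N + 2" "lk (target3 N) 1 = 2" "lk (target3 N) 2 = 2"
  by (simp_all add: target3_def lookup_add lookup_single when_def)

text \<open>
  If \<open>x_1^n\<close> occurs and \<open>x_0 x_1^{n-1}\<close> does not, let \<open>B\<close> be the exponent with the next largest power of \<open>x_1\<close>.
  The sum of \<open>x_1^n\<close> and \<open>B\<close> arises only from this pair and has nonzero weight, so it is the target exponent, in which \<open>x_1\<close>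
  has exponent 2. This contradicts \<open>n \<ge> 3\<close>.\<close>
lemma binary_pure_power_excluded:
  assumes f: "sym_tensor 2 n f" and n: "3 \<le> n" and H: "Hess 2 f = Const c * Var 0 ^ N" and c: "c \<noteq> 0"
    and A: "Poly_Mapping.single 1 n \<in> supp f" and kill: "Poly_Mapping.single 1 (n - 1) + ex 0 \<notin> supp f"
  shows False
proof -
  let ?A = "Poly_Mapping.single 1 n"
  have "pair_sums f (target2 N) \<noteq> {}"
  proof
    assume "pair_sums f (target2 N) = {}"
    then show False using Hess_2_power_coeff[OF H, of "target2 N"] c by simp
  qed
  then obtain a b where ab: "a \<in> supp f" "b \<in> supp f" "a + b = target2 N" by (auto simp: pair_sums_def)
  have "lk a 0 + lk b 0 = N + 2" using arg_cong[OF ab(3), of "\<lambda>m. lk m 0"] by (simp add: lookup_add lookup_target2)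
  then have "lk a 0 \<noteq> 0 \<or> lk b 0 \<noteq> 0" by auto
  then have ne: "{m \<in> supp f. lk m 0 \<noteq> 0} \<noteq> {}" using ab by auto
  obtain B where B: "B \<in> {m \<in> supp f. lk m 0 \<noteq> 0}" "\<And>y. y \<in> {m \<in> supp f. lk m 0 \<noteq> 0} \<Longrightarrow> lk y 1 \<le> lk B 1"
    using argmax_ex[OF _ ne, of "\<lambda>m. lk m 1"] by auto
  have Bs: "B \<in> supp f" and B0: "lk B 0 \<noteq> 0" using B by auto
  have other: "m = ?A" if "m \<in> supp f" "lk m 0 = 0" for m
    using binary_exponents_eqI[OF f that(1) A] binary_exponents(1)[OF f that(1)] that(2) by (simp add: lookup_single)
  have sumB: "lk B 0 + lk B 1 = n" using binary_exponents(1)[OF f Bs] .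
  have B2: "2 \<le> lk B 0"
  proof (rule ccontr)
    assume "\<not> 2 \<le> lk B 0"
    then have "lk B 0 = 1" using B0 by simp
    then have "lk B i = lk (Poly_Mapping.single 1 (n - 1) + ex 0) i" for i
      using sumB binary_exponents(2)[OF f Bs, of i] by (cases "i = 0"; cases "i = 1") (auto simp: lookup_add lookup_single lookup_one when_def)
    then have "B = Poly_Mapping.single 1 (n - 1) + ex 0" by (rule poly_mapping_eqI)
    then show False using kill Bs by simp
  qed
  have pair_sums: "pair_sums f (?A + B) = {(?A, B), (B, ?A)}"
  proof (intro equalityI subsetI)
    fix p assume "p \<in> pair_sums f (?A + B)"
    then obtain x y where xy: "p = (x, y)" "x \<in> supp f" "y \<in> supp f" "x + y = ?A + B" by (auto simp: pair_sums_def)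
    have e: "lk x 1 + lk y 1 = n + lk B 1"
      using arg_cong[OF xy(4), of "\<lambda>m. lk m 1"] by (simp add: lookup_add lookup_single)
    have "lk x 0 = 0 \<or> lk y 0 = 0"
    proof (rule ccontr)
      assume "\<not> (lk x 0 = 0 \<or> lk y 0 = 0)"
      then have "lk x 1 \<le> lk B 1" "lk y 1 \<le> lk B 1" using B(2)[of x] B(2)[of y] xy by auto
      then show False using e sumB B0 by simp
    qed
    then have "x = ?A \<or> y = ?A" using other xy by blast
    then show "p \<in> {(?A, B), (B, ?A)}" using xy by (auto simp: add.commute)
  qed (use A Bs in \<open>auto simp: pair_sums_def add.commute\<close>)
  have AB: "?A \<noteq> B" using B0 by (auto simp: lookup_single)
  have "(\<Sum>(a, b)\<in>pair_sums f (?A + B). lk f a * lk f b * hess_weight2 a b) = lk f ?A * lk f B * (hess_weight2 ?A B + hess_weight2 B ?A)"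
    unfolding pair_sums using AB by (simp add: algebra_simps)
  moreover have "hess_weight2 ?A B + hess_weight2 B ?A = of_nat n * (of_nat n - 1) * (of_nat (lk B 0) * (of_nat (lk B 0) - 1))"
    by (simp add: hess_weight2_def euler2_weight_def lookup_single algebra_simps)
  moreover have "of_nat n - (1::complex) \<noteq> 0" "of_nat (lk B 0) - (1::complex) \<noteq> 0"
    using of_nat_eq_1_iff[of n, where ?'a = complex] of_nat_eq_1_iff[of "lk B 0", where ?'a = complex] n B2 by auto
  ultimately have "(\<Sum>(a, b)\<in>pair_sums f (?A + B). lk f a * lk f b * hess_weight2 a b) \<noteq> 0"
    using n B0 A Bs by (auto simp: in_keys_iff)
  then have "?A + B = target2 N" using Hess_2_power_coeff[OF H, of "?A + B"] by (simp split: if_splits)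
  then have "n + lk B 1 = 2" by (metis lookup_target2(2) lookup_add lookup_single_eq)
  then show False using n by simp
qed

text \<open>
  Let \<open>A\<close> be the exponent with the largest power of \<open>x_1\<close>. A shear and the previous lemma show that \<open>A\<close> contains
  \<open>x_0\<close>; then \<open>A + A\<close> is an isolated sum of nonzero weight, hence the target, and the power of \<open>x_1\<close> is 1.\<close>
lemma binary_hess_power_support:
  assumes f: "sym_tensor 2 n f" and n: "3 \<le> n" and H: "Hess 2 f = Const c * Var 0 ^ N" and c: "c \<noteq> 0"
  shows "\<forall>m\<in>supp f. lk m 1 \<le> 1"
proof -
  have "pair_sums f (target2 N) \<noteq> {}"
  proof
    assume "pair_sums f (target2 N) = {}"
    then show False using Hess_2_power_coeff[OF H, of "target2 N"] c by simp
  qed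
  then obtain a b where ab: "a \<in> supp f" "b \<in> supp f" "a + b = target2 N" by (auto simp: pair_sums_def)
  have ab1: "lk a 1 + lk b 1 = 2" using arg_cong[OF ab(3), of "\<lambda>m. lk m 1"] by (simp add: lookup_add lookup_target2)
  have ne: "supp f \<noteq> {}" using ab by auto
  obtain A where A: "A \<in> supp f" "\<And>y. y \<in> supp f \<Longrightarrow> lk y 1 \<le> lk A 1"
    using argmax_ex[OF finite_keys ne, of "\<lambda>m. lk m 1"] by auto
  have A1: "1 \<le> lk A 1" using A(2)[OF ab(1)] A(2)[OF ab(2)] ab1 by linarith
  have sumA: "lk A 0 + lk A 1 = n" using binary_exponents(1)[OF f A(1)] .
  have A0: "lk A 0 \<noteq> 0"
  proof
    assume z: "lk A 0 = 0"
    have "lk A i = lk (Poly_Mapping.single 1 n) i" for i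
      using sumA z binary_exponents(2)[OF f A(1), of i] by (cases "i = 0"; cases "i = 1") (auto simp: lookup_single when_def)
    then have Ae: "A = Poly_Mapping.single 1 n" by (rule poly_mapping_eqI)
    let ?m = "Poly_Mapping.single 1 (n - 1)"
    have me: "?m + ex 1 = A" using n by (simp add: Ae single_add[symmetric])
    have r: "{1..<2::nat} = {1}" by auto
    define t where "t = (\<lambda>i::nat. - lk f (?m + ex 0) / (of_nat n * lk f A))"
    let ?g = "lin_subst 2 (shear 2 t) f"
    have fA: "lk f A \<noteq> 0" using A(1) by (simp add: in_keys_iff)
    have "lk ?g (?m + ex 0) = lk f (?m + ex 0) + t 1 * (of_nat n * lk f A)"
      using lookup_shear_1[OF f, of ?m t] n by (simp add: r lookup_single me)
    also have "\<dots> = 0" using n fA by (simp add: t_def)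
    finally have k: "?m + ex 0 \<notin> supp ?g" by (simp add: in_keys_iff)
    have "lk ?g A = lk f A" using lookup_shear_0[OF f z] .
    then have "Poly_Mapping.single 1 n \<in> supp ?g" using fA Ae by (simp add: in_keys_iff)
    then show False
      using binary_pure_power_excluded[OF sym_tensor_LS[OF f] n Hess_shear[OF _ H] c _ k] by simp
  qed
  have pair_sums: "pair_sums f (A + A) = {(A, A)}"
  proof (intro equalityI subsetI)
    fix p assume "p \<in> pair_sums f (A + A)"
    then obtain x y where xy: "p = (x, y)" "x \<in> supp f" "y \<in> supp f" "x + y = A + A" by (auto simp: pair_sums_def)
    have "lk x 1 + lk y 1 = lk A 1 + lk A 1"
      using arg_cong[OF xy(4), of "\<lambda>m. lk m 1"] by (simp add: lookup_add)
    then have "lk x 1 = lk A 1" "lk y 1 = lk A 1" using A(2)[OF xy(2)] A(2)[OF xy(3)] by auto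
    then show "p \<in> {(A, A)}" using binary_exponents_eqI[OF f _ A(1)] xy by auto
  qed (use A in \<open>auto simp: pair_sums_def\<close>)
  have "of_nat (lk A 0) + of_nat (lk A 1) - (1::complex) = of_nat (n - 1)"
    using sumA n by (simp add: of_nat_diff flip: of_nat_add)
  then have "hess_weight2 A A \<noteq> 0" unfolding hess_weight2_diag using A0 A1 n by simp
  then have "(\<Sum>(a, b)\<in>pair_sums f (A + A). lk f a * lk f b * hess_weight2 a b) \<noteq> 0"
    using A(1) by (simp add: pair_sums in_keys_iff)
  then have "A + A = target2 N" using Hess_2_power_coeff[OF H, of "A + A"] by (simp split: if_splits)
  then have "lk A 1 + lk A 1 = 2" by (metis lookup_target2(2) lookup_add)
  then have "lk A 1 = 1" by simp
  then show ?thesis using A(2) by metis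
qed

lemma sym_tensor_low_degree_2:
  assumes f: "sym_tensor 2 n f" and n: "1 \<le> n" and k: "\<And>m. m \<in> supp f \<Longrightarrow> n - 1 \<le> lk m 0"
  obtains R where "R \<in> carrier_mat 2 2" "f = lin_subst 2 R (nf 2 n)"
proof -
  obtain g where g: "f = Var 0 ^ (n - 1) * g" "sym_tensor 2 (n - (n - 1)) g"
    using divide_Var0_power[OF f k] by auto
  then obtain a where a: "g = lform 2 a" using n sym_tensor_1_lform[of 2 g] by auto
  define R where "R = mat 2 2 (\<lambda>(i, j). if i = 0 then (if j = 0 then 1 else 0) else a j)"
  have "lin_subst 2 R (Var 0) = Var 0" "lin_subst 2 R (Var 1) = lform 2 a"
    by (simp_all add: LS_Var lform_2 R_def)
  then have "f = lin_subst 2 R (nf 2 n)"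
    by (simp add: nf_def g(1) a LS.hom_mult LS.hom_power)
  then show ?thesis using that[of R] by (simp add: R_def)
qed

lemma binary_power_imp_GL_equiv:
  assumes f: "sym_tensor 2 n f" and n: "3 \<le> n" and H: "power_of_linear_form 2 (2 * (n - 2)) (Hess 2 f)"
  shows "GL_equiv 2 f (nf 2 n)"
proof -
  obtain B c where B: "B \<in> carrier_mat 2 2" "det B \<noteq> 0" "c \<noteq> 0"
    "Hess 2 (lin_subst 2 B f) = Const c * Var 0 ^ (2 * (n - 2))"
    using hess_power_normalize[OF H] by metis
  let ?g = "lin_subst 2 B f"
  have g: "sym_tensor 2 n ?g" using sym_tensor_LS[OF f] .
  have "n - 1 \<le> lk m 0" if "m \<in> supp ?g" for m
    using binary_hess_power_support[OF g n B(4,3)] that binary_exponents(1)[OF g that] by auto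
  then obtain R where R: "R \<in> carrier_mat 2 2" "?g = lin_subst 2 R (nf 2 n)"
    using sym_tensor_low_degree_2[OF g, of thesis] n by auto
  have "GL_equiv 2 ?g (nf 2 n)" using GL_equivI[OF R] B by simp
  then show ?thesis using GL_equiv_LS_cancel B f by blast
qed

section \<open>Ternary forms with power Hessian: the Newton polygon\<close>

lemma ternary_exponents: assumes "sym_tensor 3 n f" "m \<in> supp f"
  shows "lk m 0 + lk m 1 + lk m 2 = n" "i \<noteq> 0 \<Longrightarrow> i \<noteq> 1 \<Longrightarrow> i \<noteq> 2 \<Longrightarrow> lk m i = 0"
  using sym_tensorD(2)[OF assms] sym_tensorD(3)[OF assms] by (auto simp: sum_lessThan_3)

lemma ternary_exponents_eqI: assumes "sym_tensor 3 n f" "m \<in> supp f" "m' \<in> supp f" "lk m 0 = lk m' 0" "lk m 2 = lk m' 2"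
  shows "m = m'"
proof (rule poly_mapping_eqI)
  fix i show "lk m i = lk m' i"
    using ternary_exponents(1)[OF assms(1,2)] ternary_exponents(2)[OF assms(1,2), of i]
      ternary_exponents(1)[OF assms(1,3)] ternary_exponents(2)[OF assms(1,3), of i] assms(4,5)
    by (cases "i = 0"; cases "i = 1"; cases "i = 2") auto
qed

lemma ternary_exponents_eqI': assumes "sym_tensor 3 n f" "m \<in> supp f" "m' \<in> supp f" "lk m 1 = lk m' 1" "lk m 2 = lk m' 2"
  shows "m = m'"
  using ternary_exponents_eqI[OF assms(1-3)] ternary_exponents(1)[OF assms(1,2)] ternary_exponents(1)[OF assms(1,3)] assms(4,5) by simp

lemma hess_weight3_diag: "hess_weight3 a a a = of_nat (lk a 0) * of_nat (lk a 1) * of_nat (lk a 2)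
    * (of_nat (lk a 0) + of_nat (lk a 1) + of_nat (lk a 2) - 1)"
  by (simp add: hess_weight3_def euler2_weight_def algebra_simps)

text \<open>
  On an edge that starts at \<open>x_2\<close>-exponent 0 the total weight of the three orderings of \<open>(a, a, b)\<close> factors.\<close>
lemma hess_weight3_edge_2: assumes "lk a 2 = 0"
  shows "hess_weight3 a a b + hess_weight3 a b a + hess_weight3 b a a
    = - (of_nat (lk b 2) * (of_nat (lk b 2) - 1) * (of_nat (lk a 0) * of_nat (lk a 1) * (of_nat (lk a 0) + of_nat (lk a 1) - 1)))"
  using assms by (simp add: hess_weight3_def euler2_weight_def algebra_simps)

lemma hess_weight3_edge_0: assumes "lk a 0 = 0"
  shows "hess_weight3 a a b + hess_weight3 a b a + hess_weight3 b a a
    = - (of_nat (lk b 0) * (of_nat (lk b 0) - 1) * (of_nat (lk a 1) * of_nat (lk a 2) * (of_nat (lk a 1) + of_nat (lk a 2) - 1)))"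
  using assms by (simp add: hess_weight3_def euler2_weight_def algebra_simps)

lemma of_nat_minus_1_neq_0: "2 \<le> k \<Longrightarrow> of_nat k - (1::complex) \<noteq> 0"
  using of_nat_eq_1_iff[of k, where ?'a = complex] by auto

lemma of_nat_add_minus_1_neq_0: "1 \<le> j \<Longrightarrow> 1 \<le> k \<Longrightarrow> of_nat j + of_nat k - (1::complex) \<noteq> 0"
  using of_nat_minus_1_neq_0[of "j + k"] by simp

definition wt :: "real \<Rightarrow> real \<Rightarrow> real \<Rightarrow> (nat \<Rightarrow>\<^sub>0 nat) \<Rightarrow> real" where
  "wt p q r m = p * lk m 0 + q * lk m 1 + r * lk m 2"

lemma wt_add: "wt p q r (a + b) = wt p q r a + wt p q r b"
  by (simp add: wt_def lookup_add algebra_simps)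

text \<open>
  A ternary form whose Hessian is a nonzero multiple of a power of \<open>x_0\<close>.\<close>
locale ternary_hess_power =
  fixes f :: cpoly and n N :: nat and c :: complex
  assumes f: "sym_tensor 3 n f" and n: "3 \<le> n" and H: "Hess 3 f = Const c * Var 0 ^ N" and c: "c \<noteq> 0"
begin

text \<open>
  The target sum is attained, since its coefficient is not zero.\<close>
lemma triple_exists: obtains u v w where "u \<in> supp f" "v \<in> supp f" "w \<in> supp f"
    "lk u 1 + lk v 1 + lk w 1 = 2" "lk u 2 + lk v 2 + lk w 2 = 2"
proof -
  have "triple_sums f (target3 N) \<noteq> {}"
  proof
    assume "triple_sums f (target3 N) = {}"
    then show False using Hess_3_power_coeff[OF H, of "target3 N"] c by simp
  qed
  then obtain u v w where uvw: "u \<in> supp f" "v \<in> supp f" "w \<in> supp f" "u + v + w = target3 N" by (auto simp: triple_sums_def)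
  have "lk u 1 + lk v 1 + lk w 1 = 2" "lk u 2 + lk v 2 + lk w 2 = 2"
    using arg_cong[OF uvw(4), of "\<lambda>m. lk m 1"] arg_cong[OF uvw(4), of "\<lambda>m. lk m 2"]
    by (simp_all add: lookup_add lookup_target3)
  with uvw that show ?thesis by blast
qed

text \<open>
  If \<open>A\<close> is the unique maximum of a weight, refined by a second one, then \<open>A + A + A\<close> arises only from \<open>A\<close>, and its weight
  is nonzero when all exponents of \<open>A\<close> are positive. But the target has \<open>x_1\<close>-exponent 2, which is not divisible by 3.\<close>
lemma no_interior_vertex:
  assumes A: "A \<in> supp f" "1 \<le> lk A 0" "1 \<le> lk A 1" "1 \<le> lk A 2"
    and w: "\<And>m. m \<in> supp f \<Longrightarrow> wt p q r m \<le> wt p q r A"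
    and v: "\<And>m. m \<in> supp f \<Longrightarrow> wt p q r m = wt p q r A \<Longrightarrow> wt p' q' r' m \<le> wt p' q' r' A"
    and e: "\<And>m. m \<in> supp f \<Longrightarrow> wt p q r m = wt p q r A \<Longrightarrow> wt p' q' r' m = wt p' q' r' A \<Longrightarrow> m = A"
  shows False
proof -
  have triple_sums: "triple_sums f (A + A + A) = {(A, A, A)}"
  proof (intro equalityI subsetI)
    fix t assume "t \<in> triple_sums f (A + A + A)"
    then obtain x y z where xyz: "t = (x, y, z)" "x \<in> supp f" "y \<in> supp f" "z \<in> supp f" "x + y + z = A + A + A"
      by (auto simp: triple_sums_def)
    have 1: "wt p q r x + wt p q r y + wt p q r z = wt p q r A + wt p q r A + wt p q r A"
      using arg_cong[OF xyz(5), of "wt p q r"] by (simp add: wt_add)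
    have eq: "wt p q r x = wt p q r A" "wt p q r y = wt p q r A" "wt p q r z = wt p q r A"
      using 1 w[OF xyz(2)] w[OF xyz(3)] w[OF xyz(4)] by linarith+
    have 2: "wt p' q' r' x + wt p' q' r' y + wt p' q' r' z = wt p' q' r' A + wt p' q' r' A + wt p' q' r' A"
      using arg_cong[OF xyz(5), of "wt p' q' r'"] by (simp add: wt_add)
    have eq': "wt p' q' r' x = wt p' q' r' A" "wt p' q' r' y = wt p' q' r' A" "wt p' q' r' z = wt p' q' r' A"
      using 2 v[OF xyz(2) eq(1)] v[OF xyz(3) eq(2)] v[OF xyz(4) eq(3)] by linarith+
    show "t \<in> {(A, A, A)}"
      using e[OF xyz(2) eq(1) eq'(1)] e[OF xyz(3) eq(2) eq'(2)] e[OF xyz(4) eq(3) eq'(3)] xyz(1) by simp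
  qed (use A in \<open>auto simp: triple_sums_def\<close>)
  have "of_nat (lk A 0) + of_nat (lk A 1) + of_nat (lk A 2) - (1::complex) \<noteq> 0"
    using of_nat_add_minus_1_neq_0[of "lk A 0 + lk A 1" "lk A 2"] A by simp
  then have "hess_weight3 A A A \<noteq> 0" unfolding hess_weight3_diag using A by simp
  then have "(\<Sum>(a, b, e)\<in>triple_sums f (A + A + A). lk f a * lk f b * lk f e * hess_weight3 a b e) \<noteq> 0"
    using A(1) by (simp add: triple_sums in_keys_iff)
  then have "A + A + A = target3 N" using Hess_3_power_coeff[OF H, of "A + A + A"] by (simp split: if_splits)
  then have "lk A 1 + lk A 1 + lk A 1 = 2" by (metis lookup_target3(2) lookup_add)
  then show False by presburger
qed

text \<open>
  \<open>A\<close> and \<open>B\<close> lie on the face where the weight is maximal, and along this face \<open>B\<close> is next to \<open>A\<close> in the sense that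
  no exponent other than \<open>A\<close> has \<open>x_i\<close>-exponent below \<open>k\<close>. Then \<open>A + A + B\<close> arises only by reordering, with nonzero weight since
  \<open>k \<ge> 2\<close>, and is the target.\<close>
lemma edge_sum_eq_target:
  assumes A: "A \<in> supp f" "lk A i = 0" and B: "B \<in> supp f" "lk B i = k" "2 \<le> k"
    and i: "i = 2 \<and> 1 \<le> lk A 0 \<and> 1 \<le> lk A 1 \<or> i = 0 \<and> 1 \<le> lk A 1 \<and> 1 \<le> lk A 2"
    and w: "\<And>m. m \<in> supp f \<Longrightarrow> wt p q r m \<le> W" and W: "wt p q r A = W" "wt p q r B = W"
    and e: "\<And>m. m \<in> supp f \<Longrightarrow> wt p q r m = W \<Longrightarrow> m \<noteq> A \<Longrightarrow> k \<le> lk m i"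
  shows "2 * lk A 0 + lk B 0 = N + 2" "2 * lk A 1 + lk B 1 = 2" "2 * lk A 2 + lk B 2 = 2"
proof -
  have AB: "A \<noteq> B" using A B by auto
  have triple_sums: "triple_sums f (A + A + B) = {(A, A, B), (A, B, A), (B, A, A)}"
  proof (intro equalityI subsetI)
    fix t assume "t \<in> triple_sums f (A + A + B)"
    then obtain x y z where xyz: "t = (x, y, z)" "x \<in> supp f" "y \<in> supp f" "z \<in> supp f" "x + y + z = A + A + B"
      by (auto simp: triple_sums_def)
    have 1: "wt p q r x + wt p q r y + wt p q r z = W + W + W"
      using arg_cong[OF xyz(5), of "wt p q r"] by (simp add: wt_add W)
    have eq: "wt p q r x = W" "wt p q r y = W" "wt p q r z = W"
      using 1 w[OF xyz(2)] w[OF xyz(3)] w[OF xyz(4)] by linarith+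
    have 2: "lk x i + lk y i + lk z i = k"
      using arg_cong[OF xyz(5), of "\<lambda>m. lk m i"] A B by (simp add: lookup_add)
    have x: "x = A \<or> k \<le> lk x i" and y: "y = A \<or> k \<le> lk y i" and z: "z = A \<or> k \<le> lk z i"
      using e xyz eq by blast+
    from x y z consider "x = A" "y = A" | "x = A" "z = A" | "y = A" "z = A"
      using 2 B(3) by (metis add_le_cancel_left add_le_same_cancel1 le_add1 le_add2 le_trans not_numeral_le_zero add.commute)
    then show "t \<in> {(A, A, B), (A, B, A), (B, A, A)}"
      using xyz(1,5) by cases (auto simp: add.commute add.left_commute add.assoc)
  qed (use A B in \<open>auto simp: triple_sums_def add.commute add.left_commute add.assoc\<close>)
  have "hess_weight3 A A B + hess_weight3 A B A + hess_weight3 B A A \<noteq> 0"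
    using i
  proof
    assume i: "i = 2 \<and> 1 \<le> lk A 0 \<and> 1 \<le> lk A 1"
    then have "lk A 2 = 0" "2 \<le> lk B 2" using A B by auto
    then show ?thesis using hess_weight3_edge_2[of A B] i of_nat_add_minus_1_neq_0[of "lk A 0" "lk A 1"] of_nat_minus_1_neq_0[of "lk B 2"] by auto
  next
    assume i: "i = 0 \<and> 1 \<le> lk A 1 \<and> 1 \<le> lk A 2"
    then have "lk A 0 = 0" "2 \<le> lk B 0" using A B by auto
    then show ?thesis using hess_weight3_edge_0[of A B] i of_nat_add_minus_1_neq_0[of "lk A 1" "lk A 2"] of_nat_minus_1_neq_0[of "lk B 0"] by auto
  qed
  moreover have "(\<Sum>(a, b, e)\<in>triple_sums f (A + A + B). lk f a * lk f b * lk f e * hess_weight3 a b e)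
      = lk f A * lk f A * lk f B * (hess_weight3 A A B + hess_weight3 A B A + hess_weight3 B A A)"
    unfolding triple_sums using AB by (simp add: algebra_simps)
  ultimately have "(\<Sum>(a, b, e)\<in>triple_sums f (A + A + B). lk f a * lk f b * lk f e * hess_weight3 a b e) \<noteq> 0"
    using A(1) B(1) by (simp add: in_keys_iff)
  then have T: "A + A + B = target3 N" using Hess_3_power_coeff[OF H, of "A + A + B"] by (simp split: if_splits)
  show "2 * lk A 0 + lk B 0 = N + 2" "2 * lk A 1 + lk B 1 = 2" "2 * lk A 2 + lk B 2 = 2"
    using arg_cong[OF T, of "\<lambda>m. lk m 0"] arg_cong[OF T, of "\<lambda>m. lk m 1"] arg_cong[OF T, of "\<lambda>m. lk m 2"]
    by (simp_all add: lookup_add lookup_target3)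
qed

text \<open>
  Here \<open>f\<close> restricted to its lowest power of \<open>x_0\<close> is a power of \<open>x_2\<close>, with exponent vector \<open>C\<close>. Let \<open>U\<close> be the exponent with the largest
  power \<open>I\<close> of \<open>x_1\<close>; by \<open>no_interior_vertex\<close> it is free of \<open>x_2\<close>. The edge that leaves \<open>U\<close> towards larger powers of \<open>x_2\<close> has slope \<open>s < 1\<close>,
  because \<open>C\<close> lies far out, so its nearest point has \<open>x_2\<close>-exponent at least 2. Comparison with the target gives
  \<open>I = 1\<close> and \<open>s = 1/2\<close>, which is the claimed half-plane.\<close>
lemma support_from_tip:
  assumes C: "C \<in> supp f" "1 \<le> lk C 2" and m: "\<And>m. m \<in> supp f \<Longrightarrow> m \<noteq> C \<Longrightarrow> lk m 1 + lk m 2 < lk C 2"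
  assumes C1: "lk C 1 = 0" and mu: "mu \<in> supp f"
  shows "2 * lk mu 1 + lk mu 2 \<le> 2"
proof -
  obtain u v w where uvw: "u \<in> supp f" "v \<in> supp f" "w \<in> supp f" "lk u 1 + lk v 1 + lk w 1 = 2"
    using triple_exists by metis
  then have ne: "{m \<in> supp f. 1 \<le> lk m 1} \<noteq> {}" by auto (metis One_nat_def Suc_le_eq add_is_0 not_gr_zero numeral_eq_Suc zero_neq_one zero_less_numeral less_irrefl)
  obtain U0 where U0: "U0 \<in> supp f" "1 \<le> lk U0 1" "\<And>y. y \<in> supp f \<Longrightarrow> lk y 1 \<le> lk U0 1"
  proof -
    obtain x where "x \<in> {m \<in> supp f. 1 \<le> lk m 1}" "\<And>y. y \<in> {m \<in> supp f. 1 \<le> lk m 1} \<Longrightarrow> lk y 1 \<le> lk x 1"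
      using argmax_ex[OF _ ne, of "\<lambda>m. lk m 1"] by auto
    then show ?thesis using that[of x] by (metis (mono_tags, lifting) le_trans mem_Collect_eq nle_le)
  qed
  define I where "I = lk U0 1"
  have neI: "{m \<in> supp f. lk m 1 = I} \<noteq> {}" using U0 I_def by auto
  obtain U where U': "U \<in> {m \<in> supp f. lk m 1 = I}" "\<And>y. y \<in> {m \<in> supp f. lk m 1 = I} \<Longrightarrow> lk y 2 \<le> lk U 2"
    using argmax_ex[OF _ neI, of "\<lambda>m. lk m 2"] by auto
  then have U: "U \<in> supp f" "lk U 1 = I" "1 \<le> I" "\<And>y. y \<in> supp f \<Longrightarrow> lk y 1 \<le> I"
    "\<And>y. y \<in> supp f \<Longrightarrow> lk y 1 = I \<Longrightarrow> lk y 2 \<le> lk U 2"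
    using U0 I_def by auto
  have UC: "U \<noteq> C" using U C1 by auto
  have Cn: "lk C 2 \<le> n" using ternary_exponents(1)[OF f C(1)] by simp
  have Ulow: "lk U 1 + lk U 2 < lk C 2" using m[OF U(1) UC] .
  have Upos: "1 \<le> lk U 0" using ternary_exponents(1)[OF f U(1)] Ulow Cn by linarith
  have U2: "lk U 2 = 0"
  proof (rule ccontr)
    assume "lk U 2 \<noteq> 0"
    then have U2': "1 \<le> lk U 2" by simp
    show False
    proof (rule no_interior_vertex[OF U(1) Upos _ U2', of 0 1 0 0 0 1])
      show "1 \<le> lk U 1" using U by simp
      show "m = U" if "m \<in> supp f" "wt 0 1 0 m = wt 0 1 0 U" "wt 0 0 1 m = wt 0 0 1 U" for m
        using that ternary_exponents_eqI'[OF f that(1) U(1)] by (simp add: wt_def)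
    qed (use U in \<open>auto simp: wt_def\<close>)
  qed
  have Uuniq: "y = U" if "y \<in> supp f" "lk y 1 = I" for y
    using ternary_exponents_eqI'[OF f that(1) U(1)] U(5)[OF that] that(2) U(2) U2 by simp
  (* The slope of the segment from U to m in the plane of the exponents of x_2 and x_1. *)
  define rho where "rho = (\<lambda>m :: nat \<Rightarrow>\<^sub>0 nat. (real I - real (lk m 1)) / real (lk m 2))"
  let ?S = "{m \<in> supp f. 1 \<le> lk m 2}"
  have neS: "?S \<noteq> {}" using C by auto
  obtain B0 where B0: "B0 \<in> ?S" "\<And>y. y \<in> ?S \<Longrightarrow> rho B0 \<le> rho y"
    using argmin_ex[OF _ neS, of rho] by auto
  define s where "s = rho B0"
  have ne2: "{m \<in> ?S. rho m = s} \<noteq> {}" using B0 s_def by auto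
  obtain B where B: "B \<in> {m \<in> ?S. rho m = s}" "\<And>y. y \<in> {m \<in> ?S. rho m = s} \<Longrightarrow> lk B 2 \<le> lk y 2"
    using argmin_ex[OF _ ne2, of "\<lambda>m. lk m 2"] by auto
  have Bs: "B \<in> supp f" "1 \<le> lk B 2" "rho B = s" using B by auto
  have smin: "real I - lk y 1 \<ge> s * lk y 2" if "y \<in> supp f" for y
  proof (cases "1 \<le> lk y 2")
    case True
    then have "s \<le> rho y" using B0 that s_def by auto
    then show ?thesis using True by (simp add: rho_def pos_le_divide_eq)
  next
    case False
    then have "lk y 2 = 0" by simp
    then show ?thesis using U(4)[OF that] by simp
  qed
  have IC: "I < lk C 2" using Ulow U by simp
  have "s * lk C 2 \<le> I" using smin[OF C(1)] C1 by simp
  also have "\<dots> < 1 * lk C 2" using IC by simp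
  finally have s1: "s < 1" using C(2) by simp
  have sB: "real I - lk B 1 = s * lk B 2" using Bs by (auto simp: rho_def)
  have B2: "2 \<le> lk B 2"
  proof (rule ccontr)
    assume "\<not> 2 \<le> lk B 2"
    then have "lk B 2 = 1" using Bs by simp
    then have "real I - lk B 1 < 1" using sB s1 by simp
    then have "lk B 1 = I" using U(4)[OF Bs(1)] by linarith
    then show False using Uuniq[OF Bs(1)] U2 Bs(2) by simp
  qed
  have ed: "2 * lk U 1 + lk B 1 = 2" "2 * lk U 2 + lk B 2 = 2"
  proof -
    have r: "wt 0 1 s m \<le> I" if "m \<in> supp f" for m using smin[OF that] by (simp add: wt_def)
    have k: "lk B 2 \<le> lk y 2" if "y \<in> supp f" "wt 0 1 s y = I" "y \<noteq> U" for y
    proof -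
      have "lk y 2 \<noteq> 0"
      proof
        assume "lk y 2 = 0"
        then have "lk y 1 = I" using that(2) by (simp add: wt_def)
        then show False using Uuniq that by simp
      qed
      then have "y \<in> {m \<in> ?S. rho m = s}" using that by (auto simp: rho_def wt_def field_simps)
      then show ?thesis using B(2) by simp
    qed
    have i: "2 = (2::nat) \<and> 1 \<le> lk U 0 \<and> 1 \<le> lk U 1 \<or> 2 = (0::nat) \<and> 1 \<le> lk U 1 \<and> 1 \<le> lk U 2"
      using Upos U by simp
    note ed = edge_sum_eq_target[OF U(1) U2 Bs(1) refl B2 i r _ _ k]
    show "2 * lk U 1 + lk B 1 = 2" "2 * lk U 2 + lk B 2 = 2"
      by (rule ed; use U U2 sB in \<open>simp add: wt_def\<close>)+
  qed
  then have "I = 1" "lk B 1 = 0" "lk B 2 = 2" using U U2 by auto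
  then have sh: "s = 1 / 2" using sB by simp
  have "real I - lk mu 1 \<ge> 1 / 2 * lk mu 2" using smin[OF mu] unfolding sh .
  then have "real (2 * lk mu 1 + lk mu 2) \<le> real 2" using \<open>I = 1\<close> by simp
  then show ?thesis by (simp only: of_nat_le_iff)
qed

text \<open>
  Let \<open>A = x_1^{n-b} x_2^b\<close> be the point on the line at infinity with the smallest \<open>b\<close>, and consider the edge from \<open>A\<close> that descends most
  steeply in \<open>x_2\<close> per unit of \<open>x_0\<close>, with slope \<open>s\<close>. Its nearest point has \<open>x_0\<close>-exponent 1, by \<open>edge_sum_eq_target\<close>, so
  \<open>s\<close> is an integer, and \<open>s \<ge> 2\<close> because the coefficient that would give \<open>s = 1\<close> is absent. The far end \<open>V\<close> of the edge
  is free of \<open>x_2\<close> by \<open>no_interior_vertex\<close>, and \<open>edge_sum_eq_target\<close> at this end gives \<open>x_1\<close>-exponent 1. Then its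
  \<open>x_0\<close>-exponent is \<open>n - 1\<close>, and \<open>s (n - 1) = b < n\<close> is impossible.\<close>
lemma no_mixed_point_at_infinity:
  assumes A: "A \<in> supp f" "lk A 0 = 0" "1 \<le> lk A 1" "1 \<le> lk A 2"
    and Amin: "\<And>m. m \<in> supp f \<Longrightarrow> lk m 0 = 0 \<Longrightarrow> lk A 2 \<le> lk m 2"
    and kill: "\<And>m. m \<in> supp f \<Longrightarrow> lk m 0 = 1 \<Longrightarrow> lk m 2 \<noteq> lk A 2 - 1"
  shows False
proof -
  define b where "b = lk A 2"
  have bn: "b < n" "1 \<le> b" using ternary_exponents(1)[OF f A(1)] A by (auto simp: b_def)
  obtain u v w where uvw: "u \<in> supp f" "v \<in> supp f" "w \<in> supp f" "lk u 2 + lk v 2 + lk w 2 = 2"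
    using triple_exists by metis
  then have "lk u 2 = 0 \<or> lk v 2 = 0 \<or> lk w 2 = 0" by linarith
  then obtain z where z: "z \<in> supp f" "lk z 2 = 0" using uvw by blast
  let ?P = "{m \<in> supp f. lk m 2 < b}"
  have neP: "?P \<noteq> {}" using z bn by auto
  have P0: "1 \<le> lk m 0" if "m \<in> ?P" for m
    using Amin[of m] that by (cases "lk m 0 = 0") (auto simp: b_def)
  (* The slope of the segment from A to m in the plane of the exponents of x_0 and x_2. *)
  define rho where "rho = (\<lambda>m :: nat \<Rightarrow>\<^sub>0 nat. (real b - real (lk m 2)) / real (lk m 0))"
  obtain B0 where B0: "B0 \<in> ?P" "\<And>y. y \<in> ?P \<Longrightarrow> rho y \<le> rho B0"
    using argmax_ex[OF _ neP, of rho] by auto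
  define s where "s = rho B0"
  have spos: "0 < s" using B0(1) P0[OF B0(1)] by (auto simp: s_def rho_def)
  have smax: "real b \<le> s * lk m 0 + lk m 2" if "m \<in> supp f" for m
  proof (cases "lk m 2 < b")
    case True
    then have "rho m \<le> s" "1 \<le> lk m 0" using B0 P0 that s_def by auto
    then have "real b - lk m 2 \<le> s * lk m 0" by (simp add: rho_def pos_divide_le_eq)
    then show ?thesis by simp
  next
    case False
    then have "0 \<le> s * lk m 0" "real b \<le> lk m 2" using spos by auto
    then show ?thesis by linarith
  qed
  have wle: "wt (-s) 0 (-1) m \<le> - real b" if "m \<in> supp f" for m
    using smax[OF that] by (simp add: wt_def)
  have A_edge: "wt (-s) 0 (-1) A = - real b" using A by (simp add: wt_def b_def)
  let ?Ed = "{m \<in> supp f. wt (-s) 0 (-1) m = - real b \<and> 1 \<le> lk m 0}"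
  have neE: "?Ed \<noteq> {}"
  proof -
    have "1 \<le> lk B0 0" using P0[OF B0(1)] .
    then have "s * lk B0 0 = real b - lk B0 2" by (simp add: s_def rho_def)
    then have "B0 \<in> ?Ed" using B0(1) P0[OF B0(1)] by (auto simp: wt_def)
    then show ?thesis by auto
  qed
  have Aonly: "m = A" if "m \<in> supp f" "wt (-s) 0 (-1) m = - real b" "lk m 0 = 0" for m
    using that ternary_exponents_eqI[OF f that(1) A(1)] A(2) by (simp add: wt_def b_def)
  obtain B where B: "B \<in> ?Ed" "\<And>y. y \<in> ?Ed \<Longrightarrow> lk B 0 \<le> lk y 0"
    using argmin_ex[OF _ neE, of "\<lambda>m. lk m 0"] by auto
  have Bs: "B \<in> supp f" "wt (-s) 0 (-1) B = - real b" "1 \<le> lk B 0" using B by auto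
  have B01: "lk B 0 = 1"
  proof (rule ccontr)
    assume "lk B 0 \<noteq> 1"
    then have B2: "2 \<le> lk B 0" using Bs by simp
    have i: "0 = (2::nat) \<and> 1 \<le> lk A 0 \<and> 1 \<le> lk A 1 \<or> 0 = (0::nat) \<and> 1 \<le> lk A 1 \<and> 1 \<le> lk A 2" using A by simp
    have k: "lk B 0 \<le> lk y 0" if "y \<in> supp f" "wt (-s) 0 (-1) y = - real b" "y \<noteq> A" for y
      using B(2)[of y] Aonly[OF that(1,2)] that by (cases "lk y 0 = 0") auto
    note ed = edge_sum_eq_target[OF A(1,2) Bs(1) refl B2 i wle A_edge Bs(2) k]
    have "2 * lk A 1 + lk B 1 = 2" "2 * lk A 2 + lk B 2 = 2" by (rule ed; simp)+
    then show False using ternary_exponents(1)[OF f A(1)] A n by linarith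
  qed
  have sB: "s = real b - lk B 2" using Bs(2) B01 by (simp add: wt_def)
  have s2: "2 \<le> s"
  proof -
    have lt: "lk B 2 < b" using sB spos by simp
    have "lk B 2 \<noteq> b - 1" using kill[OF Bs(1) B01] by (simp add: b_def)
    then have "lk B 2 + 2 \<le> b" using lt by linarith
    then have "real (lk B 2) + 2 \<le> real b" by (metis of_nat_add of_nat_le_iff of_nat_numeral)
    then show ?thesis using sB by simp
  qed
  obtain V where V: "V \<in> ?Ed" "\<And>y. y \<in> ?Ed \<Longrightarrow> lk y 0 \<le> lk V 0"
    using argmax_ex[OF _ neE, of "\<lambda>m. lk m 0"] by auto
  have Vs: "V \<in> supp f" "wt (-s) 0 (-1) V = - real b" "1 \<le> lk V 0" using V by auto
  have Veq: "s * lk V 0 + lk V 2 = b" using Vs(2) by (simp add: wt_def)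
  have sV: "2 * real (lk V 0) \<le> s * lk V 0" using s2 by (intro mult_right_mono) auto
  have V1: "1 \<le> lk V 1"
  proof (rule ccontr)
    assume "\<not> 1 \<le> lk V 1"
    then have "real (lk V 0) + real (lk V 2) = n" using ternary_exponents(1)[OF f Vs(1)] by (metis add.right_neutral less_one not_le of_nat_add)
    then show False using Veq sV bn Vs(3) by linarith
  qed
  have V2: "lk V 2 = 0"
  proof (rule ccontr)
    assume "lk V 2 \<noteq> 0"
    then have V2': "1 \<le> lk V 2" by simp
    show False
    proof (rule no_interior_vertex[OF Vs(1) Vs(3) V1 V2', of "-s" 0 "-1" 1 0 0])
      fix m assume m: "m \<in> supp f"
      show "wt (-s) 0 (-1) m \<le> wt (-s) 0 (-1) V" using wle[OF m] Vs by simp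
      assume w: "wt (-s) 0 (-1) m = wt (-s) 0 (-1) V"
      show "wt 1 0 0 m \<le> wt 1 0 0 V" using V(2)[of m] w m Vs by (cases "lk m 0 = 0") (auto simp: wt_def)
      assume "wt 1 0 0 m = wt 1 0 0 V"
      then have e0: "lk m 0 = lk V 0" by (simp add: wt_def)
      moreover have "lk m 2 = lk V 2" using w e0 by (simp add: wt_def)
      ultimately show "m = V" using ternary_exponents_eqI[OF f m Vs(1)] by simp
    qed
  qed
  have sVb: "s * lk V 0 = b" using Veq V2 by simp
  have edge2: "real (lk m 2) = s * (real (lk V 0) - lk m 0)" if "wt (-s) 0 (-1) m = - real b" for m
    using that sVb by (simp add: wt_def algebra_simps)
  let ?F = "{m \<in> supp f. wt (-s) 0 (-1) m = - real b \<and> m \<noteq> V}"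
  have neF: "?F \<noteq> {}" using A A_edge Vs(3) by auto
  obtain C where C: "C \<in> ?F" "\<And>y. y \<in> ?F \<Longrightarrow> lk C 2 \<le> lk y 2"
    using argmin_ex[OF _ neF, of "\<lambda>m. lk m 2"] by auto
  have Cs: "C \<in> supp f" "wt (-s) 0 (-1) C = - real b" "C \<noteq> V" using C by auto
  have C2: "2 \<le> lk C 2"
  proof -
    have "lk C 0 \<noteq> lk V 0"
    proof
      assume e: "lk C 0 = lk V 0"
      then have "lk C 2 = lk V 2" using edge2[OF Cs(2)] V2 by simp
      then show False using ternary_exponents_eqI[OF f Cs(1) Vs(1) e] Cs(3) by simp
    qed
    moreover have "0 \<le> real (lk V 0) - lk C 0"
      using edge2[OF Cs(2)] spos by (metis of_nat_0_le_iff zero_le_mult_iff not_less)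
    ultimately have "1 \<le> real (lk V 0) - lk C 0" by linarith
    then have "s * 1 \<le> s * (real (lk V 0) - lk C 0)" using spos by (intro mult_left_mono) auto
    then have "2 \<le> real (lk C 2)" using edge2[OF Cs(2)] s2 by linarith
    then show ?thesis by simp
  qed
  have i: "2 = (2::nat) \<and> 1 \<le> lk V 0 \<and> 1 \<le> lk V 1 \<or> 2 = (0::nat) \<and> 1 \<le> lk V 1 \<and> 1 \<le> lk V 2" using Vs V1 by simp
  have k: "lk C 2 \<le> lk y 2" if "y \<in> supp f" "wt (-s) 0 (-1) y = - real b" "y \<noteq> V" for y
    using C(2)[of y] that by auto
  note ed = edge_sum_eq_target[OF Vs(1) V2 Cs(1) refl C2 i wle Vs(2) Cs(2) k]
  have "2 * lk V 1 + lk C 1 = 2" by (rule ed; simp)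
  then have "lk V 1 = 1" using V1 by simp
  then have "lk V 0 + 1 = n" using ternary_exponents(1)[OF f Vs(1)] V2 by simp
  then show False using sV sVb bn n by linarith
qed

end

section \<open>Ternary forms with power Hessian: the normal form\<close>

text \<open>
  At a unit point only the pure power of one variable survives.\<close>
lemma ev_unit_point: assumes "sym_tensor d m g" "j < d"
  shows "ev (\<lambda>i. if i = j then 1 else 0) g = lk g (Poly_Mapping.single j m)"
proof -
  let ?x = "\<lambda>i. if i = j then 1 else (0::complex)"
  have 1: "monom_val ?x p = (if p = Poly_Mapping.single j m then 1 else 0)" if p: "p \<in> supp g" for p
  proof (cases "p = Poly_Mapping.single j m")
    case True
    then show ?thesis by (simp add: monom_val_def)
  next
    case False
    have "\<exists>i. i \<noteq> j \<and> lk p i \<noteq> 0"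
    proof (rule ccontr)
      assume z: "\<not> (\<exists>i. i \<noteq> j \<and> lk p i \<noteq> 0)"
      have "(\<Sum>i<d. lk p i) = (\<Sum>i<d. if i = j then lk p j else 0)" by (rule sum.cong) (use z in auto)
      then have "lk p j = m" using sym_tensorD(2)[OF assms(1) p] assms(2) by simp
      then have "lk p i = lk (Poly_Mapping.single j m) i" for i using z by (cases "i = j") (auto simp: lookup_single)
      with False show False using poly_mapping_eqI[of p "Poly_Mapping.single j m"] by blast
    qed
    then obtain i where i: "i \<noteq> j" "lk p i \<noteq> 0" by blast
    then have "monom_val ?x p = 0"
      unfolding monom_val_def by (intro prod_zero) (auto simp: in_keys_iff intro!: bexI[of _ i])
    with False show ?thesis by simp
  qed
  have "ev ?x g = (\<Sum>p\<in>supp g. if p = Poly_Mapping.single j m then lk g p else 0)"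
    unfolding ev_def msub_def by (intro sum.cong refl) (simp add: 1)
  then show ?thesis by (simp add: sum.delta in_keys_iff)
qed

text \<open>
  If the dehomogenization in one chart has no zero, it is a constant \<open>c\<close>; in the other chart the form is then \<open>c s^m\<close>, which vanishes at 0.\<close>
lemma zero_on_line_at_infinity:
  assumes g: "sym_tensor 3 m g" and m: "1 \<le> m"
  obtains r s where "r \<noteq> 0 \<or> s \<noteq> 0" "ev (\<lambda>i. if i = 1 then r else if i = 2 then s else 0) g = 0"
proof -
  let ?e = "\<lambda>i::nat. \<lambda>k. if k = i then 1 else (0::complex)"
  let ?q = "evline (?e 1) (?e 2) g"
  have q: "poly ?q t = ev (\<lambda>i. if i = 1 then 1 else if i = 2 then t else 0) g" for t
    unfolding poly_evline by (intro arg_cong[of _ _ "\<lambda>x. ev x g"]) auto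
  show ?thesis
  proof (cases "\<exists>t. poly ?q t = 0")
    case True
    then obtain t where "ev (\<lambda>i. if i = 1 then 1 else if i = 2 then t else 0) g = 0" using q by auto
    then show ?thesis by (intro that[of 1 t]) simp_all
  next
    case False
    then have "constant (poly ?q)" using fundamental_theorem_of_algebra by blast
    then obtain c where c: "\<And>t. poly ?q t = c" unfolding constant_def by metis
    let ?p = "evline (?e 2) (?e 1) g"
    have p: "poly ?p s = ev (\<lambda>i. if i = 1 then s else if i = 2 then 1 else 0) g" for s
      unfolding poly_evline by (intro arg_cong[of _ _ "\<lambda>x. ev x g"]) auto
    have "poly (?p - monom c m) s = 0" if "s \<noteq> 0" for s
    proof -
      have "(\<lambda>i::nat. if i = 1 then s else if i = 2 then 1 else 0) = (\<lambda>i. s * (if i = 1 then 1 else if i = 2 then 1 / s else 0))"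
        using that by auto
      then have "poly ?p s = s ^ m * poly ?q (1 / s)" unfolding p q using ev_scale[OF g, of s] by simp
      then show ?thesis by (simp add: c poly_monom)
    qed
    then have "UNIV - {0} \<subseteq> {s. poly (?p - monom c m) s = 0}" by auto
    moreover have "infinite (UNIV - {0::complex})" by (simp add: infinite_UNIV_char_0)
    ultimately have "?p - monom c m = 0" using poly_roots_finite finite_subset by blast
    then have "poly ?p 0 = poly (monom c m) 0" by simp
    then have "ev (\<lambda>i. if i = 1 then 0 else if i = 2 then 1 else 0) g = 0" unfolding p using m by (simp add: poly_monom)
    then show ?thesis by (intro that[of 0 1]) simp_all
  qed
qed

text \<open>
  A change of variables that fixes \<open>x_0\<close> and moves the point \<open>(1 : 0)\<close> of the line at infinity to \<open>(r : s)\<close>.\<close>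
definition line_frame :: "complex \<Rightarrow> complex \<Rightarrow> complex mat" where
  "line_frame r s = mat 3 3 (\<lambda>(i, j). if i = 0 then (if j = 0 then 1 else 0)
     else if i = 1 then (if j = 1 then r else if j = 2 \<and> r = 0 then 1 else 0)
     else (if j = 1 then s else if j = 2 \<and> r \<noteq> 0 then 1 else 0))"

lemma line_frame_invertible: "line_frame r s \<in> carrier_mat 3 3" "r \<noteq> 0 \<or> s \<noteq> 0 \<Longrightarrow> det (line_frame r s) \<noteq> 0"
  by (auto simp: line_frame_def det_mat_3)

lemma LS_line_frame_Var0: "lin_subst 3 (line_frame r s) (Var 0) = Var 0"
  by (simp add: LS_Var lform_3 line_frame_def)

text \<open>
  The half-plane \<open>2 m_1 + m_2 \<le> 2\<close> contains only the exponents of \<open>x_0^{n-2} (x_0 L + c x_2\<^sup>2)\<close>.\<close>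
lemma sym_tensor_low_degree_3:
  assumes f: "sym_tensor 3 n f" and n: "2 \<le> n" and k: "\<And>m. m \<in> supp f \<Longrightarrow> 2 * lk m 1 + lk m 2 \<le> 2"
  obtains R where "R \<in> carrier_mat 3 3" "f = lin_subst 3 R (nf 3 n)"
proof -
  have "n - 2 \<le> lk m 0" if "m \<in> supp f" for m
    using k[OF that] ternary_exponents(1)[OF f that] by linarith
  then obtain g where g: "f = Var 0 ^ (n - 2) * g" "sym_tensor 3 (n - (n - 2)) g"
    using divide_Var0_power[OF f] by auto
  have g2: "sym_tensor 3 2 g" using g(2) n by simp
  define sm where "sm = (\<lambda>i j. Poly_Mapping.single i 1 + Poly_Mapping.single (j::nat) (1::nat))"
  have sm: "lk (sm i j) k = (if i = k then 1 else 0) + (if j = k then 1 else 0)" for i j k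
    by (simp add: sm_def lookup_add lookup_single when_def)
  let ?S = "{sm 0 0, sm 0 1, sm 0 2, sm 2 (2::nat)}"
  have sub: "supp g \<subseteq> ?S"
  proof
    fix m assume m: "m \<in> supp g"
    then have "m + Poly_Mapping.single 0 (n - 2) \<in> supp f"
      unfolding g(1) in_keys_iff lookup_Var0_power_mult by simp
    then have k': "2 * lk m 1 + lk m 2 \<le> 2" using k by (force simp: lookup_add lookup_single)
    have d: "lk m 0 + lk m 1 + lk m 2 = 2" using ternary_exponents(1)[OF g2 m] .
    have z: "lk m i = 0" if "i \<noteq> 0" "i \<noteq> 1" "i \<noteq> 2" for i using ternary_exponents(2)[OF g2 m that] .
    have eqI: "m = sm a b" if "lk m 0 = lk (sm a b) 0" "lk m 1 = lk (sm a b) 1" "lk m 2 = lk (sm a b) 2" "a \<in> {0,1,2}" "b \<in> {0,1,2}" for a b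
    proof (rule poly_mapping_eqI)
      fix i show "lk m i = lk (sm a b) i"
        using that z[of i] by (cases "i = 0"; cases "i = 1"; cases "i = 2") (auto simp: sm)
    qed
    have "(lk m 1 = 0 \<and> lk m 2 = 0) \<or> (lk m 1 = 1 \<and> lk m 2 = 0) \<or> (lk m 1 = 0 \<and> lk m 2 = 1) \<or> (lk m 1 = 0 \<and> lk m 2 = 2)"
      using k' by linarith
    then have "m = sm 0 0 \<or> m = sm 0 1 \<or> m = sm 0 2 \<or> m = sm 2 2"
      using d eqI[of 0 0] eqI[of 0 1] eqI[of 0 2] eqI[of 2 2] by (auto simp: sm)
    then show "m \<in> ?S" by auto
  qed
  have "g = (\<Sum>m\<in>?S. Poly_Mapping.single m (lk g m))"
    by (subst cpoly_expand, rule sum.mono_neutral_left) (use sub in \<open>auto simp: in_keys_iff\<close>)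
  also have "\<dots> = Poly_Mapping.single (sm 0 0) (lk g (sm 0 0)) + Poly_Mapping.single (sm 0 1) (lk g (sm 0 1))
     + Poly_Mapping.single (sm 0 2) (lk g (sm 0 2)) + Poly_Mapping.single (sm 2 2) (lk g (sm 2 2))"
  proof -
    have d: "sm 0 0 \<noteq> sm 0 1" "sm 0 0 \<noteq> sm 0 (2::nat)" "sm 0 0 \<noteq> sm 2 (2::nat)" "sm 0 1 \<noteq> sm 0 (2::nat)" "sm 0 1 \<noteq> sm 2 (2::nat)" "sm 0 (2::nat) \<noteq> sm 2 2"
      by (auto dest!: arg_cong[of _ _ "\<lambda>m. (lk m 0, lk m 1, lk m 2)"] simp: sm)
    show ?thesis
      using d by (subst sum.insert, simp, fastforce, subst sum.insert, simp, fastforce, subst sum.insert, simp, fastforce)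
        (simp only: sum.insert finite.emptyI sum.empty empty_iff not_False_eq_True add.assoc add_0_right)
  qed
  also have "\<dots> = Var 0 * (Const (lk g (sm 0 0)) * Var 0 + Const (lk g (sm 0 1)) * Var 1 + Const (lk g (sm 0 2)) * Var 2)
     + Const (lk g (sm 2 2)) * Var 2 ^ 2"
  proof -
    have "Poly_Mapping.single (sm i j) a = Var i * (Const a * Var j)" for i j a
      by (simp add: Var_def Const_def mult_single sm_def)
    then show ?thesis by (simp add: distrib_left power2_eq_square mult.left_commute)
  qed
  finally have ge: "g = Var 0 * (Const (lk g (sm 0 0)) * Var 0 + Const (lk g (sm 0 1)) * Var 1 + Const (lk g (sm 0 2)) * Var 2)
     + Const (lk g (sm 2 2)) * Var 2 ^ 2" .
  obtain z where z: "z ^ 2 = lk g (sm 2 2)" using complex_root_exists[of 2] by auto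
  define a where "a = (\<lambda>j::nat. if j = 0 then lk g (sm 0 0) else if j = 1 then lk g (sm 0 1) else lk g (sm 0 2))"
  define R where "R = mat 3 3 (\<lambda>(i, j). if i = 0 then (if j = 0 then 1 else 0) else if i = 1 then (if j = 2 then z else 0) else a j)"
  have R: "lin_subst 3 R (Var 0) = Var 0" "lin_subst 3 R (Var 1) = Const z * Var 2"
    "lin_subst 3 R (Var 2) = Const (a 0) * Var 0 + Const (a 1) * Var 1 + Const (a 2) * Var 2"
    by (simp_all add: LS_Var lform_3 R_def)
  have ge': "g = Var 0 * (Const (a 0) * Var 0 + Const (a 1) * Var 1 + Const (a 2) * Var 2) + Const (z ^ 2) * Var 2 ^ 2"
    using ge unfolding z by (simp only: a_def) simp
  have n1: "n - 1 = Suc (n - 2)" using n by simp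
  have "f = lin_subst 3 R (nf 3 n)"
    unfolding g(1) nf_def LS.hom_add LS.hom_mult LS.hom_power n1
    by (subst ge') (simp add: LS.hom_add LS.hom_mult LS.hom_power R power_mult_distrib Const.hom_power algebra_simps)
  then show ?thesis using that[of R] by (simp add: R_def)
qed

text \<open>
  Split off the largest power \<open>x_0^k\<close> and choose coordinates on the line at infinity such that the cofactor vanishes at
  \<open>(1 : 0)\<close>. Let \<open>A\<close> be the exponent with \<open>m_0 = k\<close> and the smallest power of \<open>x_2\<close>, which is positive. If \<open>A\<close>
  contained \<open>x_1\<close>, it would be an interior vertex for \<open>k > 0\<close>, and a mixed point at infinity, after a shear that removes one coefficient, for
  \<open>k = 0\<close>. So \<open>A\<close> is the tip required by \<open>support_from_tip\<close>.\<close>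
lemma ternary_support:
  assumes f: "sym_tensor 3 n f" and n: "3 \<le> n" and H: "Hess 3 f = Const c * Var 0 ^ N" and c: "c \<noteq> 0"
  obtains B where "B \<in> carrier_mat 3 3" "det B \<noteq> 0" "\<And>m. m \<in> supp (lin_subst 3 B f) \<Longrightarrow> 2 * lk m 1 + lk m 2 \<le> 2"
proof -
  interpret F: ternary_hess_power f n N c by unfold_locales fact+
  obtain u0 where u0: "u0 \<in> supp f" "1 \<le> lk u0 1"
  proof -
    obtain u v w where "u \<in> supp f" "v \<in> supp f" "w \<in> supp f" "lk u 1 + lk v 1 + lk w 1 = 2"
      using F.triple_exists by metis
    moreover from this have "1 \<le> lk u 1 \<or> 1 \<le> lk v 1 \<or> 1 \<le> lk w 1" by linarith
    ultimately show ?thesis using that by blast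
  qed
  then have ne: "supp f \<noteq> {}" by auto
  obtain K where K: "K \<in> supp f" "\<And>y. y \<in> supp f \<Longrightarrow> lk K 0 \<le> lk y 0"
    using argmin_ex[OF finite_keys ne, of "\<lambda>m. lk m 0"] by auto
  define k where "k = lk K 0"
  obtain g where g: "f = Var 0 ^ k * g" "sym_tensor 3 (n - k) g"
    using divide_Var0_power[OF f, of k] K k_def by auto
  have kn: "k < n" using K(2)[OF u0(1)] u0(2) ternary_exponents(1)[OF f u0(1)] by (simp add: k_def)
  define m where "m = n - k"
  have m: "1 \<le> m" "sym_tensor 3 m g" using kn g(2) by (auto simp: m_def)
  obtain r s where rs: "r \<noteq> 0 \<or> s \<noteq> 0" "ev (\<lambda>i. if i = 1 then r else if i = 2 then s else 0) g = 0"
    using zero_on_line_at_infinity[OF m(2,1)] .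
  let ?R = "line_frame r s"
  have R: "?R \<in> carrier_mat 3 3" "det ?R \<noteq> 0" using line_frame_invertible rs by auto
  define f1 where "f1 = lin_subst 3 ?R f"
  define g1 where "g1 = lin_subst 3 ?R g"
  have fg1: "f1 = Var 0 ^ k * g1" by (simp add: f1_def g1_def g(1) LS.hom_mult LS.hom_power LS_line_frame_Var0)
  have f1: "sym_tensor 3 n f1" unfolding f1_def by (rule sym_tensor_LS[OF f])
  have g1: "sym_tensor 3 m g1" unfolding g1_def by (rule sym_tensor_LS[OF m(2)])
  have H1: "Hess 3 f1 = Const (det ?R ^ 2 * c) * Var 0 ^ N"
    by (simp add: f1_def Hess_LS[OF R(1)] H LS.hom_mult LS.hom_power LS_line_frame_Var0 Const_mult mult.assoc)
  have c1: "det ?R ^ 2 * c \<noteq> 0" using R c by simp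
  interpret F1: ternary_hess_power f1 n N "det ?R ^ 2 * c" by unfold_locales fact+
  have tip1: "Poly_Mapping.single 1 m \<notin> supp g1"
  proof -
    have "ev (\<lambda>i. if i = 1 then 1 else 0) g1 = ev (\<lambda>i. if i = 1 then r else if i = 2 then s else 0) g"
      unfolding g1_def ev_LS[OF m(2)]
      by (rule ev_cong[OF m(2)]) (auto simp: sum_lessThan_3 line_frame_def numeral_3_eq_3 less_Suc_eq numeral_2_eq_2 One_nat_def)
    then have "lk g1 (Poly_Mapping.single 1 m) = 0" using ev_unit_point[OF g1, of 1] rs(2) by simp
    then show ?thesis by (simp add: in_keys_iff)
  qed
  have k1: "k \<le> lk p 0" if "p \<in> supp f1" for p
    using that unfolding fg1 by (elim supp_Var0_power_mult) (simp add: lookup_add)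
  have tip: "lk p 2 \<noteq> 0" if p: "p \<in> supp f1" "lk p 0 = k" for p
  proof
    assume z: "lk p 2 = 0"
    obtain q where q: "p = q + Poly_Mapping.single 0 k" "q \<in> supp g1" using p(1) unfolding fg1 by (rule supp_Var0_power_mult)
    have "lk q 0 = 0" "lk q 2 = 0" using p(2) z q(1) by (auto simp: lookup_add lookup_single)
    then have "lk q i = lk (Poly_Mapping.single 1 m) i" for i
      using ternary_exponents(1)[OF g1 q(2)] ternary_exponents(2)[OF g1 q(2), of i] by (cases "i = 0"; cases "i = 1"; cases "i = 2") (auto simp: lookup_single)
    then have "q = Poly_Mapping.single 1 m" by (rule poly_mapping_eqI)
    then show False using tip1 q by simp
  qed
  have exk: "\<exists>p\<in>supp f1. lk p 0 = k"
  proof (rule ccontr)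
    assume no: "\<not> (\<exists>p\<in>supp f1. lk p 0 = k)"
    have "1 \<le> lk q 0" if "q \<in> supp g1" for q
    proof (rule ccontr)
      assume "\<not> 1 \<le> lk q 0"
      then have z: "lk (q + Poly_Mapping.single 0 k) 0 = k" by (simp add: lookup_add)
      have "q + Poly_Mapping.single 0 k \<in> supp f1" using that unfolding fg1 in_keys_iff lookup_Var0_power_mult .
      then show False using no z by blast
    qed
    then obtain h where h: "g1 = Var 0 ^ 1 * h" using divide_Var0_power[OF g1, of 1] by auto
    obtain B where B: "B \<in> carrier_mat 3 3" "?R * B = 1\<^sub>m 3" using ex_inverse[OF R] by blast
    have "lin_subst 3 B (Var 0) = Var 0" using LS_inverse[OF R(1) B sym_tensor_Var[of 0 3]] by (simp add: LS_line_frame_Var0)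
    then have "g = Var 0 * lin_subst 3 B h"
      using LS_inverse[OF R(1) B m(2)] h by (simp add: g1_def[symmetric] LS.hom_mult)
    then have "lk q 0 \<noteq> 0" if "q \<in> supp g" for q using that by (auto simp: in_keys_iff lookup_Var_mult split: if_splits)
    moreover obtain q where q: "K = q + Poly_Mapping.single 0 k" "q \<in> supp g" using K(1) unfolding g(1) by (rule supp_Var0_power_mult)
    moreover have "lk q 0 = 0" using arg_cong[OF q(1), of "\<lambda>m. lk m 0"] by (simp add: k_def lookup_add)
    ultimately show False by blast
  qed
  have neA: "{p \<in> supp f1. lk p 0 = k} \<noteq> {}" using exk by auto
  obtain A where A: "A \<in> {p \<in> supp f1. lk p 0 = k}" "\<And>y. y \<in> {p \<in> supp f1. lk p 0 = k} \<Longrightarrow> lk A 2 \<le> lk y 2"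
    using argmin_ex[OF _ neA, of "\<lambda>m. lk m 2"] by auto
  have As: "A \<in> supp f1" "lk A 0 = k" "1 \<le> lk A 2" using A tip[of A] by auto
  have A1: "lk A 1 = 0"
  proof (rule ccontr)
    assume "lk A 1 \<noteq> 0"
    then have A1': "1 \<le> lk A 1" by simp
    show False
    proof (cases "k = 0")
      case False
      show False
      proof (rule F1.no_interior_vertex[OF As(1) _ A1' As(3), of "-1" 0 0 0 0 "-1"])
        fix p assume p: "p \<in> supp f1"
        show "wt (-1) 0 0 p \<le> wt (-1) 0 0 A" using k1[OF p] As by (simp add: wt_def)
        assume "wt (-1) 0 0 p = wt (-1) 0 0 A"
        then have p0: "lk p 0 = k" using As by (simp add: wt_def)
        then show "wt 0 0 (-1) p \<le> wt 0 0 (-1) A" using A(2)[of p] p by (simp add: wt_def)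
        assume "wt 0 0 (-1) p = wt 0 0 (-1) A"
        then show "p = A" using ternary_exponents_eqI[OF f1 p As(1)] p0 As(2) by (simp add: wt_def)
      qed (use False As in simp)
    next
      case True
      define b where "b = lk A 2"
      define P where "P = Poly_Mapping.single (1::nat) (lk A 1) + Poly_Mapping.single 2 (b - 1)"
      have P: "lk P i = 0" if "i \<noteq> 0" "i \<noteq> 1" "i \<noteq> 2" for i
        using that by (auto simp: P_def lookup_add lookup_single when_def)
      have P': "lk P 0 = 0" "lk P 1 = lk A 1" "lk P 2 = b - 1"
        by (auto simp: P_def lookup_add lookup_single when_def)
      have "lk (P + ex 2) i = lk A i" for i
        using P[of i] P' ternary_exponents(2)[OF f1 As(1), of i] As True
        by (cases "i = 0"; cases "i = 1"; cases "i = 2") (auto simp: lookup_add lookup_single b_def)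
      then have PA: "P + ex 2 = A" by (rule poly_mapping_eqI)
      define t where "t = (\<lambda>i::nat. if i = 2 then - lk f1 (P + ex 0) / (of_nat b * lk f1 A) else 0)"
      let ?f2 = "lin_subst 3 (shear 3 t) f1"
      have fA: "lk f1 A \<noteq> 0" using As by (simp add: in_keys_iff)
      have r: "{1..<3::nat} = {1, 2}" by auto
      have "lk ?f2 (P + ex 0) = lk f1 (P + ex 0) + t 2 * (of_nat b * lk f1 A)"
        using lookup_shear_1[OF f1 P'(1), of t] As(3) by (simp add: r PA P' t_def b_def)
      also have "\<dots> = 0" using fA As(3) by (simp add: t_def b_def)
      finally have kill: "lk ?f2 (P + ex 0) = 0" .
      have f2: "sym_tensor 3 n ?f2" by (rule sym_tensor_LS[OF f1])
      have H2: "Hess 3 ?f2 = Const (det ?R ^ 2 * c) * Var 0 ^ N" using Hess_shear[OF _ H1] by simp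
      interpret F2: ternary_hess_power ?f2 n N "det ?R ^ 2 * c" using f2 n H2 c1 by unfold_locales
      have same: "p \<in> supp ?f2 \<longleftrightarrow> p \<in> supp f1" if "lk p 0 = 0" for p
        using lookup_shear_0[OF f1 that, of t] by (simp add: in_keys_iff)
      show False
      proof (rule F2.no_mixed_point_at_infinity[of A])
        show "A \<in> supp ?f2" using same As True by simp
        show "lk A 0 = 0" "1 \<le> lk A 1" "1 \<le> lk A 2" using As True A1' by auto
        show "lk A 2 \<le> lk p 2" if "p \<in> supp ?f2" "lk p 0 = 0" for p
          using A(2)[of p] same[OF that(2)] that True by simp
        show "lk p 2 \<noteq> lk A 2 - 1" if p: "p \<in> supp ?f2" "lk p 0 = 1" for p
        proof
          assume p2: "lk p 2 = lk A 2 - 1"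
          have "lk A 1 + lk A 2 = n" using ternary_exponents(1)[OF f1 As(1)] As(2) True by simp
          then have "lk p 1 = lk A 1" using ternary_exponents(1)[OF f2 p(1)] p(2) p2 As(3) by simp
          then have "lk p i = lk (P + ex 0) i" for i
            using P[of i] P' ternary_exponents(2)[OF f2 p(1), of i] p(2) p2
            by (cases "i = 0"; cases "i = 1"; cases "i = 2") (auto simp: lookup_add lookup_single lookup_one b_def)
          then have "p = P + ex 0" by (rule poly_mapping_eqI)
          then show False using kill p(1) by (simp add: in_keys_iff)
        qed
      qed
    qed
  qed
  have A2: "lk A 2 = m" using ternary_exponents(1)[OF f1 As(1)] A1 As(2) by (simp add: m_def)
  have "lk p 1 + lk p 2 < lk A 2" if p: "p \<in> supp f1" "p \<noteq> A" for p
  proof -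
    have s: "lk p 0 + lk p 1 + lk p 2 = n" using ternary_exponents(1)[OF f1 p(1)] .
    have "lk p 0 \<noteq> k"
    proof
      assume p0: "lk p 0 = k"
      then have "lk A 2 \<le> lk p 2" using A(2)[of p] p by simp
      then have "lk p 2 = lk A 2" using A2 s p0 kn by (simp add: m_def)
      then show False using ternary_exponents_eqI[OF f1 p(1) As(1)] p0 As(2) p(2) by simp
    qed
    then show ?thesis using k1[OF p(1)] s A2 kn by (simp add: m_def)
  qed
  then have "2 * lk p 1 + lk p 2 \<le> 2" if "p \<in> supp f1" for p
    using F1.support_from_tip[OF As(1,3) _ A1 that] by blast
  then show ?thesis using that[OF R] by (simp add: f1_def)
qed

lemma ternary_power_imp_GL_equiv:
  assumes f: "sym_tensor 3 n f" and n: "3 \<le> n" and H: "power_of_linear_form 3 (3 * (n - 2)) (Hess 3 f)"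
  shows "GL_equiv 3 f (nf 3 n)"
proof -
  obtain B c where B: "B \<in> carrier_mat 3 3" "det B \<noteq> 0" "c \<noteq> 0"
    "Hess 3 (lin_subst 3 B f) = Const c * Var 0 ^ (3 * (n - 2))"
    using hess_power_normalize[OF H] by metis
  let ?g = "lin_subst 3 B f"
  have g: "sym_tensor 3 n ?g" using sym_tensor_LS[OF f] .
  obtain C where C: "C \<in> carrier_mat 3 3" "det C \<noteq> 0"
    "\<And>m. m \<in> supp (lin_subst 3 C ?g) \<Longrightarrow> 2 * lk m 1 + lk m 2 \<le> 2"
    using ternary_support[OF g n B(4,3)] by blast
  let ?h = "lin_subst 3 C ?g"
  have h: "sym_tensor 3 n ?h" using sym_tensor_LS[OF g] .
  obtain R where R: "R \<in> carrier_mat 3 3" "?h = lin_subst 3 R (nf 3 n)"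
    using sym_tensor_low_degree_3[OF h _ C(3)] n by auto
  have "Hess 3 ?g \<noteq> 0" using B by simp
  then have "Hess 3 ?h \<noteq> 0"
    using LS_eq_0_iff[OF C(1,2) sym_tensor_Hess[OF g]] C(2) by (simp add: Hess_LS[OF C(1)])
  then have "GL_equiv 3 ?h (nf 3 n)" using GL_equivI[OF R] by simp
  then have "GL_equiv 3 ?g (nf 3 n)" using GL_equiv_LS_cancel C(1,2) g by blast
  then show ?thesis using GL_equiv_LS_cancel B f by blast
qed

section \<open>Hessians of the normal forms\<close>

lemma sym_tensor_nf: assumes "d = 2 \<or> d = 3" "2 \<le> n" shows "sym_tensor d n (nf d n)"
proof -
  have V: "sym_tensor d k (Var i ^ k)" if "i < d" for d i k
    using sym_tensor_power[OF sym_tensor_Var[OF that], of k] by simp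
  have 1: "sym_tensor 2 (n - 1 + 1) (Var 0 ^ (n - 1) * Var 1)" if "d = 2"
    using that by (intro sym_tensor_mult sym_tensor_Var V) auto
  have 2: "sym_tensor 3 (n - 1 + 1) (Var 0 ^ (n - 1) * Var 2)" "sym_tensor 3 (n - 2 + 2) (Var 0 ^ (n - 2) * Var 1 ^ 2)" if "d = 3"
    using that by (intro sym_tensor_mult sym_tensor_Var V; simp)+
  have e: "n - 1 + 1 = n" "n - 2 + 2 = n" using assms(2) by auto
  show ?thesis using assms(1) 1 2 unfolding e by (auto simp: nf_def intro!: sym_tensor_add)
qed

text \<open>
  The scalar in the Hessian of the normal form.\<close>
definition nf_hess_coeff :: "nat \<Rightarrow> nat \<Rightarrow> complex" where
  "nf_hess_coeff d n = (if d = 2 then - (of_nat (n - 1) ^ 2) else - 2 * of_nat (n - 1) ^ 2)"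

lemma nf_hess_coeff_neq_0: "2 \<le> n \<Longrightarrow> nf_hess_coeff d n \<noteq> 0" by (simp add: nf_hess_coeff_def)

lemma partial_Var_power: "partial i (Var j ^ m) = (if i = j then of_nat m * Var j ^ (m - 1) else 0)"
  unfolding partial_power by (simp add: partial_Var)

lemma Hess_nf: assumes "d = 2 \<or> d = 3" "2 \<le> n"
  shows "Hess d (nf d n) = Const (nf_hess_coeff d n) * Var 0 ^ (d * (n - 2))"
proof -
  obtain k where k: "n = k + 2" using assms(2) by (metis add.commute le_Suc_ex)
  have n1: "n - 1 = Suc k" "n - 2 = k" by (auto simp: k)
  show ?thesis using assms(1)
  proof
    assume d: "d = 2"
    have "partial 1 (partial 1 (nf 2 n)) = 0" "partial 0 (partial 1 (nf 2 n)) = of_nat (n - 1) * Var 0 ^ (n - 1 - 1)"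
      by (simp_all add: nf_def partial_mult partial_Var_power partial_Var)
    then have "partial 1 (partial 1 (nf 2 n)) = 0" "partial 0 (partial 1 (nf 2 n)) = of_nat (Suc k) * Var 0 ^ k"
      by (simp_all add: n1 del: of_nat_Suc)
    then show ?thesis
      by (simp add: d Hess_2 nf_hess_coeff_def n1 power2_eq_square Const.hom_mult Const.hom_uminus mult_2 power_add mult.assoc mult.left_commute
          del: of_nat_Suc flip: Const.hom_of_nat)
  next
    assume d: "d = 3"
    let ?f = "nf 3 n"
    have "partial 1 (partial 1 ?f) = 2 * Var 0 ^ (n - 2)" "partial 0 (partial 2 ?f) = of_nat (n - 1) * Var 0 ^ (n - 1 - 1)"
      "partial 1 (partial 2 ?f) = 0" "partial 2 (partial 2 ?f) = 0"
      by (simp_all add: nf_def partial_add partial_mult partial_Var_power partial_Var)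
    then have "partial 1 (partial 1 ?f) = 2 * Var 0 ^ k" "partial 0 (partial 2 ?f) = of_nat (Suc k) * Var 0 ^ k"
      "partial 1 (partial 2 ?f) = 0" "partial 2 (partial 2 ?f) = 0"
      by (simp_all add: n1 del: of_nat_Suc)
    then have "Hess 3 ?f = - 2 * (of_nat (Suc k) * of_nat (Suc k)) * (Var 0 ^ k * Var 0 ^ k * Var 0 ^ k)"
      unfolding Hess_3 by (simp add: mult.assoc mult.left_commute del: of_nat_Suc)
    also have "Var 0 ^ k * Var 0 ^ k * Var 0 ^ k = Var 0 ^ (3 * k)"
    proof -
      have "3 * k = k + k + k" by simp
      then show ?thesis by (simp only: power_add)
    qed
    also have "- 2 * (of_nat (Suc k) * of_nat (Suc k)) = Const (nf_hess_coeff 3 n)"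
      by (simp add: nf_hess_coeff_def n1 power2_eq_square Const.hom_mult Const.hom_uminus Const.hom_numeral del: of_nat_Suc flip: Const.hom_of_nat)
    finally show ?thesis by (simp add: d n1)
  qed
qed

lemma GL_equiv_nf_hess_power:
  assumes d: "d = 2 \<or> d = 3" "2 \<le> n" and A: "A \<in> carrier_mat d d"
  shows "Hess d (lin_subst d A (nf d n)) = Const (det A ^ 2 * nf_hess_coeff d n) * lform d (\<lambda>j. A $$ (0, j)) ^ (d * (n - 2))"
  using d(1) by (auto simp: Hess_LS[OF A] Hess_nf[OF d] LS.hom_mult LS.hom_power LS_Var Const_mult mult.assoc)

lemma row_neq_0: assumes A: "A \<in> carrier_mat d d" "det A \<noteq> (0::complex)" and i: "i < d"
  shows "lform d (\<lambda>j. A $$ (i, j)) \<noteq> 0"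
  using LS_eq_0_iff[OF A sym_tensor_Var[OF i]] i by (simp add: LS_Var)

lemma GL_equiv_nf_imp_power:
  assumes d: "d = 2 \<or> d = 3" "2 \<le> n" and f: "GL_equiv d f (nf d n)"
  shows "power_of_linear_form d (d * (n - 2)) (Hess d f)"
proof -
  obtain A where A: "A \<in> carrier_mat d d" "det A \<noteq> 0" "f = lin_subst d A (nf d n)"
    using f GL_equiv_iff by blast
  show ?thesis unfolding power_of_linear_form_iff A(3) GL_equiv_nf_hess_power[OF d A(1)]
    using A(2) nf_hess_coeff_neq_0[OF d(2)] row_neq_0[OF A(1,2), of 0] d(1)
    by (intro exI[of _ "lform d (\<lambda>j. A $$ (0, j))"] exI[of _ "det A ^ 2 * nf_hess_coeff d n"]) auto
qed

section \<open>Quadratic normal forms\<close>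

text \<open>
  The quadratic formula: a binary quadratic form over \<open>\<complex>\<close> is a product of linear forms.\<close>
lemma binary_quadratic_splits:
  obtains p q r s :: complex where "a = p * r" "b = p * s + q * r" "c = q * s"
proof (cases "a = 0")
  case True
  then show ?thesis by (intro that[where p = 0 and q = 1 and r = b and s = c]) auto
next
  case False
  obtain w where w: "w ^ 2 = b ^ 2 - 4 * a * c" using complex_root_exists[of 2] by auto
  have "(b + w) / 2 * ((b - w) / (2 * a)) = (b ^ 2 - w ^ 2) / (4 * a)"
    using False by (simp add: field_simps power2_eq_square)
  then have "c = (b + w) / 2 * ((b - w) / (2 * a))" using False by (simp add: w)
  moreover have "b = a * ((b - w) / (2 * a)) + (b + w) / 2 * 1" using False by (simp add: field_simps)
  ultimately show ?thesis by (intro that[where p = a and r = 1 and q = "(b + w) / 2" and s = "(b - w) / (2 * a)"]) auto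
qed

lemma binary_quadratic_GL_equiv:
  assumes f: "sym_tensor 2 2 f" and H: "Hess 2 f \<noteq> 0"
  shows "GL_equiv 2 f (nf 2 2)"
proof -
  obtain A where A: "A \<in> carrier_mat 2 2" "A\<^sup>T = A"
    "f = (\<Sum>i<2. \<Sum>j<2. Const (A $$ (i, j)) * Var i * Var j)" using quadratic_form[OF f] .
  obtain p q r s where s: "A $$ (0,0) = p * r" "A $$ (0,1) + A $$ (1,0) = p * s + q * r" "A $$ (1,1) = q * s"
    using binary_quadratic_splits .
  define R where "R = mat 2 2 (\<lambda>(i, j). if i = 0 then (if j = 0 then p else q) else (if j = 0 then r else s))"
  have "f = lin_subst 2 R (nf 2 2)"
  proof (rule ev_inj)
    fix x
    have "ev x f = A $$ (0,0) * x 0 * x 0 + (A $$ (0,1) + A $$ (1,0)) * (x 0 * x 1) + A $$ (1,1) * x 1 * x 1"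
      unfolding A(3) by (simp add: sum_lessThan_2 ev.hom_add ev.hom_mult algebra_simps)
    also have "\<dots> = (p * x 0 + q * x 1) * (r * x 0 + s * x 1)" unfolding s by (simp add: algebra_simps)
    also have "\<dots> = ev x (lin_subst 2 R (nf 2 2))"
      by (simp add: nf_def LS.hom_mult LS.hom_power LS_Var lform_2 R_def ev.hom_add ev.hom_mult ev.hom_power)
    finally show "ev x f = ev x (lin_subst 2 R (nf 2 2))" .
  qed
  then show ?thesis using GL_equivI[of R 2 f "nf 2 2"] H by (simp add: R_def)
qed

text \<open>
  For \<open>n = 2\<close> the normal form is a nonsingular conic \<open>x_0 x_2 + x_1\<^sup>2\<close>.\<close>
lemma ternary_quadratic_GL_equiv:
  assumes f: "sym_tensor 3 2 f" and H: "Hess 3 f \<noteq> 0"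
  shows "GL_equiv 3 f (nf 3 2)"
proof -
  have "f \<noteq> 0" using H by (auto simp: Hess_3)
  then obtain x0 where x0: "ev x0 f \<noteq> 0" using ev_inj0 by blast
  obtain k where k: "k < 3" "x0 k \<noteq> 0"
  proof (rule ccontr)
    assume "\<not> thesis"
    then have "ev x0 f = ev (\<lambda>i. 0 * x0 i) f" using that by (intro ev_cong[OF f]) force
    then show False using x0 ev_scale[OF f, of 0 x0] by simp
  qed
  obtain M where M: "M \<in> carrier_mat 3 3" "det M \<noteq> 0" "\<And>j. j < 3 \<Longrightarrow> M $$ (0, j) = x0 j"
    using ex_invertible_first_row[of k 3 x0] k by blast
  let ?g = "lin_subst 3 (M\<^sup>T) f"
  have g: "sym_tensor 3 2 ?g" by (rule sym_tensor_LS[OF f])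
  have MT: "M\<^sup>T \<in> carrier_mat 3 3" "det (M\<^sup>T) \<noteq> 0" using M det_transpose[OF M(1)] by auto
  have "ev (\<lambda>i. if i = 0 then 1 else 0) ?g = ev x0 f"
    unfolding ev_LS[OF f] by (rule ev_cong[OF f]) (use M in \<open>simp add: if_distrib sum.delta cong: if_cong\<close>)
  then have g0: "ev (\<lambda>i. if i = 0 then 1 else 0) ?g \<noteq> 0" using x0 by simp
  obtain A where A: "A \<in> carrier_mat 3 3" "A\<^sup>T = A"
    "?g = (\<Sum>i<3. \<Sum>j<3. Const (A $$ (i, j)) * Var i * Var j)" using quadratic_form[OF g] .
  have "A $$ (j, i) = A $$ (i, j)" if "i < 3" "j < 3" for i j
    using arg_cong[OF A(2), of "\<lambda>M. M $$ (i, j)"] A(1) that by simp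
  then have sy: "A $$ (1, 0) = A $$ (0, 1)" "A $$ (2, 0) = A $$ (0, 2)" "A $$ (2, 1) = A $$ (1, 2)"
    by simp_all
  have ex: "ev x ?g = A $$ (0,0) * x 0 ^ 2 + 2 * A $$ (0,1) * x 0 * x 1 + 2 * A $$ (0,2) * x 0 * x 2
      + A $$ (1,1) * x 1 ^ 2 + 2 * A $$ (1,2) * x 1 * x 2 + A $$ (2,2) * x 2 ^ 2" for x
    unfolding A(3) by (simp add: sum_lessThan_3 ev.hom_add ev.hom_mult ev.hom_numeral sy algebra_simps power2_eq_square)
  have A0: "A $$ (0,0) \<noteq> 0" using g0 unfolding ex by simp
  obtain z where z: "z ^ 2 = A $$ (0,0)" using complex_root_exists[of 2] by auto
  then have z0: "z \<noteq> 0" using A0 by auto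
  define \<alpha> where "\<alpha> = A $$ (0,1) / z"
  define \<beta> where "\<beta> = A $$ (0,2) / z"
  have ab: "A $$ (0,1) = z * \<alpha>" "A $$ (0,2) = z * \<beta>" using z0 by (simp_all add: \<alpha>_def \<beta>_def)
  obtain p q r s where s: "A $$ (1,1) - \<alpha> ^ 2 = p * r" "2 * A $$ (1,2) - 2 * \<alpha> * \<beta> = p * s + q * r" "A $$ (2,2) - \<beta> ^ 2 = q * s"
    using binary_quadratic_splits .
  define R where "R = mat 3 3 (\<lambda>(i, j). if i = 0 then (if j = 0 then 0 else if j = 1 then p else q)
    else if i = 1 then (if j = 0 then z else if j = 1 then \<alpha> else \<beta>)
    else (if j = 0 then 0 else if j = 1 then r else s))"
  have "?g = lin_subst 3 R (nf 3 2)"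
  proof (rule ev_inj)
    fix x
    have "ev x ?g = z ^ 2 * x 0 ^ 2 + 2 * (z * \<alpha>) * x 0 * x 1 + 2 * (z * \<beta>) * x 0 * x 2
      + (\<alpha> ^ 2 + p * r) * x 1 ^ 2 + (2 * \<alpha> * \<beta> + (p * s + q * r)) * x 1 * x 2 + (\<beta> ^ 2 + q * s) * x 2 ^ 2"
      unfolding ex ab(1)[symmetric] ab(2)[symmetric] z s(1,2,3)[symmetric] by simp
    also have "\<dots> = (p * x 1 + q * x 2) * (r * x 1 + s * x 2) + (z * x 0 + \<alpha> * x 1 + \<beta> * x 2) ^ 2"
      by (simp add: algebra_simps power2_eq_square)
    also have "\<dots> = ev x (lin_subst 3 R (nf 3 2))"
      by (simp add: nf_def LS.hom_add LS.hom_mult LS.hom_power LS_Var lform_3 R_def ev.hom_add ev.hom_mult ev.hom_power)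
    finally show "ev x ?g = ev x (lin_subst 3 R (nf 3 2))" .
  qed
  moreover have "Hess 3 ?g \<noteq> 0"
    using LS_eq_0_iff[OF MT sym_tensor_Hess[OF f]] H MT by (simp add: Hess_LS[OF MT(1)])
  ultimately have "GL_equiv 3 ?g (nf 3 2)" using GL_equivI[of R 3 ?g "nf 3 2"] by (simp add: R_def)
  then show ?thesis using GL_equiv_LS_cancel MT f by blast
qed

lemma GL_equiv_nf_iff_power:
  assumes d: "d = 2 \<or> d = 3" and n: "2 \<le> n" and f: "sym_tensor d n f"
  shows "GL_equiv d f (nf d n) \<longleftrightarrow> power_of_linear_form d (d * (n - 2)) (Hess d f)"
proof
  assume p: "power_of_linear_form d (d * (n - 2)) (Hess d f)"
  then have H0: "Hess d f \<noteq> 0" unfolding power_of_linear_form_iff by auto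
  show "GL_equiv d f (nf d n)"
  proof (cases "n = 2")
    case True
    then show ?thesis using binary_quadratic_GL_equiv ternary_quadratic_GL_equiv d f H0 by auto
  next
    case False
    then show ?thesis using binary_power_imp_GL_equiv[of n f] ternary_power_imp_GL_equiv[of n f] d n f p by auto
  qed
qed (rule GL_equiv_nf_imp_power[OF d n])

section \<open>Normal forms are persistent\<close>

lemma dir_deriv_2: "dir_deriv 2 u f = Const (u $ 0) * partial 0 f + Const (u $ 1) * partial 1 f"
  by (simp add: dir_deriv_def sum_lessThan_2)

lemma dir_deriv_3: "dir_deriv 3 u f = Const (u $ 0) * partial 0 f + Const (u $ 1) * partial 1 f + Const (u $ 2) * partial 2 f"
  by (simp add: dir_deriv_def sum_lessThan_3)

text \<open>
  Differentiating lowers the exponents by one and multiplies the terms by \<open>u_0\<close> up to positive integers; the terms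
  produced by the other components of \<open>u\<close> are absorbed in the last variable.\<close>
lemma dir_deriv_nf:
  assumes d: "d = 2 \<or> d = 3" and n: "2 \<le> n" and u: "u $ 0 \<noteq> 0"
  shows "GL_equiv d (dir_deriv d u (nf d (Suc n))) (nf d n)"
proof -
  obtain k where k: "n = k + 2" using n by (metis add.commute le_Suc_ex)
  have n1: "Suc n - 1 = Suc (Suc k)" "Suc n - 2 = Suc k" "n - 1 = Suc k" "n - 2 = k" by (auto simp: k)
  show ?thesis using d
  proof
    assume d: "d = 2"
    define R where "R = mat 2 2 (\<lambda>(i, j). if i = 0 then (if j = 0 then 1 else 0) else (if j = 0 then u $ 1 else of_nat n * u $ 0))"
    have "dir_deriv 2 u (nf 2 (Suc n)) = Var 0 ^ Suc k * (Const (u $ 1) * Var 0 + Const (of_nat n * u $ 0) * Var 1)"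
      unfolding dir_deriv_2 nf_def
      by (simp add: partial_mult partial_Var_power partial_Var) (simp add: k Const_mult Const_add Const.hom_numeral Const.hom_of_nat algebra_simps)
    also have "\<dots> = lin_subst 2 R (nf 2 n)"
      by (simp add: nf_def n1 LS.hom_mult LS.hom_power LS_Var lform_2 R_def)
    finally have "dir_deriv 2 u (nf 2 (Suc n)) = lin_subst 2 R (nf 2 n)" .
    moreover have "det R \<noteq> 0" using u n unfolding R_def det_mat_2 by simp
    moreover have "R \<in> carrier_mat 2 2" by (simp add: R_def)
    ultimately show ?thesis unfolding d GL_equiv_iff by blast
  next
    assume d: "d = 3"
    obtain z where z: "z ^ 2 = of_nat (Suc k) * u $ 0" using complex_root_exists[of 2] by auto
    define R where "R = mat 3 3 (\<lambda>(i, j). if i = 0 then (if j = 0 then 1 else 0) else if i = 1 then (if j = 1 then z else 0)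
      else (if j = 0 then u $ 2 else if j = 1 then 2 * u $ 1 else of_nat n * u $ 0))"
    have "dir_deriv 3 u (nf 3 (Suc n)) = Var 0 ^ Suc k * (Const (u $ 2) * Var 0 + Const (2 * u $ 1) * Var 1 + Const (of_nat n * u $ 0) * Var 2)
        + Var 0 ^ k * (Const (of_nat (Suc k) * u $ 0) * Var 1 ^ 2)"
      unfolding dir_deriv_3 nf_def
      by (simp add: partial_add partial_mult partial_Var_power partial_Var)
         (simp add: k Const_mult Const_add Const.hom_numeral Const.hom_of_nat algebra_simps power2_eq_square)
    also have "\<dots> = lin_subst 3 R (nf 3 n)"
      unfolding z[symmetric]
      by (simp add: nf_def n1 LS.hom_add LS.hom_mult LS.hom_power LS_Var lform_3 R_def power_mult_distrib Const.hom_power)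
    finally have "dir_deriv 3 u (nf 3 (Suc n)) = lin_subst 3 R (nf 3 n)" .
    moreover have "z ^ 2 \<noteq> 0" unfolding z using u by (simp del: of_nat_Suc)
    then have "z \<noteq> 0" by auto
    then have "det R \<noteq> 0" using u n unfolding R_def det_mat_3 by simp
    moreover have "R \<in> carrier_mat 3 3" by (simp add: R_def)
    ultimately show ?thesis unfolding d GL_equiv_iff by blast
  qed
qed

text \<open>
  The exceptional hyperplane consists of the directions along which the linear form that plays the role of \<open>x_0\<close> has derivative 0.\<close>
lemma GL_equiv_nf_persistent:
  assumes d: "d = 2 \<or> d = 3"
  shows "2 \<le> n \<Longrightarrow> GL_equiv d f (nf d n) \<Longrightarrow> persistent d n f"
proof (induction n arbitrary: f rule: dec_induct)
  case base
  obtain A where A: "A \<in> carrier_mat d d" "det A \<noteq> 0" "f = lin_subst d A (nf d 2)"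
    using base GL_equiv_iff by blast
  have f: "sym_tensor d 2 f" unfolding A(3) by (intro sym_tensor_LS sym_tensor_nf d) simp
  have "Hess d f = Const (det A ^ 2 * nf_hess_coeff d 2)"
    unfolding A(3) using GL_equiv_nf_hess_power[OF d _ A(1), of 2] by simp
  moreover have "det A ^ 2 * nf_hess_coeff d 2 \<noteq> 0" using A nf_hess_coeff_neq_0[of 2 d] by simp
  ultimately show ?case unfolding persistent_2_iff[OF f] by blast
next
  case (step n)
  obtain A where A: "A \<in> carrier_mat d d" "det A \<noteq> 0" "f = lin_subst d A (nf d (Suc n))"
    using step.prems GL_equiv_iff by blast
  have f: "sym_tensor d (Suc n) f" unfolding A(3) using step by (intro sym_tensor_LS sym_tensor_nf d) simp
  have "power_of_linear_form d (d * (Suc n - 2)) (Hess d f)"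
    using step by (intro GL_equiv_nf_imp_power d) auto
  then have "Hess d f \<noteq> 0" unfolding power_of_linear_form_iff by auto
  then have conc: "concise d f" by (rule Hess_concise)
  have d0: "0 < d" using d by auto
  let ?a = "row A 0"
  have a: "?a \<in> carrier_vec d" using A by auto
  have a0: "?a \<noteq> 0\<^sub>v d"
  proof
    assume z: "?a = 0\<^sub>v d"
    have "A $$ (0, j) = 0" if "j < d" for j using arg_cong[OF z, of "\<lambda>v. v $ j"] A(1) d0 that by simp
    then show False using row_neq_0[OF A(1,2) d0] by (simp add: lform_eq_0_iff)
  qed
  have "persistent d n (dir_deriv d u f)" if u: "u \<in> carrier_vec d - ann d ?a" for u
  proof (rule step.IH)
    have uc: "u \<in> carrier_vec d" using u by auto
    have "(A *\<^sub>v u) $ 0 \<noteq> 0" using u A(1) d0 by (auto simp: ann_def)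
    then have "GL_equiv d (dir_deriv d (A *\<^sub>v u) (nf d (Suc n))) (nf d n)"
      using step by (intro dir_deriv_nf d) auto
    then show "GL_equiv d (dir_deriv d u f) (nf d n)"
      unfolding A(3) dir_deriv_LS[OF A(1) uc] by (rule GL_equiv_LS[OF _ A(1,2)])
  qed
  then show ?case unfolding persistent_Suc_iff[OF step.hyps(1)]
    using f conc hyperplane_ann[OF a a0] by blast
qed

section \<open>Pencils of normal forms\<close>

lemma Hess_pencil:
  obtains K where "\<And>t. Hess d (F + Const t * G) = (\<Sum>k\<le>d. Const (t ^ k) * K k)"
proof -
  let ?M = "mat d d (\<lambda>(i, j). [:partial i (partial j F), partial i (partial j G):])"
  let ?P = "det ?M"
  have "degree ?P \<le> 1 * d" by (rule degree_det_le) auto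
  then have deg: "degree ?P \<le> d" by simp
  have "Hess d (F + Const t * G) = (\<Sum>k\<le>d. Const (t ^ k) * coeff ?P k)" for t
  proof -
    have "poly ?P (Const t) = det (hess_mat d (F + Const t * G))"
      by (rule poly_det_cong[of _ d]) (auto simp: hess_mat_def partial_add partial_Const_mult)
    moreover have "poly ?P (Const t) = (\<Sum>k\<le>d. coeff ?P k * Const t ^ k)"
      unfolding poly_altdef by (rule sum.mono_neutral_left) (use deg in \<open>auto simp: coeff_eq_0\<close>)
    ultimately show ?thesis by (simp add: Hess_det Const.hom_power mult.commute)
  qed
  then show ?thesis using that by blast
qed

text \<open>
  Coefficients with index above \<open>d\<close> are cut off.\<close>
definition poly_upto :: "nat \<Rightarrow> (nat \<Rightarrow> complex) \<Rightarrow> complex poly" where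
  "poly_upto d a = (\<Sum>k\<le>d. monom (a k) k)"

lemma poly_poly_upto: "poly (poly_upto d a) t = (\<Sum>k\<le>d. t ^ k * a k)"
  by (simp add: poly_upto_def poly_sum poly_monom mult.commute)

lemma coeff_poly_upto: "coeff (poly_upto d a) k = (if k \<le> d then a k else 0)"
  by (simp add: poly_upto_def coeff_sum sum.delta)

lemma degree_poly_upto: "degree (poly_upto d a) \<le> d"
  by (rule degree_le) (simp add: coeff_poly_upto)

text \<open>
  A polynomial in \<open>t\<close> that vanishes identically has zero coefficients.\<close>
lemma sym_tensor_pencil_coeff:
  assumes "\<And>t. sym_tensor e N (\<Sum>k\<le>d. Const (t ^ k) * K k)" and k: "k \<le> d"
  shows "sym_tensor e N (K k)"
  unfolding sym_tensor_def
proof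
  fix m assume m: "m \<in> supp (K k)"
  show "supp m \<subseteq> {..<e} \<and> (\<Sum>j<e. lk m j) = N"
  proof (rule ccontr)
    assume no: "\<not> (supp m \<subseteq> {..<e} \<and> (\<Sum>j<e. lk m j) = N)"
    have "lk (\<Sum>k\<le>d. Const (t ^ k) * K k) m = 0" for t
      using assms(1)[of t] no unfolding sym_tensor_def by (metis in_keys_iff)
    then have "poly (poly_upto d (\<lambda>k. lk (K k) m)) t = 0" for t
      by (simp add: poly_poly_upto lookup_sum lookup_Const_mult)
    then have "poly_upto d (\<lambda>k. lk (K k) m) = 0" by (intro poly_all_0_iff_0[THEN iffD1] allI)
    then have "lk (K k) m = 0" using coeff_poly_upto[of d "\<lambda>k. lk (K k) m" k] k by simp
    then show False using m by (simp add: in_keys_iff)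
  qed
qed

text \<open>
  The derivative along a direction given by a coordinate function.\<close>
definition deriv_along :: "nat \<Rightarrow> (nat \<Rightarrow> complex) \<Rightarrow> cpoly \<Rightarrow> cpoly" where
  "deriv_along d y g = (\<Sum>i<d. Const (y i) * partial i g)"

lemma deriv_along_sum: "deriv_along d y (\<Sum>k\<in>S. Const (c k) * g k) = (\<Sum>k\<in>S. Const (c k) * deriv_along d y (g k))"
  unfolding deriv_along_def partial_sum partial_Const_mult sum_distrib_left
  by (subst sum.swap) (simp add: mult.left_commute)

lemma deriv_along_power_lform: assumes "sym_tensor d 1 l"
  shows "ev z (deriv_along d y (Const c * l ^ N)) = of_nat N * c * ev z l ^ (N - 1) * ev y l"
proof -
  obtain a where a: "l = lform d a" using sym_tensor_1_lform[OF assms] .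
  have "ev z (deriv_along d y (Const c * l ^ N)) = (\<Sum>i<d. of_nat N * c * ev z l ^ (N - 1) * (y i * a i))"
    unfolding deriv_along_def
    by (simp add: ev.hom_sum ev.hom_mult partial_Const_mult partial_power ev.hom_power ev.hom_of_nat a partial_lform)
       (rule sum.cong, auto)
  also have "\<dots> = of_nat N * c * ev z l ^ (N - 1) * (\<Sum>i<d. y i * a i)" by (simp only: sum_distrib_left)
  also have "(\<Sum>i<d. y i * a i) = ev y l" unfolding a ev_lform by (rule sum.cong) auto
  finally show ?thesis .
qed

text \<open>
  Let \<open>K(t)\<close> and \<open>C(t)\<close> be the values of \<open>P t = c l^N\<close> at \<open>y\<close> and \<open>z\<close>, and \<open>B(t)\<close> the derivative along \<open>y\<close> at \<open>z\<close>, that is \<open>N c l(z)^{N-1} l(y)\<close>.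
  Although \<open>l\<close> need not depend polynomially on \<open>t\<close>, the polynomials satisfy \<open>B^N = N^N K C^{N-1}\<close>. Choosing \<open>z\<close> with \<open>C(t1) \<noteq> 0\<close>, the
  order of \<open>K\<close> at \<open>t1\<close> is a multiple of \<open>N\<close>.\<close>
lemma pencil_order:
  assumes K: "\<And>t. P t = (\<Sum>k\<le>d. Const (t ^ k) * K k)"
    and pow: "\<And>t. \<exists>l c. sym_tensor e 1 l \<and> l \<noteq> 0 \<and> c \<noteq> 0 \<and> P t = Const c * l ^ N"
    and N: "0 < N" and y: "ev y (P t1) = 0" and nz: "poly_upto d (\<lambda>k. ev y (K k)) \<noteq> 0"
  shows "N \<le> order t1 (poly_upto d (\<lambda>k. ev y (K k)))"
proof -
  let ?K = "poly_upto d (\<lambda>k. ev y (K k))"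
  obtain l1 c1 where l1: "sym_tensor e 1 l1" "l1 \<noteq> 0" "c1 \<noteq> 0" "P t1 = Const c1 * l1 ^ N" using pow by blast
  obtain z where z: "ev z l1 \<noteq> 0" using l1(2) ev_inj0 by blast
  let ?C = "poly_upto d (\<lambda>k. ev z (K k))"
  let ?B = "poly_upto d (\<lambda>k. ev z (deriv_along e y (K k)))"
  have pK: "poly ?K t = ev y (P t)" for t by (simp add: poly_poly_upto K ev.hom_sum ev.hom_mult)
  have pC: "poly ?C t = ev z (P t)" for t by (simp add: poly_poly_upto K ev.hom_sum ev.hom_mult)
  have pB: "poly ?B t = ev z (deriv_along e y (P t))" for t by (simp add: poly_poly_upto K deriv_along_sum ev.hom_sum ev.hom_mult)
  have C1: "poly ?C t1 \<noteq> 0" unfolding pC l1(4) using z l1(3) by (simp add: ev.hom_mult ev.hom_power)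
  then have C0: "?C \<noteq> 0" by auto
  have eq: "?B ^ N = smult (of_nat N ^ N) (?K * ?C ^ (N - 1))"
  proof (rule poly_eq_poly_eq_iff[THEN iffD1], rule ext)
    fix t
    obtain l c where l: "sym_tensor e 1 l" "P t = Const c * l ^ N" using pow by blast
    obtain M where M: "N = Suc M" using N by (cases N) auto
    have "poly (?B ^ N) t = (of_nat N * c * ev z l ^ (N - 1) * ev y l) ^ N"
      unfolding poly_power pB l(2) deriv_along_power_lform[OF l(1)] ..
    also have "\<dots> = of_nat N ^ N * ((c * ev y l ^ N) * (c * ev z l ^ N) ^ (N - 1))"
      by (simp add: M power_mult_distrib power_mult[symmetric] mult.commute mult.left_commute power_commutes)
    also have "\<dots> = poly (smult (of_nat N ^ N) (?K * ?C ^ (N - 1))) t"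
      by (simp add: pK pC poly_power l(2) ev.hom_mult ev.hom_power)
    finally show "poly (?B ^ N) t = poly (smult (of_nat N ^ N) (?K * ?C ^ (N - 1))) t" .
  qed
  have R0: "?K * ?C ^ (N - 1) \<noteq> 0" using nz C0 by simp
  have B0: "?B \<noteq> 0"
  proof
    assume "?B = 0"
    then have "smult (of_nat N ^ N) (?K * ?C ^ (N - 1)) = 0" unfolding eq[symmetric] using N by (simp add: zero_power)
    then show False using R0 N by simp
  qed
  have oC: "order t1 (?C ^ (N - 1)) = 0" using C1 by (intro order_0I) (simp add: poly_power)
  have "poly ?K t1 = 0" using y pK by simp
  then have oK: "1 \<le> order t1 ?K" using nz by (simp add: order_root Suc_le_eq One_nat_def)
  have "order t1 (?B ^ N) = order t1 ?K"
    unfolding eq using N oC R0 by (simp add: order_smult order_mult)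
  moreover have "order t1 (?B ^ N) = N * order t1 ?B"
  proof -
    have "order t1 (?B ^ k) = k * order t1 ?B" for k
      by (induction k) (use B0 in \<open>simp_all add: order_mult\<close>)
    then show ?thesis .
  qed
  ultimately show ?thesis using oK by (cases "order t1 ?B") auto
qed

text \<open>
  The linear form of the Hessian divides the form itself; zeros of the Hessian are therefore zeros of the form.\<close>
lemma GL_equiv_nf_witness:
  assumes d: "d = 2 \<or> d = 3" and n: "3 \<le> n" and f: "GL_equiv d f (nf d n)"
  obtains l c s where "sym_tensor d 1 l" "l \<noteq> 0" "c \<noteq> 0" "Hess d f = Const c * l ^ (d * (n - 2))" "f = l * s"
proof -
  obtain A where A: "A \<in> carrier_mat d d" "det A \<noteq> 0" "f = lin_subst d A (nf d n)"
    using f GL_equiv_iff by blast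
  have n2: "2 \<le> n" using n by simp
  let ?l = "lform d (\<lambda>j. A $$ (0, j))"
  obtain k where k: "n = k + 3" using n by (metis add.commute le_Suc_ex)
  have "\<exists>h. nf d n = Var 0 * h"
  proof -
    have "n - 1 = Suc (Suc k)" "n - 2 = Suc k" by (auto simp: k)
    then have "nf d n = Var 0 * (if d = 2 then Var 0 ^ Suc k * Var 1 else Var 0 ^ Suc k * Var 2 + Var 0 ^ k * Var 1 ^ 2)"
      by (simp add: nf_def algebra_simps)
    then show ?thesis by blast
  qed
  then obtain h where "nf d n = Var 0 * h" by blast
  then have 1: "f = ?l * lin_subst d A h" using d by (auto simp: A(3) LS.hom_mult LS_Var)
  have 2: "det A ^ 2 * nf_hess_coeff d n \<noteq> 0" using A nf_hess_coeff_neq_0[OF n2] by simp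
  have 3: "?l \<noteq> 0" using row_neq_0[OF A(1,2), of 0] d by auto
  have 4: "Hess d f = Const (det A ^ 2 * nf_hess_coeff d n) * ?l ^ (d * (n - 2))"
    unfolding A(3) by (rule GL_equiv_nf_hess_power[OF d n2 A(1)])
  show ?thesis by (rule that[OF sym_tensor_lform 3 2 4 1])
qed

text \<open>
  The value of the Hessian at \<open>y\<close> has degree at most \<open>d\<close> in \<open>t\<close>, and its roots have order at least \<open>d (n - 2)\<close>. If there is never a
  root, it does not depend on \<open>t\<close>. Otherwise \<open>n = 3\<close> and the value is \<open>\<kappa> (t - t1)^d\<close>, whose first two coefficients determine the root;
  substituting it into \<open>F(y) + t1 G(y) = 0\<close> gives the polynomial identity, with \<open>K\<close> the linear coefficient of the Hessian.\<close>
lemma pencil_alternative: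
  assumes d: "d = 2 \<or> d = 3" and n: "3 \<le> n"
    and P: "\<And>t. GL_equiv d (F + Const t * G) (nf d n)"
  shows "(\<forall>t. Hess d (F + Const t * G) = Hess d F) \<or>
     (n = 3 \<and> (\<exists>K. sym_tensor d d K \<and> K * F = of_nat d * (Hess d F * G)))"
proof -
  let ?P = "\<lambda>t. F + Const t * G"
  let ?N = "d * (n - 2)"
  obtain K where K: "\<And>t. Hess d (?P t) = (\<Sum>k\<le>d. Const (t ^ k) * K k)" using Hess_pencil by blast
  have N: "0 < ?N" "d \<le> ?N" using d n by auto
  have pow: "\<exists>l c. sym_tensor d 1 l \<and> l \<noteq> 0 \<and> c \<noteq> 0 \<and> Hess d (?P t) = Const c * l ^ ?N" for t
    using GL_equiv_nf_witness[OF d n P[of t]] by metis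
  have vanish: "ev y (?P t) = 0" if z: "ev y (Hess d (?P t)) = 0" for y t
  proof -
    obtain l c s where l: "c \<noteq> 0" "Hess d (?P t) = Const c * l ^ ?N" "?P t = l * s"
      using GL_equiv_nf_witness[OF d n P[of t]] by metis
    have "ev y l = 0" using z l(1) N unfolding l(2) by (simp add: ev.hom_mult ev.hom_power)
    then show ?thesis unfolding l(3) by (simp add: ev.hom_mult)
  qed
  have F0: "Hess d F \<noteq> 0" using pow[of 0] by auto
  have K0: "K 0 = Hess d F"
  proof -
    have "(\<Sum>k\<le>d. Const (0 ^ k) * K k) = (\<Sum>k\<le>d. if k = 0 then K 0 else 0)"
      by (rule sum.cong) (auto simp: power_0_left)
    then show ?thesis using K[of 0] by (simp add: sum.delta)
  qed
  let ?q = "\<lambda>y. poly_upto d (\<lambda>k. ev y (K k))"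
  have pq: "poly (?q y) t = ev y (Hess d (?P t))" for y t
    by (simp add: poly_poly_upto K ev.hom_sum ev.hom_mult)
  have q0: "poly (?q y) 0 = ev y (Hess d F)" for y using pq[of y 0] by simp
  have nonroot: "ev y (Hess d (?P t)) = ev y (Hess d F)" if "\<And>t. poly (?q y) t \<noteq> 0" for y t
  proof -
    have "constant (poly (?q y))" using that fundamental_theorem_of_algebra by blast
    then have "poly (?q y) t = poly (?q y) 0" by (simp add: constant_def)
    then show ?thesis by (simp add: pq q0)
  qed
  have root: "n = 3 \<and> t1 \<noteq> 0 \<and> coeff (?q y) 1 \<noteq> 0 \<and> coeff (?q y) 1 * (- t1) = of_nat d * coeff (?q y) 0"
    if y: "ev y (Hess d F) \<noteq> 0" and t1: "poly (?q y) t1 = 0" for y t1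
  proof -
    have nz: "?q y \<noteq> 0" using q0[of y] y by auto
    have ord: "?N \<le> order t1 (?q y)"
      by (rule pencil_order[OF K pow N(1) _ nz]) (use t1 pq in simp)
    also have "\<dots> \<le> degree (?q y)" by (rule order_degree[OF nz])
    also have "\<dots> \<le> d" by (rule degree_poly_upto)
    finally have "d * (n - 2) \<le> d * 1" by simp
    then have n3: "n = 3" using d n by auto
    then have Nd: "?N = d" by simp
    have t10: "t1 \<noteq> 0" using t1 q0[of y] y by auto
    have "[:- t1, 1:] ^ d dvd ?q y" using order_1[of t1 "?q y"] ord unfolding Nd by (meson power_le_dvd)
    then obtain r where r: "?q y = [:- t1, 1:] ^ d * r" by (elim dvdE)
    have r0: "r \<noteq> 0" using nz r by auto
    have "degree (?q y) = d + degree r" unfolding r using r0 by (simp add: degree_mult_eq degree_power_eq)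
    then have "degree r = 0" using degree_poly_upto[of d "\<lambda>k. ev y (K k)"] by simp
    then obtain \<kappa> where euler2_weight: "r = [:\<kappa>:]" by (meson degree_eq_zeroE)
    have k0: "\<kappa> \<noteq> 0" using r0 euler2_weight by simp
    have dd: "[:- t1, 1:] ^ 2 = [:t1 ^ 2, - 2 * t1, 1:]" "[:- t1, 1:] ^ 3 = [:- (t1 ^ 3), 3 * t1 ^ 2, - 3 * t1, 1:]"
      by (simp_all add: power2_eq_square power3_eq_cube algebra_simps)
    have "coeff (?q y) 1 \<noteq> 0 \<and> coeff (?q y) 1 * (- t1) = of_nat d * coeff (?q y) 0"
      unfolding r euler2_weight using d t10 k0 by (auto simp: dd One_nat_def power2_eq_square power3_eq_cube)
    then show ?thesis using n3 t10 by blast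
  qed
  show ?thesis
  proof (cases "\<forall>y t1. ev y (Hess d F) \<noteq> 0 \<longrightarrow> poly (?q y) t1 \<noteq> 0")
    case True
    have "Hess d (?P t) = Hess d F" for t
    proof -
      have "Hess d F * (Hess d (?P t) - Hess d F) = 0"
      proof (rule ev_inj0)
        fix y show "ev y (Hess d F * (Hess d (?P t) - Hess d F)) = 0"
          using nonroot[of y t] True by (cases "ev y (Hess d F) = 0") (auto simp: ev.hom_mult ev.hom_minus)
      qed
      then show ?thesis using F0 by simp
    qed
    then show ?thesis by blast
  next
    case False
    then obtain y0 t0 where y0: "ev y0 (Hess d F) \<noteq> 0" "poly (?q y0) t0 = 0" by blast
    have n3: "n = 3" using root[OF y0] by blast
    have d1: "1 \<le> d" using d by auto
    have c1: "coeff (?q y) 1 = ev y (K 1)" "coeff (?q y) 0 = ev y (Hess d F)" for y using d1 by (simp_all add: coeff_poly_upto K0)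
    have K1: "K 1 \<noteq> 0" using root[OF y0] c1[of y0] by auto
    have "Hess d F * (K 1 * (K 1 * F - of_nat d * (Hess d F * G))) = 0"
    proof (rule ev_inj0)
      fix y
      show "ev y (Hess d F * (K 1 * (K 1 * F - of_nat d * (Hess d F * G)))) = 0"
      proof (cases "ev y (Hess d F) = 0 \<or> ev y (K 1) = 0")
        case False
        have "\<exists>t1. poly (?q y) t1 = 0"
        proof (rule ccontr)
          assume "\<nexists>t1. poly (?q y) t1 = 0"
          then have "constant (poly (?q y))" using fundamental_theorem_of_algebra by blast
          then have "degree (?q y) = 0" by (simp add: constant_degree)
          then have "coeff (?q y) 1 = 0" by (simp add: coeff_eq_0)
          then show False using False c1 by simp
        qed
        then obtain t1 where t1: "poly (?q y) t1 = 0" by blast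
        have rt: "ev y (K 1) * (- t1) = of_nat d * ev y (Hess d F)" using root[OF _ t1] False c1 by auto
        have "ev y (?P t1) = 0" using vanish[of y t1] t1 pq by simp
        then have "ev y F = - t1 * ev y G" by (simp add: ev.hom_add ev.hom_mult eq_neg_iff_add_eq_0)
        then have "ev y (K 1) * ev y F = (ev y (K 1) * (- t1)) * ev y G" by simp
        then show ?thesis unfolding rt by (simp add: ev.hom_mult ev.hom_minus ev.hom_of_nat)
      qed (auto simp: ev.hom_mult)
    qed
    then have "K 1 * F = of_nat d * (Hess d F * G)" using F0 K1 by simp
    moreover have "sym_tensor d d (K 1)"
    proof (rule sym_tensor_pencil_coeff[where d = d and e = d and N = d and K = K and k = 1])
      fix t
      obtain l c where l: "sym_tensor d 1 l" "Hess d (?P t) = Const c * l ^ ?N" using pow by blast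
      have "sym_tensor d (d * 1) (l ^ d)" by (rule sym_tensor_power[OF l(1)])
      then show "sym_tensor d d (\<Sum>k\<le>d. Const (t ^ k) * K k)"
        using l(2) n3 by (simp add: K[symmetric] sym_tensor_Const_mult)
    qed (rule d1)
    ultimately show ?thesis using n3 by blast
  qed
qed

section \<open>The Hessian of a pencil of normal forms is constant\<close>

lemma quadratic_coeffs_2:
  assumes "sym_tensor 2 2 k"
  obtains a b c where "k = Const a * Var 0 ^ 2 + Const b * Var 0 * Var 1 + Const c * Var 1 ^ 2"
proof -
  obtain A where A: "k = (\<Sum>i<2. \<Sum>j<2. Const (A $$ (i, j)) * Var i * Var j)" using quadratic_form[OF assms] .
  have "k = Const (A $$ (0,0)) * Var 0 ^ 2 + Const (A $$ (0,1) + A $$ (1,0)) * Var 0 * Var 1 + Const (A $$ (1,1)) * Var 1 ^ 2"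
    unfolding A by (simp add: sum_lessThan_2 power2_eq_square Const_add algebra_simps)
  then show ?thesis using that by blast
qed

text \<open>
  The identity for \<open>K\<close> makes \<open>G\<close> divisible by \<open>x_1\<close>, so the pencil consists of products of \<open>x_1\<close> with quadratic forms. If \<open>x_0\<^sup>2\<close>
  occurs in the quadratic factor, the Hessian of the product is a square only if the discriminant of that factor vanishes, and this for all \<open>t\<close>
  forces \<open>G = 0\<close>.\<close>
lemma binary_pencil_stationary:
  assumes P: "\<And>t. GL_equiv 2 (nf 2 3 + Const t * G) (nf 2 3)"
    and K: "sym_tensor 2 2 K" "K * nf 2 3 = of_nat 2 * (Hess 2 (nf 2 3) * G)"
  shows "G = 0"
proof -
  have nf: "nf 2 3 = Var 0 ^ 2 * Var 1" by (simp add: nf_def)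
  have HF: "Hess 2 (nf 2 3) = Const (- 4) * Var 0 ^ 2" using Hess_nf[of 2 3] by (simp add: nf_hess_coeff_def)
  have "Var 0 ^ 2 * (K * Var 1) = Var 0 ^ 2 * (Const (- 8) * G)"
  proof -
    have "of_nat 2 = Const (of_nat 2)" by (rule Const.hom_of_nat[symmetric])
    then have c: "of_nat 2 = Const 2" "Const 2 * Const (- 4) = Const (- 8)"
      unfolding Const_mult[symmetric] by simp_all
    have "Var 0 ^ 2 * (K * Var 1) = K * (Var 0 ^ 2 * Var 1)" by (rule mult.left_commute)
    also have "\<dots> = of_nat 2 * (Const (- 4) * Var 0 ^ 2 * G)" using K(2) unfolding HF unfolding nf .
    also have "\<dots> = Const (- 8) * (Var 0 ^ 2 * G)" unfolding c(2)[symmetric] c(1) by (simp only: mult.assoc)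
    also have "\<dots> = Var 0 ^ 2 * (Const (- 8) * G)" by (rule mult.left_commute)
    finally show ?thesis .
  qed
  then have KG: "K * Var 1 = Const (- 8) * G" by simp
  define k where "k = Const (- (1/8)) * K"
  have Gk: "G = Var 1 * k"
  proof -
    have "Const (- (1/8)) * (K * Var 1) = (Const (- (1/8)) * Const (- 8)) * G" unfolding KG by (simp add: mult.assoc)
    then show ?thesis unfolding Const_mult[symmetric] by (simp add: k_def ac_simps)
  qed
  have "sym_tensor 2 2 k" unfolding k_def by (rule sym_tensor_Const_mult[OF K(1)])
  then obtain k0 k1 k2 where k: "k = Const k0 * Var 0 ^ 2 + Const k1 * Var 0 * Var 1 + Const k2 * Var 1 ^ 2"
    using quadratic_coeffs_2 by blast
  have Ft: "nf 2 3 + Const t * G = Var 1 * (Const (1 + t * k0) * Var 0 ^ 2 + Const (t * k1) * Var 0 * Var 1 + Const (t * k2) * Var 1 ^ 2)" for t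
    unfolding nf Gk k by (simp add: Const_add Const_mult algebra_simps)
  have disc: "a \<noteq> 0 \<Longrightarrow> 4 * a * c = b ^ 2" if g: "GL_equiv 2 (Var 1 * (Const a * Var 0 ^ 2 + Const b * Var 0 * Var 1 + Const c * Var 1 ^ 2)) (nf 2 3)" for a b c
  proof -
    assume a: "a \<noteq> 0"
    let ?f = "Var 1 * (Const a * Var 0 ^ 2 + Const b * Var 0 * Var 1 + Const c * Var 1 ^ 2)"
    have H: "Hess 2 ?f = Const (- 4 * a ^ 2) * Var 0 ^ 2 + Const (- 4 * a * b) * Var 0 * Var 1 + Const (12 * a * c - 4 * b ^ 2) * Var 1 ^ 2"
    proof -
      have 0: "partial 0 (partial 0 ?f) = 2 * Const a * Var 1"
        by (simp add: partial_mult partial_add partial_power partial_Var algebra_simps)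
      have 1: "partial 0 (partial 1 ?f) = 2 * Const a * Var 0 + 2 * Const b * Var 1"
        by (simp add: partial_mult partial_add partial_power partial_Var algebra_simps)
      have 2: "partial 1 (partial 1 ?f) = 2 * Const b * Var 0 + 6 * Const c * Var 1"
        by (simp add: partial_mult partial_add partial_power partial_Var algebra_simps)
      show ?thesis unfolding Hess_2 unfolding 0 1 2
        by (simp add: Const_mult Const_add Const.hom_minus Const.hom_uminus Const.hom_numeral Const.hom_power algebra_simps power2_eq_square)
    qed
    obtain l C where l: "sym_tensor 2 1 l" "Hess 2 ?f = Const C * l ^ (2 * (3 - 2))"
      using GL_equiv_nf_witness[OF disjI1[OF refl] order_refl g] by blast
    obtain u where u: "l = lform 2 u" using sym_tensor_1_lform[OF l(1)] .
    have e: "- 4 * a ^ 2 * x ^ 2 + - 4 * a * b * x * y + (12 * a * c - 4 * b ^ 2) * y ^ 2 = C * (u 0 * x + u 1 * y) ^ 2" for x y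
    proof -
      have "ev (\<lambda>i. if i = 0 then x else y) (Hess 2 ?f) = ev (\<lambda>i. if i = 0 then x else y) (Const C * l ^ (2 * (3 - 2)))" unfolding l(2) ..
      then show ?thesis unfolding H by (simp add: u lform_2 ev.hom_add ev.hom_mult ev.hom_power)
    qed
    have "(- 4 * a * b) ^ 2 = 4 * (- 4 * a ^ 2) * (12 * a * c - 4 * b ^ 2)"
    proof -
      have 1: "- 4 * a ^ 2 = C * u 0 ^ 2" using e[of 1 0] by simp
      have 2: "12 * a * c - 4 * b ^ 2 = C * u 1 ^ 2" using e[of 0 1] by simp
      have "- 4 * a ^ 2 + - 4 * a * b + (12 * a * c - 4 * b ^ 2) = C * (u 0 + u 1) ^ 2" using e[of 1 1] by simp
      then have "- 4 * a * b = C * (u 0 + u 1) ^ 2 - C * u 0 ^ 2 - C * u 1 ^ 2" unfolding 1 2 by (simp add: algebra_simps)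
      then have 3: "- 4 * a * b = 2 * C * u 0 * u 1" by (simp add: power2_eq_square algebra_simps)
      show ?thesis unfolding 1 2 3 by (simp add: power2_eq_square algebra_simps)
    qed
    then have "a ^ 2 * (48 * (4 * a * c - b ^ 2)) = 0" by (simp add: power2_eq_square algebra_simps)
    then show ?thesis using a by (simp add: mult.assoc)
  qed
  have lin: "4 * k2 + t * (4 * k0 * k2 - k1 ^ 2) = 0" if t: "t \<noteq> 0" "1 + t * k0 \<noteq> 0" for t
  proof -
    have "4 * (1 + t * k0) * (t * k2) = (t * k1) ^ 2" using disc[OF P[of t, unfolded Ft]] t by blast
    then have "t * (4 * k2 + t * (4 * k0 * k2 - k1 ^ 2)) = 0" by (simp add: power2_eq_square algebra_simps)
    then show ?thesis using t by simp
  qed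
  obtain s t where st: "s \<noteq> 0" "t \<noteq> 0" "s \<noteq> t" "1 + s * k0 \<noteq> 0" "1 + t * k0 \<noteq> (0::complex)"
  proof (cases "k0 = - 1 \<or> k0 = - (1/2)")
    case True
    then show ?thesis using that[of 3 4] by auto
  next
    case False
    have "1 + 1 * k0 \<noteq> 0"
    proof
      assume "1 + 1 * k0 = 0"
      then have "k0 = - 1" by (simp add: eq_neg_iff_add_eq_0 add.commute)
      then show False using False by simp
    qed
    moreover have "1 + 2 * k0 \<noteq> 0"
    proof
      assume "1 + 2 * k0 = 0"
      then have "2 * k0 = - 1" by (simp add: eq_neg_iff_add_eq_0 add.commute)
      moreover have "k0 = (2 * k0) / 2" by simp
      ultimately have "k0 = - 1 / 2" by metis
      then show False using False by simp
    qed
    ultimately have "1 + 1 * k0 \<noteq> 0" "1 + 2 * k0 \<noteq> 0" by blast+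
    then show ?thesis using that[of 1 2] by auto
  qed
  have "(s - t) * (4 * k0 * k2 - k1 ^ 2) = (4 * k2 + s * (4 * k0 * k2 - k1 ^ 2)) - (4 * k2 + t * (4 * k0 * k2 - k1 ^ 2))"
    by (simp add: algebra_simps)
  then have z: "4 * k0 * k2 - k1 ^ 2 = 0" using lin[OF st(1,4)] lin[OF st(2,5)] st(3) by simp
  then have k2: "k2 = 0" using lin[OF st(1,4)] by simp
  then have k1: "k1 = 0" using z by simp
  have "k0 = 0"
  proof (rule ccontr)
    assume "k0 \<noteq> 0"
    then have "nf 2 3 + Const (- 1 / k0) * G = 0" unfolding Ft by (simp add: k1 k2)
    then show False using GL_equiv_nf_witness[OF disjI1[OF refl] order_refl P[of "- 1 / k0"]] by (auto simp: Hess_2)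
  qed
  then show ?thesis by (simp add: Gk k k1 k2)
qed

lemma r0_eq_0_divide: assumes "sym_tensor d n g" "r0 g = 0" "0 < d"
  obtains h where "g = Var 0 * h" "sym_tensor d (n - 1) h"
proof -
  have "1 \<le> lk m 0" if "m \<in> supp g" for m
  proof (rule ccontr)
    assume "\<not> 1 \<le> lk m 0"
    then have "lk (r0 g) m = lk g m" by (simp add: lookup_r0)
    then show False using that assms(2) by (simp add: in_keys_iff)
  qed
  then obtain h where "g = Var 0 ^ 1 * h" "sym_tensor d (n - 1) h" using divide_Var0_power[OF assms(1) _ assms(3), of 1] by blast
  then show ?thesis using that by simp
qed

definition conic :: cpoly where "conic = Var 0 * Var 2 + Var 1 ^ 2"

text \<open>
  The coefficient \<open>4 a_0 a_2 + a_1\<^sup>2\<close> vanishes iff the line is tangent to the conic.\<close>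
lemma Hess_lform_conic:
  "Hess 3 (lform 3 a * conic) = Const (- 8) * lform 3 a ^ 3 + Const (2 * (4 * a 0 * a 2 + a 1 ^ 2)) * (lform 3 a * conic)"
proof (rule ev_inj)
  fix x
  let ?f = "lform 3 a * conic"
  have 0: "partial 0 (partial 0 ?f) = 2 * Const (a 0) * Var 2" "partial 0 (partial 1 ?f) = 2 * Const (a 0) * Var 1 + Const (a 1) * Var 2"
    "partial 0 (partial 2 ?f) = Const (a 0) * Var 0 + Const (a 2) * Var 2 + lform 3 a"
    "partial 1 (partial 1 ?f) = 4 * Const (a 1) * Var 1 + 2 * lform 3 a" "partial 1 (partial 2 ?f) = Const (a 1) * Var 0 + 2 * Const (a 2) * Var 1"
    "partial 2 (partial 2 ?f) = 2 * Const (a 2) * Var 0"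
    by (simp_all add: conic_def partial_mult partial_add partial_power partial_Var partial_lform algebra_simps)
  show "ev x (Hess 3 ?f) = ev x (Const (- 8) * lform 3 a ^ 3 + Const (2 * (4 * a 0 * a 2 + a 1 ^ 2)) * (lform 3 a * conic))"
    unfolding Hess_3 unfolding 0 unfolding lform_3 conic_def
    by (simp add: ev.hom_add ev.hom_mult ev.hom_minus ev.hom_uminus ev.hom_power ev.hom_numeral)
       (simp add: power2_eq_square power3_eq_cube algebra_simps)
qed

text \<open>
  A linear form that vanishes on the kernel of another one is a multiple of it.\<close>
lemma lform_multiple:
  assumes k: "k < d" "a k \<noteq> 0" and z: "\<And>x. ev x (lform d a) = 0 \<Longrightarrow> ev x (lform d b) = 0"
  shows "lform d b = Const (b k / a k) * lform d a"
proof -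
  have "b i = b k / a k * a i" if i: "i < d" for i
  proof (cases "i = k")
    case False
    let ?x = "\<lambda>j. if j = i then 1 else if j = k then - a i / a k else 0"
    have s: "(\<Sum>j<d. c j * ?x j) = c i - c k * (a i / a k)" for c :: "nat \<Rightarrow> complex"
    proof -
      have "(\<Sum>j<d. c j * ?x j) = (\<Sum>j<d. (if j = i then c i else 0) + (if j = k then - c k * (a i / a k) else 0))"
        by (rule sum.cong) (use False in auto)
      then show ?thesis using i k by (simp add: sum.distrib sum.delta)
    qed
    have "ev ?x (lform d a) = 0" unfolding ev_lform s using k by simp
    then have "ev ?x (lform d b) = 0" by (rule z)
    then show ?thesis unfolding ev_lform s using k by (simp add: field_simps)
  qed (use k in simp)
  then have "lform d b = lform d (\<lambda>i. b k / a k * a i)" by (intro lform_cong)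
  then show ?thesis by (simp only: lform_def sum_distrib_left Const_mult mult.assoc)
qed

text \<open>
  If the line were not tangent, the formula for the Hessian would make the conic a multiple of a square of a linear form.\<close>
lemma tangent_factor:
  assumes g: "GL_equiv 3 (lform 3 a * conic) (nf 3 3)"
  shows "4 * a 0 * a 2 + a 1 ^ 2 = 0"
proof (rule ccontr)
  define \<delta> where "\<delta> = 4 * a 0 * a 2 + a 1 ^ 2"
  assume "4 * a 0 * a 2 + a 1 ^ 2 \<noteq> 0"
  then have d0: "\<delta> \<noteq> 0" by (simp add: \<delta>_def)
  let ?L = "lform 3 a"
  obtain l C where l: "sym_tensor 3 1 l" "l \<noteq> 0" "C \<noteq> 0" "Hess 3 (?L * conic) = Const C * l ^ (3 * (3 - 2))"
    using GL_equiv_nf_witness[OF disjI2[OF refl] order_refl g] by blast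
  have L0: "?L \<noteq> 0" using l by (auto simp: Hess_3)
  then obtain k where k: "k < 3" "a k \<noteq> 0" using lform_eq_0_iff by blast
  obtain b where b: "l = lform 3 b" using sym_tensor_1_lform[OF l(1)] .
  have H: "Const (- 8) * ?L ^ 3 + Const (2 * \<delta>) * (?L * conic) = Const C * l ^ 3"
    using l(4) unfolding Hess_lform_conic \<delta>_def by simp
  have "ev x l = 0" if "ev x ?L = 0" for x
  proof -
    have "ev x (Const (- 8) * ?L ^ 3 + Const (2 * \<delta>) * (?L * conic)) = ev x (Const C * l ^ 3)" unfolding H ..
    then show ?thesis using that l(3) by (simp add: ev.hom_add ev.hom_mult ev.hom_power)
  qed
  then have lm: "l = Const (b k / a k) * ?L" unfolding b using lform_multiple[of k 3 a b] k by blast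
  define \<mu> where "\<mu> = b k / a k"
  have "?L * (Const (2 * \<delta>) * conic) = ?L * (Const (C * \<mu> ^ 3 + 8) * ?L ^ 2)"
    using H unfolding lm \<mu>_def[symmetric]
    by (simp add: power_mult_distrib Const_add Const_mult Const.hom_power Const.hom_numeral Const.hom_uminus power2_eq_square power3_eq_cube algebra_simps add_eq_0_iff)
  then have q: "Const (2 * \<delta>) * conic = Const (C * \<mu> ^ 3 + 8) * ?L ^ 2" using L0 by simp
  have e: "2 * \<delta> * (x * z + y ^ 2) = (C * \<mu> ^ 3 + 8) * (a 0 * x + a 1 * y + a 2 * z) ^ 2" for x y z
  proof -
    let ?p = "\<lambda>i::nat. if i = 0 then x else if i = 1 then y else z"
    have "ev ?p (Const (2 * \<delta>) * conic) = ev ?p (Const (C * \<mu> ^ 3 + 8) * ?L ^ 2)" unfolding q ..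
    then show ?thesis by (simp add: conic_def lform_3 ev.hom_add ev.hom_mult ev.hom_power)
  qed
  have "(C * \<mu> ^ 3 + 8) * a 0 ^ 2 = 0" "(C * \<mu> ^ 3 + 8) * a 2 ^ 2 = 0" using e[where x = 1 and y = 0 and z = 0] e[where x = 0 and y = 0 and z = 1] by simp_all
  moreover have "C * \<mu> ^ 3 + 8 \<noteq> 0" using e[where x = 0 and y = 1 and z = 0] d0 by auto
  ultimately have "a 0 = 0" "a 2 = 0" by simp_all
  then show False using e[where x = 1 and y = 0 and z = 1] d0 by simp
qed

text \<open>
  The identity for \<open>K\<close> makes \<open>G\<close> a product of the conic with a linear form \<open>e\<close>. Every line \<open>x_0 + t e\<close> must be tangent to the
  conic, a quadratic condition in \<open>t\<close> that leaves only \<open>e\<close> proportional to \<open>x_0\<close>; then some member of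
  the pencil is zero unless \<open>e = 0\<close>.\<close>
lemma ternary_pencil_stationary:
  assumes P: "\<And>t. GL_equiv 3 (nf 3 3 + Const t * G) (nf 3 3)"
    and K: "sym_tensor 3 3 K" "K * nf 3 3 = of_nat 3 * (Hess 3 (nf 3 3) * G)"
  shows "G = 0"
proof -
  have nf: "nf 3 3 = Var 0 * conic" by (simp add: nf_def conic_def distrib_left power2_eq_square)
  have HF: "Hess 3 (nf 3 3) = Const (- 8) * Var 0 ^ 3" using Hess_nf[of 3 3] by (simp add: nf_hess_coeff_def)
  have "Var 0 * (K * conic) = Var 0 * (Const (- 24) * (Var 0 * (Var 0 * G)))"
  proof -
    have "of_nat 3 = Const (of_nat 3)" by (rule Const.hom_of_nat[symmetric])
    then have c: "of_nat 3 = Const 3" "Const 3 * Const (- 8) = Const (- 24)"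
      unfolding Const_mult[symmetric] by simp_all
    have "Var 0 * (K * conic) = K * (Var 0 * conic)" by (rule mult.left_commute)
    also have "\<dots> = of_nat 3 * (Const (- 8) * Var 0 ^ 3 * G)" using K(2) unfolding HF unfolding nf .
    also have "\<dots> = Const (- 24) * (Var 0 * (Var 0 * (Var 0 * G)))"
      unfolding c(2)[symmetric] c(1) power3_eq_cube by (simp only: mult.assoc)
    also have "\<dots> = Var 0 * (Const (- 24) * (Var 0 * (Var 0 * G)))" by (rule mult.left_commute)
    finally show ?thesis .
  qed
  then have KG: "K * conic = Const (- 24) * (Var 0 * (Var 0 * G))" by simp
  have rc: "r0 conic = Var 1 ^ 2" by (simp add: conic_def r0.hom_add r0.hom_mult r0.hom_power)
  have "r0 (K * conic) = 0" unfolding KG by (simp add: r0.hom_mult)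
  then have "r0 K = 0" by (simp add: r0.hom_mult rc)
  then obtain h where h: "K = Var 0 * h" "sym_tensor 3 (3 - 1) h" using r0_eq_0_divide[OF K(1)] by auto
  have "Var 0 * (h * conic) = Var 0 * (Const (- 24) * (Var 0 * G))" using KG unfolding h(1) by (simp only: mult.assoc mult.left_commute[of "Var 0" "Const (- 24)"])
  then have hG: "h * conic = Const (- 24) * (Var 0 * G)" by simp
  have "r0 (h * conic) = 0" unfolding hG by (simp add: r0.hom_mult)
  then have "r0 h = 0" by (simp add: r0.hom_mult rc)
  then obtain \<beta> where b: "h = Var 0 * \<beta>" "sym_tensor 3 (3 - 1 - 1) \<beta>" using r0_eq_0_divide[OF h(2)] by auto
  have "Var 0 * (\<beta> * conic) = Var 0 * (Const (- 24) * G)" using hG unfolding b(1) by (simp only: mult.assoc mult.left_commute[of "Var 0" "Const (- 24)"])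
  then have bG: "\<beta> * conic = Const (- 24) * G" by simp
  have "sym_tensor 3 1 (Const (- (1/24)) * \<beta>)" using b(2) by (intro sym_tensor_Const_mult) (simp add: One_nat_def)
  then obtain e where e: "Const (- (1/24)) * \<beta> = lform 3 e" using sym_tensor_1_lform by blast
  have G: "G = lform 3 e * conic"
  proof -
    have "Const (- (1/24)) * (\<beta> * conic) = (Const (- (1/24)) * Const (- 24)) * G" unfolding bG by (simp add: mult.assoc)
    then show ?thesis unfolding Const_mult[symmetric] by (simp add: e[symmetric] mult.assoc)
  qed
  define av where "av = (\<lambda>t (i::nat). if i = 0 then 1 + t * e 0 else t * e i)"
  have Ft: "nf 3 3 + Const t * G = lform 3 (av t) * conic" for t
    unfolding nf G lform_3 by (simp add: av_def Const_add Const_mult algebra_simps)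
  have q: "4 * av t 0 * av t 2 + av t 1 ^ 2 = 0" for t
    using P[of t] unfolding Ft by (rule tangent_factor)
  have q1': "av t 1 ^ 2 = - (4 * av t 0 * av t 2)" for t
    using q[of t] by (simp add: eq_neg_iff_add_eq_0 add.commute)
  have q1: "e 1 ^ 2 = - ((4 + 4 * e 0) * e 2)" using q1'[of 1] by (simp add: av_def)
  have q2: "e 1 ^ 2 = (4 - 4 * e 0) * e 2" using q1'[of "- 1"] by (simp add: av_def)
  have "8 * e 2 = (4 - 4 * e 0) * e 2 - (- ((4 + 4 * e 0) * e 2))" by (simp add: algebra_simps)
  also have "\<dots> = e 1 ^ 2 - e 1 ^ 2" by (simp only: q1[symmetric] q2[symmetric])
  finally have "8 * e 2 = 0" by simp
  then have e2: "e 2 = 0" by simp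
  then have e1: "e 1 = 0" using q1 by simp
  have "e 0 = 0"
  proof (rule ccontr)
    assume "e 0 \<noteq> 0"
    then have "nf 3 3 + Const (- 1 / e 0) * G = 0" unfolding Ft by (simp add: av_def lform_3 e1 e2)
    then show False using GL_equiv_nf_witness[OF disjI2[OF refl] order_refl P[of "- 1 / e 0"]] by (auto simp: Hess_3)
  qed
  then show ?thesis by (simp add: G lform_3 e1 e2)
qed

lemma pencil_constant:
  assumes d: "d = 2 \<or> d = 3" and n: "3 \<le> n" and P: "\<And>t. GL_equiv d (nf d n + Const t * G) (nf d n)"
  shows "Hess d (nf d n + G) = Hess d (nf d n)"
proof -
  consider "\<forall>t. Hess d (nf d n + Const t * G) = Hess d (nf d n)" |
    K where "n = 3" "sym_tensor d d K" "K * nf d n = of_nat d * (Hess d (nf d n) * G)"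
    using pencil_alternative[OF d n P] by blast
  then show ?thesis
  proof cases
    case 1
    then show ?thesis by (metis Const_1 mult_1)
  next
    case 2
    have "G = 0" using d binary_pencil_stationary[of G K] ternary_pencil_stationary[of G K] P 2 by auto
    then show ?thesis by simp
  qed
qed

section \<open>Persistent tensors are in normal form\<close>

lemma supp_divisible: "m \<in> supp (Var 0 ^ k * g) \<Longrightarrow> k \<le> lk m 0"
  by (elim supp_Var0_power_mult) (simp add: lookup_add)

text \<open>
  The linear form in the Hessian of a normal form is determined up to a scalar.\<close>
lemma nf_LS_row0:
  assumes d: "d = 2 \<or> d = 3" and C: "C \<in> carrier_mat d d" "det C \<noteq> 0" and n: "3 \<le> n"
    and H: "Hess d (lin_subst d C (nf d n)) = Const s * Var 0 ^ (d * (n - 2))"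
  obtains \<zeta> where "\<zeta> \<noteq> 0" "lin_subst d C (Var 0) = Const \<zeta> * Var 0"
proof -
  have n2: "2 \<le> n" using n by simp
  have d0: "0 < d" using d by auto
  have N: "0 < d * (n - 2)" using d n by auto
  let ?l = "lform d (\<lambda>j. C $$ (0, j))"
  define a where "a = (\<lambda>j::nat. if j = 0 then 1 else (0::complex))"
  have "lform d a = (\<Sum>j<d. if j = 0 then Var 0 else 0)"
    unfolding lform_def a_def by (rule sum.cong) auto
  then have V: "Var 0 = lform d a" using d0 by (simp add: sum.delta)
  have e: "Const (det C ^ 2 * nf_hess_coeff d n) * ?l ^ (d * (n - 2)) = Const s * Var 0 ^ (d * (n - 2))"
    using H unfolding GL_equiv_nf_hess_power[OF d n2 C(1)] .
  have "ev x ?l = 0" if "ev x (lform d a) = 0" for x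
  proof -
    have "ev x (Const (det C ^ 2 * nf_hess_coeff d n) * ?l ^ (d * (n - 2))) = ev x (Const s * Var 0 ^ (d * (n - 2)))" unfolding e ..
    then show ?thesis using that C(2) nf_hess_coeff_neq_0[OF n2, of d] N unfolding V by (simp add: ev.hom_mult ev.hom_power power_0_left)
  qed
  then have l: "?l = Const (C $$ (0, 0)) * Var 0"
    using lform_multiple[of 0 d a "\<lambda>j. C $$ (0, j)"] d0 unfolding V by (simp add: a_def)
  have "C $$ (0, 0) \<noteq> 0" using l row_neq_0[OF C d0] by auto
  then show ?thesis using that l d0 by (simp add: LS_Var)
qed

text \<open>
  If all first derivatives are divisible by \<open>x_0^e\<close> with \<open>e \<ge> 1\<close>, a monomial without \<open>x_0\<close> is impossible, and the
  derivative by \<open>x_0\<close> shows one more factor.\<close>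
lemma divisible_by_tangent:
  assumes f: "sym_tensor d n f" and e: "1 \<le> e" and D: "\<And>i m. i < d \<Longrightarrow> m \<in> supp (partial i f) \<Longrightarrow> e \<le> lk m 0"
    and n: "0 < n" and m: "m \<in> supp f" and d: "0 < d"
  shows "Suc e \<le> lk m 0"
proof -
  have key: "m - ex i \<in> supp (partial i f)" if "lk m i \<noteq> 0" for i
  proof -
    have "lk (partial i f) (m - ex i) = of_nat (lk (m - ex i) i + 1) * lk f m"
      using that by (simp only: lookup_partial ex_cancel not_False_eq_True)
    then show ?thesis using m by (simp add: in_keys_iff del: of_nat_add of_nat_Suc)
  qed
  show ?thesis
  proof (cases "lk m 0 = 0")
    case False
    then have "e \<le> lk (m - ex 0) 0" using D[OF d key] by simp
    then show ?thesis using False by (simp add: lookup_minus)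
  next
    case True
    have "\<exists>i<d. lk m i \<noteq> 0"
    proof (rule ccontr)
      assume "\<not> (\<exists>i<d. lk m i \<noteq> 0)"
      then have "(\<Sum>i<d. lk m i) = 0" by simp
      then show False using sym_tensorD(2)[OF f m] n by simp
    qed
    then obtain i where i: "i < d" "lk m i \<noteq> 0" by blast
    then have "e \<le> lk (m - ex i) 0" using D[OF i(1) key] by simp
    then show ?thesis using True e by (simp add: lookup_minus)
  qed
qed

text \<open>
  Comparing a direction \<open>w\<close> with \<open>u\<close> inside the pencil that joins them, \<open>pencil_constant\<close> shows that the Hessian of every derivative with
  \<open>a \<bullet> w \<noteq> 0\<close> is a multiple of the same power of \<open>x_0\<close>, so these derivatives are normal forms with first variable \<open>x_0\<close>. All derivatives are
  then divisible by \<open>x_0^{n-d}\<close> and \<open>f\<close> by one power more. For \<open>d = 2\<close> this is the normal form. For \<open>d = 3\<close> a quadratic cofactor \<open>q\<close> remains;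
  restricting one derivative to \<open>x_0 = 0\<close> shows that \<open>q\<close> is a square there.\<close>
lemma normal_direction_imp_nf:
  assumes d: "d = 2 \<or> d = 3" and n: "4 \<le> n" and f: "sym_tensor d n f" and conc: "concise d f"
    and u: "u \<in> carrier_vec d" "dir_deriv d u f = nf d (n - 1)"
    and a: "a \<in> carrier_vec d" "a \<bullet> u \<noteq> 0"
    and P: "\<And>w. w \<in> carrier_vec d \<Longrightarrow> a \<bullet> w \<noteq> 0 \<Longrightarrow> GL_equiv d (dir_deriv d w f) (nf d (n - 1))"
  shows "GL_equiv d f (nf d n)"
proof -
  let ?m = "n - 1"
  have m: "3 \<le> ?m" "2 \<le> ?m" using n by auto
  have d0: "0 < d" using d by auto
  have Hw: "Hess d (dir_deriv d w f) = Const (((a \<bullet> w) / (a \<bullet> u)) ^ d * nf_hess_coeff d ?m) * Var 0 ^ (d * (?m - 2))"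
    if w: "w \<in> carrier_vec d" "a \<bullet> w \<noteq> 0" for w
  proof -
    define s where "s = (a \<bullet> w) / (a \<bullet> u)"
    have s: "s \<noteq> 0" using w a by (simp add: s_def)
    (* After rescaling, w is joined to u by a line parallel to the hyperplane a = 0. *)
    define v where "v = (1 / s) \<cdot>\<^sub>v w + (- 1) \<cdot>\<^sub>v u"
    have v: "v \<in> carrier_vec d" using w u by (simp add: v_def)
    have av: "a \<bullet> v = 0"
      using a w u s by (simp add: v_def scalar_prod_add_distrib[of _ d] s_def)
    have P': "GL_equiv d (nf d ?m + Const t * dir_deriv d v f) (nf d ?m)" for t
    proof -
      have "a \<bullet> (u + t \<cdot>\<^sub>v v) \<noteq> 0" using a u v av by (simp add: scalar_prod_add_distrib[of _ d])
      then have "GL_equiv d (dir_deriv d (u + t \<cdot>\<^sub>v v) f) (nf d ?m)" using u v by (intro P) auto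
      then show ?thesis using u v by (simp add: dir_deriv_add dir_deriv_smult)
    qed
    have "dir_deriv d w f = Const s * (nf d ?m + dir_deriv d v f)"
    proof -
      have "w = s \<cdot>\<^sub>v (u + v)" using w u s
        by (intro eq_vecI) (auto simp: v_def field_simps)
      then show ?thesis using u v by (simp add: dir_deriv_add dir_deriv_smult)
    qed
    then have "Hess d (dir_deriv d w f) = Const (s ^ d) * Hess d (nf d ?m)"
      using pencil_constant[OF d m(1) P'] by (simp add: Hess_Const_mult)
    then show ?thesis by (simp add: Hess_nf[OF d m(2)] s_def Const_mult mult.assoc)
  qed
  have shape: "\<exists>C \<zeta>. C \<in> carrier_mat d d \<and> \<zeta> \<noteq> 0 \<and> lin_subst d C (Var 0) = Const \<zeta> * Var 0 \<and> dir_deriv d w f = lin_subst d C (nf d ?m)"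
    if w: "w \<in> carrier_vec d" "a \<bullet> w \<noteq> 0" for w
  proof -
    obtain C where C: "C \<in> carrier_mat d d" "det C \<noteq> 0" "dir_deriv d w f = lin_subst d C (nf d ?m)"
      using P[OF w] GL_equiv_iff by blast
    obtain \<zeta> where "\<zeta> \<noteq> 0" "lin_subst d C (Var 0) = Const \<zeta> * Var 0"
      using nf_LS_row0[OF d C(1,2) m(1)] Hw[OF w] unfolding C(3) by blast
    then show ?thesis using C by blast
  qed
  define e where "e = n - d"
  have e1: "1 \<le> e" using n d by (auto simp: e_def)
  have div_w: "e \<le> lk p 0" if w: "w \<in> carrier_vec d" "a \<bullet> w \<noteq> 0" and p: "p \<in> supp (dir_deriv d w f)" for w p
  proof -
    obtain C \<zeta> where C: "lin_subst d C (Var 0) = Const \<zeta> * Var 0" "dir_deriv d w f = lin_subst d C (nf d ?m)"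
      using shape[OF w] by blast
    have "\<exists>h. dir_deriv d w f = Var 0 ^ e * h"
      using d
    proof
      assume d: "d = 2"
      have "n - 1 - 1 = e" by (simp add: e_def d)
      then have "dir_deriv d w f = Var 0 ^ e * (Const (\<zeta> ^ e) * lin_subst 2 C (Var 1))"
        unfolding C(2) using C(1) by (simp add: nf_def d LS.hom_mult LS.hom_power power_mult_distrib Const.hom_power mult.left_commute mult.assoc)
      then show ?thesis by blast
    next
      assume d: "d = 3"
      have "n - 1 - 1 = Suc e" "n - 1 - 2 = e" using n by (simp_all add: e_def d)
      then have "dir_deriv d w f = Var 0 ^ e * (Const (\<zeta> ^ Suc e) * Var 0 * lin_subst 3 C (Var 2) + Const (\<zeta> ^ e) * lin_subst 3 C (Var 1) ^ 2)"
        unfolding C(2) using C(1) by (simp add: nf_def d LS.hom_add LS.hom_mult LS.hom_power power_mult_distrib Const.hom_power Const_mult algebra_simps)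
      then show ?thesis by blast
    qed
    then show ?thesis using p supp_divisible by metis
  qed
  have div_all: "e \<le> lk p 0" if w: "w \<in> carrier_vec d" and p: "p \<in> supp (dir_deriv d w f)" for w p
  proof (cases "a \<bullet> w = 0")
    case False
    then show ?thesis using div_w w p by blast
  next
    case True
    have "a \<bullet> (w + u) \<noteq> 0" using True a w u by (simp add: scalar_prod_add_distrib[of _ d])
    moreover have "dir_deriv d w f = dir_deriv d (w + u) f - dir_deriv d u f" using w u by (simp add: dir_deriv_add)
    then have "p \<in> supp (dir_deriv d (w + u) f) \<or> p \<in> supp (dir_deriv d u f)"
      using p by (auto simp: in_keys_iff lookup_minus)
    ultimately show ?thesis using div_w[of "w + u" p] div_w[of u p] w u a by auto
  qed
  have supp_f: "Suc e \<le> lk p 0" if "p \<in> supp f" for p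
  proof (rule divisible_by_tangent[OF f e1 _ _ that d0])
    fix i q assume "i < d" "q \<in> supp (partial i f)"
    then show "e \<le> lk q 0" using div_all[of "unit_vec d i" q] by (simp add: dir_deriv_unit)
  qed (use n in simp)
  have "\<exists>R\<in>carrier_mat d d. f = lin_subst d R (nf d n)"
    using d
  proof
    assume d2: "d = 2"
    have f2: "sym_tensor 2 n f" using f d2 by simp
    have "n - 1 \<le> lk p 0" if "p \<in> supp f" for p using supp_f[OF that] n by (simp add: e_def d2)
    then obtain R where "R \<in> carrier_mat 2 2" "f = lin_subst 2 R (nf 2 n)"
      using sym_tensor_low_degree_2[OF f2, of thesis] n by auto
    then show ?thesis unfolding d2 by blast
  next
    assume d3: "d = 3"
    have f3: "sym_tensor 3 n f" using f d3 by simp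
    have "n - 2 \<le> lk p 0" if "p \<in> supp f" for p using supp_f[OF that] n by (simp add: e_def d3)
    then obtain q where q: "f = Var 0 ^ (n - 2) * q" "sym_tensor 3 (n - (n - 2)) q"
      using divide_Var0_power[OF f3, of "n - 2"] by auto
    have q2: "sym_tensor 3 2 q" using q(2) n by simp
    obtain w where w: "w \<in> carrier_vec 3" "a \<bullet> w \<noteq> 0" "w $ 0 \<noteq> 0"
    proof (cases "u $ 0 = 0")
      case False
      then show ?thesis using that[of u] u a d3 by simp
    next
      case True
      have au: "a \<bullet> (u + s \<cdot>\<^sub>v unit_vec 3 0) = a \<bullet> u + s * (a $ 0)" for s
        using a u d3 by (simp add: scalar_prod_add_distrib[of _ 3])
      show ?thesis
      proof (cases "a \<bullet> u + 1 * (a $ 0) = 0")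
        case False
        then show ?thesis using that[of "u + 1 \<cdot>\<^sub>v unit_vec 3 0"] au[of 1] u d3 True by simp
      next
        case t: True
        have "a \<bullet> u + (- 1) * (a $ 0) \<noteq> 0"
        proof
          assume "a \<bullet> u + (- 1) * (a $ 0) = 0"
          with t have "2 * (a \<bullet> u) = 0" by (simp add: algebra_simps)
          then show False using a by simp
        qed
        then show ?thesis using that[of "u + (- 1) \<cdot>\<^sub>v unit_vec 3 0"] au[of "- 1"] u d3 True by simp
      qed
    qed
    obtain C \<zeta> where C: "C \<in> carrier_mat 3 3" "\<zeta> \<noteq> 0" "lin_subst 3 C (Var 0) = Const \<zeta> * Var 0" "dir_deriv 3 w f = lin_subst 3 C (nf 3 ?m)"
      using shape[of w] w d3 by auto
    obtain k where k: "n = k + 4" using n by (metis add.commute le_Suc_ex)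
    have kk: "n - 2 = Suc (Suc k)" "n - 1 - 1 = Suc (Suc k)" "n - 1 - 2 = Suc k" by (auto simp: k)
    have "dir_deriv 3 w f = Var 0 ^ Suc k * (Const (of_nat (n - 2) * w $ 0) * q + Var 0 * dir_deriv 3 w q)"
    proof -
      have "dir_deriv 3 w f = Const (w $ 0) * (of_nat (n - 2) * Var 0 ^ (n - 2 - 1)) * q + Var 0 ^ (n - 2) * dir_deriv 3 w q"
        unfolding q(1) dir_deriv_3 by (simp add: partial_mult partial_Var_power algebra_simps)
      moreover have "n - 2 - 1 = Suc k" by (simp add: k)
      ultimately show ?thesis by (simp add: kk(1) Const_mult Const.hom_of_nat algebra_simps del: of_nat_Suc)
    qed
    moreover have "lin_subst 3 C (nf 3 ?m) = Var 0 ^ Suc k * (Const (\<zeta> ^ Suc (Suc k)) * Var 0 * lin_subst 3 C (Var 2) + Const (\<zeta> ^ Suc k) * lin_subst 3 C (Var 1) ^ 2)"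
      unfolding nf_def kk using C(3) by (simp add: LS.hom_add LS.hom_mult LS.hom_power power_mult_distrib Const.hom_power Const_mult algebra_simps)
    ultimately have "Var 0 ^ Suc k * (Const (of_nat (n - 2) * w $ 0) * q + Var 0 * dir_deriv 3 w q)
      = Var 0 ^ Suc k * (Const (\<zeta> ^ Suc (Suc k)) * Var 0 * lin_subst 3 C (Var 2) + Const (\<zeta> ^ Suc k) * lin_subst 3 C (Var 1) ^ 2)"
      using C(4) by simp
    then have eq: "Const (of_nat (n - 2) * w $ 0) * q + Var 0 * dir_deriv 3 w q = Const (\<zeta> ^ Suc (Suc k)) * Var 0 * lin_subst 3 C (Var 2) + Const (\<zeta> ^ Suc k) * lin_subst 3 C (Var 1) ^ 2"
      by (metis mult_left_cancel power_not_zero Var_neq_0)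
    let ?y = "r0 (lin_subst 3 C (Var 1))"
    have y: "?y = Const (C $$ (1, 1)) * Var 1 + Const (C $$ (1, 2)) * Var 2"
      by (simp add: LS_Var lform_3 r0.hom_add r0.hom_mult)
    have "r0 (Const (of_nat (n - 2) * w $ 0) * q + Var 0 * dir_deriv 3 w q) = r0 (Const (\<zeta> ^ Suc (Suc k)) * Var 0 * lin_subst 3 C (Var 2) + Const (\<zeta> ^ Suc k) * lin_subst 3 C (Var 1) ^ 2)"
      unfolding eq ..
    then have eq2: "Const (of_nat (n - 2) * w $ 0) * r0 q = Const (\<zeta> ^ Suc k) * ?y ^ 2"
      by (simp add: r0.hom_add r0.hom_mult r0.hom_power)
    have nw: "of_nat (n - 2) * w $ 0 \<noteq> 0" unfolding kk(1) using w(3) by (simp del: of_nat_Suc)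
    define \<rho> where "\<rho> = of_nat (n - 2) * w $ 0"
    have rho: "\<rho> \<noteq> 0" using nw unfolding \<rho>_def .
    define \<kappa> where "\<kappa> = \<zeta> ^ Suc k / \<rho>"
    have r0q: "r0 q = Const \<kappa> * ?y ^ 2"
    proof -
      have "\<rho> * \<kappa> = \<zeta> ^ Suc k" using rho by (simp add: \<kappa>_def)
      then have "Const \<rho> * r0 q = Const \<rho> * (Const \<kappa> * ?y ^ 2)"
        using eq2 unfolding \<rho>_def[symmetric] mult.assoc[symmetric] Const_mult[symmetric] by simp
      then show ?thesis using rho by (metis Const_eq_0_iff mult_left_cancel)
    qed
    have sr: "sym_tensor 3 2 (q - r0 q)"
    proof (intro sym_tensor_diff q2)
      have "sym_tensor 3 (2 * 1) (?y ^ 2)" unfolding y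
        by (intro sym_tensor_power sym_tensor_add sym_tensor_Const_mult sym_tensor_Var) simp_all
      then show "sym_tensor 3 2 (r0 q)" unfolding r0q by (intro sym_tensor_Const_mult) simp
    qed
    have rr: "r0 (q - r0 q) = 0"
      by (rule poly_mapping_eqI) (simp add: lookup_r0 lookup_minus)
    obtain h where h: "q - r0 q = Var 0 * h" "sym_tensor 3 (2 - 1) h" using r0_eq_0_divide[OF sr rr] by auto
    have "sym_tensor 3 1 h" using h(2) by (simp add: One_nat_def)
    then obtain b where b: "h = lform 3 b" using sym_tensor_1_lform by blast
    obtain z where z: "z ^ 2 = \<kappa>" using complex_root_exists[of 2] by auto
    define R where "R = mat 3 3 (\<lambda>(i, j). if i = 0 then (if j = 0 then 1 else 0)
      else if i = 1 then (if j = 0 then 0 else if j = 1 then z * C $$ (1, 1) else z * C $$ (1, 2)) else b j)"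
    have R: "lin_subst 3 R (Var 0) = Var 0" "lin_subst 3 R (Var 1) = Const z * ?y" "lin_subst 3 R (Var 2) = h"
      unfolding y b by (simp_all add: LS_Var lform_3 R_def Const_mult algebra_simps)
    have "q = Var 0 * h + Const (z ^ 2) * ?y ^ 2" using h(1) r0q unfolding z by (simp add: algebra_simps)
    then have "f = Var 0 ^ (n - 2) * (Var 0 * h + (Const z * ?y) ^ 2)"
      unfolding q(1) by (simp add: power_mult_distrib Const.hom_power)
    moreover have "n - 1 = Suc (n - 2)" using n by simp
    ultimately have "f = lin_subst 3 R (nf 3 n)"
      by (simp add: nf_def LS.hom_add LS.hom_mult LS.hom_power R algebra_simps)
    moreover have "R \<in> carrier_mat 3 3" by (simp add: R_def)
    ultimately show ?thesis unfolding d3 by blast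
  qed
  then obtain R where R: "R \<in> carrier_mat d d" "f = lin_subst d R (nf d n)" by blast
  have "det R \<noteq> 0" using concise_LS[OF R(1)] conc R(2) by blast
  then show ?thesis using R unfolding GL_equiv_iff by blast
qed

text \<open>
  In the induction step coordinates are changed so that one derivative outside the hyperplane is the normal form itself.\<close>
lemma persistent_imp_power:
  assumes d: "d = 2 \<or> d = 3"
  shows "2 \<le> n \<Longrightarrow> persistent d n f \<Longrightarrow> power_of_linear_form d (d * (n - 2)) (Hess d f)"
proof (induction n arbitrary: f rule: dec_induct)
  case base
  then obtain c where "c \<noteq> 0" "Hess d f = Const c" using persistent_2_iff[OF persistent_sym_tensor[OF base]] by blast
  moreover have "sym_tensor d 1 (Var 0)" using d by (intro sym_tensor_Var) auto
  ultimately show ?case unfolding power_of_linear_form_iff by (intro exI[of _ "Var 0"] exI[of _ c]) simp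
next
  case (step n)
  have f: "sym_tensor d (Suc n) f" using persistent_sym_tensor[OF step.prems] .
  show ?case
  proof (cases "n = 2")
    case True
    then show ?thesis using step.prems f persistent_3_iff[of d f] by (simp add: numeral_3_eq_3[symmetric] flip: numeral_2_eq_2)
  next
    case False
    then have n: "4 \<le> Suc n" "3 \<le> n" using step.hyps by auto
    obtain S where S: "concise d f" "hyperplane d S" "\<And>u. u \<in> carrier_vec d - S \<Longrightarrow> persistent d n (dir_deriv d u f)"
      using step.prems persistent_Suc_iff[OF step.hyps(1)] by blast
    obtain a where a: "a \<in> carrier_vec d" "a \<noteq> 0\<^sub>v d" "S \<subseteq> ann d a" using hyperplane_subset_ann[OF S(2)] .
    have P: "GL_equiv d (dir_deriv d w f) (nf d n)" if w: "w \<in> carrier_vec d" "a \<bullet> w \<noteq> 0" for w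
    proof -
      have "persistent d n (dir_deriv d w f)" using S(3)[of w] w a(3) by (auto simp: ann_def)
      then show ?thesis using GL_equiv_nf_iff_power[OF d step.hyps(1) persistent_sym_tensor] step.IH by blast
    qed
    obtain k where k: "k < d" "a $ k \<noteq> 0" using a
      by (metis carrier_vecD eq_vecI index_zero_vec(1) index_zero_vec(2))
    define u :: "complex vec" where "u = unit_vec d k"
    have u: "u \<in> carrier_vec d" "a \<bullet> u \<noteq> 0" using k a by (auto simp: u_def)
    obtain A where A: "A \<in> carrier_mat d d" "det A \<noteq> 0" "dir_deriv d u f = lin_subst d A (nf d n)"
      using P[OF u] GL_equiv_iff by blast
    obtain B where B: "B \<in> carrier_mat d d" "A * B = 1\<^sub>m d" "B * A = 1\<^sub>m d" "det B \<noteq> 0" using ex_inverse[OF A(1,2)] by blast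
    let ?g = "lin_subst d B f"
    let ?v = "A *\<^sub>v u"
    let ?b = "B\<^sup>T *\<^sub>v a"
    have v: "?v \<in> carrier_vec d" using A u by simp
    have b: "?b \<in> carrier_vec d" using B a by simp
    have ad: "?b \<bullet> w = a \<bullet> (B *\<^sub>v w)" if "w \<in> carrier_vec d" for w
      using transpose_vec_mult_scalar[OF B(1) that a(1)] a(1) B(1) that
      by (metis comm_scalar_prod mult_mat_vec_carrier transpose_carrier_mat)
    have Bv: "B *\<^sub>v ?v = u" using A(1) B(1,3) u(1) by (metis assoc_mult_mat_vec one_mult_mat_vec)
    have "GL_equiv d ?g (nf d (Suc n))"
    proof (rule normal_direction_imp_nf[OF d n(1) sym_tensor_LS[OF f] _ v _ b])
      show "concise d ?g"
        unfolding concise_iff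
      proof (intro ballI impI)
        fix w assume w: "w \<in> carrier_vec d" "dir_deriv d w ?g = 0"
        then have "lin_subst d B (dir_deriv d (B *\<^sub>v w) f) = 0" by (simp add: dir_deriv_LS[OF B(1)])
        then have "dir_deriv d (B *\<^sub>v w) f = 0" using LS_eq_0_iff[OF B(1,4) sym_tensor_dir_deriv[OF f]] by simp
        then have "B *\<^sub>v w = 0\<^sub>v d" using S(1) B(1) w(1) unfolding concise_iff by simp
        then show "w = 0\<^sub>v d" using det_0_iff_vec_prod_zero_field[OF B(1)] B(4) w(1) by blast
      qed
      show "dir_deriv d ?v ?g = nf d (Suc n - 1)"
        unfolding dir_deriv_LS[OF B(1) v] Bv A(3)
        using LS_inverse[OF A(1) B(1,2) sym_tensor_nf[OF d step.hyps(1)]] by simp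
      show "?b \<bullet> ?v \<noteq> 0" unfolding ad[OF v] Bv by (rule u(2))
      fix w assume w: "w \<in> carrier_vec d" "?b \<bullet> w \<noteq> 0"
      have "GL_equiv d (dir_deriv d (B *\<^sub>v w) f) (nf d n)" using w B(1) ad by (intro P) auto
      then show "GL_equiv d (dir_deriv d w ?g) (nf d (Suc n - 1))"
        unfolding dir_deriv_LS[OF B(1) w(1)] using GL_equiv_LS B by simp
    qed
    then have "GL_equiv d f (nf d (Suc n))" using GL_equiv_LS_cancel B f by blast
    then show ?thesis using step.hyps by (intro GL_equiv_nf_imp_power d) auto
  qed
qed

section \<open>One variable\<close>

text \<open>
  In one variable all statements concern the monomials \<open>c x_0^n\<close>.\<close>
lemma sym_tensor_1_monomial: assumes "sym_tensor 1 n f" obtains c where "f = Const c * Var 0 ^ n"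
proof -
  have "n \<le> lk m 0" if "m \<in> supp f" for m
    using sym_tensorD(2)[OF assms that] by (simp add: One_nat_def)
  then obtain g where g: "f = Var 0 ^ n * g" "sym_tensor 1 (n - n) g"
    using divide_Var0_power[OF assms, of n] by auto
  then have "g = Const (lk g 0)" using sym_tensor_0D[of 1 g] by simp
  then show ?thesis using g(1) that[of "lk g 0"] by (simp add: mult.commute)
qed

lemma Hess_1_monomial: "Hess 1 (Const c * Var 0 ^ n) = Const (c * of_nat n * of_nat (n - 1)) * Var 0 ^ (n - 2)"
proof -
  have "n - 1 - 1 = n - 2" by simp
  then show ?thesis
    by (simp add: Hess_def det_mat_1 partial_Const_mult partial_Var_power partial_mult Const_mult Const.hom_of_nat mult.assoc del: of_nat_diff)
qed

lemma univariate_power_iff: assumes "2 \<le> n"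
  shows "power_of_linear_form 1 (1 * (n - 2)) (Hess 1 (Const c * Var 0 ^ n)) \<longleftrightarrow> c \<noteq> 0"
proof
  assume "power_of_linear_form 1 (1 * (n - 2)) (Hess 1 (Const c * Var 0 ^ n))"
  then have "Hess 1 (Const c * Var 0 ^ n) \<noteq> 0" unfolding power_of_linear_form_iff by auto
  then show "c \<noteq> 0" unfolding Hess_1_monomial by auto
next
  assume c: "c \<noteq> 0"
  have "c * of_nat n * of_nat (n - 1) \<noteq> 0" using c assms by (simp del: of_nat_diff)
  then show "power_of_linear_form 1 (1 * (n - 2)) (Hess 1 (Const c * Var 0 ^ n))"
    unfolding power_of_linear_form_iff Hess_1_monomial using sym_tensor_Var[of 0 1]
    by (intro exI[of _ "Var 0"] exI[of _ "c * of_nat n * of_nat (n - 1)"]) simp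
qed

lemma univariate_persistent_iff: "2 \<le> n \<Longrightarrow> persistent 1 n (Const c * Var 0 ^ n) \<longleftrightarrow> c \<noteq> 0"
proof (induction n arbitrary: c rule: dec_induct)
  case base
  have "sym_tensor 1 2 (Const c * Var 0 ^ 2)"
    using sym_tensor_Const_mult[OF sym_tensor_power[OF sym_tensor_Var[of 0 1], of 2]] by simp
  then show ?case by (subst persistent_2_iff) (simp_all add: Hess_1_monomial)
next
  case (step n)
  have f: "sym_tensor 1 (Suc n) (Const d * Var 0 ^ Suc n)" for d
    using sym_tensor_Const_mult[OF sym_tensor_power[OF sym_tensor_Var[of 0 1], of "Suc n"]] by simp
  have D: "dir_deriv 1 u (Const c * Var 0 ^ Suc n) = Const (u $ 0 * c * of_nat (Suc n)) * Var 0 ^ n" for u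
    unfolding dir_deriv_def partial_Const_mult partial_Var_power
    by (simp add: One_nat_def Const_mult Const.hom_of_nat mult.assoc del: of_nat_Suc)
  show ?case
  proof
    assume p: "persistent 1 (Suc n) (Const c * Var 0 ^ Suc n)"
    then have conc: "concise 1 (Const c * Var 0 ^ Suc n)" using persistent_Suc_iff[OF step.hyps(1)] by blast
    show "c \<noteq> 0"
    proof
      assume "c = 0"
      then have "(unit_vec 1 0 :: complex vec) = 0\<^sub>v 1" using conc unfolding concise_iff D by auto
      from arg_cong[OF this, of "\<lambda>v. v $ 0"] show False by simp
    qed
  next
    assume c: "c \<noteq> 0"
    have "c * of_nat (Suc n) * of_nat (Suc n - 1) \<noteq> 0" using c step.hyps by (simp del: of_nat_Suc)
    then have "Hess 1 (Const c * Var 0 ^ Suc n) \<noteq> 0" unfolding Hess_1_monomial by (simp del: of_nat_Suc)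
    then have conc: "concise 1 (Const c * Var 0 ^ Suc n)" by (rule Hess_concise)
    let ?a = "unit_vec 1 0 :: complex vec"
    have "?a \<noteq> 0\<^sub>v 1" by (auto dest: arg_cong[of _ _ "\<lambda>v. v $ 0"])
    then have hyp: "hyperplane 1 (ann 1 ?a)" by (intro hyperplane_ann) auto
    have "persistent 1 n (dir_deriv 1 u (Const c * Var 0 ^ Suc n))" if u: "u \<in> carrier_vec 1 - ann 1 ?a" for u
    proof -
      have "u $ 0 \<noteq> 0" using u by (auto simp: ann_def)
      then show ?thesis unfolding D using step.IH c by (simp del: of_nat_Suc)
    qed
    then show "persistent 1 (Suc n) (Const c * Var 0 ^ Suc n)"
      using persistent_Suc_iff[OF step.hyps(1)] f conc hyp by blast
  qed
qed

section \<open>Isobaric normal forms\<close>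

text \<open>
  Isobaric weight without the homogeneity clause; the zero polynomial has every weight.\<close>
definition has_weight :: "nat \<Rightarrow> nat \<Rightarrow> cpoly \<Rightarrow> bool" where
  "has_weight d \<delta> f \<longleftrightarrow> (\<forall>m\<in>supp f. (\<Sum>j<d. j * lk m j) = \<delta>)"

lemma has_weight_add: "has_weight d \<delta> f \<Longrightarrow> has_weight d \<delta> g \<Longrightarrow> has_weight d \<delta> (f + g)"
  unfolding has_weight_def using Poly_Mapping.keys_add[of f g] by blast

lemma has_weight_mult: assumes "has_weight d a f" "has_weight d b g" shows "has_weight d (a + b) (f * g)"
  unfolding has_weight_def
proof
  fix m assume "m \<in> supp (f * g)"
  then obtain p q where pq: "m = p + q" "p \<in> supp f" "q \<in> supp g"
    using Poly_Mapping.keys_mult[of f g] by auto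
  then show "(\<Sum>j<d. j * lk m j) = a + b"
    using assms by (simp add: has_weight_def lookup_add distrib_left sum.distrib)
qed

lemma has_weight_Const: "has_weight d 0 (Const a)" by (auto simp: has_weight_def Const_def split: if_splits)

lemma has_weight_Var: "i < d \<Longrightarrow> has_weight d i (Var i)"
  by (simp add: has_weight_def Var_def lookup_single when_def if_distrib sum.delta cong: if_cong)

lemma has_weight_power: "has_weight d a f \<Longrightarrow> has_weight d (k * a) (f ^ k)"
  by (induction k) (use has_weight_Const[of d 1] in \<open>auto intro: has_weight_mult\<close>)

lemma isobaric_nf: assumes "d = 2 \<or> d = 3" "2 \<le> n" shows "isobaric d (d - 1) (nf d n)"
proof -
  have 2: "has_weight 2 1 (Var 0 ^ (n - 1) * Var 1)"
    using has_weight_mult[OF has_weight_power[OF has_weight_Var[of 0 2]] has_weight_Var[of 1 2]] by simp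
  have 3: "has_weight 3 2 (Var 0 ^ (n - 1) * Var 2 + Var 0 ^ (n - 2) * Var 1 ^ 2)"
    using has_weight_mult[OF has_weight_power[OF has_weight_Var[of 0 3]] has_weight_Var[of 2 3]]
      has_weight_mult[OF has_weight_power[OF has_weight_Var[of 0 3]] has_weight_power[OF has_weight_Var[of 1 3], of 2]]
    by (intro has_weight_add) (simp_all add: numeral_2_eq_2)
  have "has_weight d (d - 1) (nf d n)" using assms(1)
  proof
    assume d: "d = 2" have "(2::nat) - 1 = 1" by simp
    then show ?thesis using 2 by (simp only: d nf_def) simp
  next
    assume d: "d = 3"
    have "(3::nat) - 1 = 2" by simp
    then show ?thesis using 3 by (simp only: d nf_def) simp
  qed
  then show ?thesis using sym_tensor_nf[OF assms] unfolding isobaric_def has_weight_def by blast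
qed

section \<open>The quaternary normal form\<close>

definition nf4 :: "complex \<Rightarrow> complex \<Rightarrow> complex \<Rightarrow> cpoly" where
  "nf4 a b c = Const a * Var 0 ^ 2 * Var 3 + Const b * Var 0 * Var 1 * Var 2 + Const c * Var 1 ^ 3"

lemma sym_tensor_nf4: "sym_tensor 4 3 (nf4 a b c)"
proof -
  have "sym_tensor 4 (0 + 2 * 1 + 1) (Const a * Var 0 ^ 2 * Var 3)" "sym_tensor 4 (0 + 1 + 1 + 1) (Const b * Var 0 * Var 1 * Var 2)"
    "sym_tensor 4 (0 + 3 * 1) (Const c * Var 1 ^ 3)"
    by (intro sym_tensor_mult sym_tensor_power sym_tensor_Var sym_tensor_Const; simp)+
  then show ?thesis unfolding nf4_def by (intro sym_tensor_add) simp_all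
qed

lemma isobaric_nf4: "isobaric 4 3 (nf4 a b c)"
proof -
  have "has_weight 4 (0 + 2 * 0 + 3) (Const a * Var 0 ^ 2 * Var 3)" "has_weight 4 (0 + 0 + 1 + 2) (Const b * Var 0 * Var 1 * Var 2)"
    "has_weight 4 (0 + 3 * 1) (Const c * Var 1 ^ 3)"
    by (intro has_weight_mult has_weight_power has_weight_Var has_weight_Const; simp)+
  then have "has_weight 4 3 (nf4 a b c)" unfolding nf4_def by (intro has_weight_add) simp_all
  then show ?thesis using sym_tensor_nf4 unfolding isobaric_def has_weight_def by blast
qed

lemma Hess_nf4: "Hess 4 (nf4 a b c) = Const (4 * a ^ 2 * b ^ 2) * Var 0 ^ 4"
proof -
  have "Hess 4 (nf4 a b c) = (2 * Const a * Var 0) ^ 2 * (Const b * Var 0) ^ 2"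
    unfolding Hess_def det_mat_4 nf4_def
    by (simp add: partial_add partial_mult partial_Var_power partial_Var power2_eq_square ac_simps)
  then show ?thesis
    by (simp add: Const_mult Const.hom_power Const.hom_numeral power_mult_distrib power_add[symmetric] mult.assoc mult.left_commute)
qed

lemma GL_equiv_nf4_imp_power:
  assumes "a * b \<noteq> 0" "GL_equiv 4 f (nf4 a b c)" shows "power_of_linear_form 4 4 (Hess 4 f)"
proof -
  obtain A where A: "A \<in> carrier_mat 4 4" "det A \<noteq> 0" "f = lin_subst 4 A (nf4 a b c)"
    using assms(2) GL_equiv_iff by blast
  have "Hess 4 f = Const (det A ^ 2 * (4 * a ^ 2 * b ^ 2)) * lform 4 (\<lambda>j. A $$ (0, j)) ^ 4"
    by (simp add: A(3) Hess_LS[OF A(1)] Hess_nf4 LS.hom_mult LS.hom_power LS_Var Const_mult mult.assoc)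
  moreover have "det A ^ 2 * (4 * a ^ 2 * b ^ 2) \<noteq> 0" using A assms(1) by simp
  ultimately show ?thesis unfolding power_of_linear_form_iff
    using row_neq_0[OF A(1,2), of 0] sym_tensor_lform
    by (intro exI[of _ "lform 4 (\<lambda>j. A $$ (0, j))"] exI[of _ "det A ^ 2 * (4 * a ^ 2 * b ^ 2)"]) simp
qed

section \<open>The third-derivative tensor of a cubic\<close>

text \<open>
  For a cubic these are the entries of the symmetric tensor of constant third derivatives.\<close>
definition third_deriv :: "cpoly \<Rightarrow> nat \<Rightarrow> nat \<Rightarrow> nat \<Rightarrow> complex" where
  "third_deriv f i j k = lk (partial i (partial j (partial k f))) 0"

lemma third_deriv_sym: "third_deriv f i j k = third_deriv f j i k" "third_deriv f i j k = third_deriv f i k j"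
proof -
  show "third_deriv f i j k = third_deriv f j i k" unfolding third_deriv_def by (subst partial_commute) (rule refl)
  show "third_deriv f i j k = third_deriv f i k j" unfolding third_deriv_def by (subst partial_commute[of j k]) (rule refl)
qed

lemma partial3_cubic: assumes "sym_tensor d 3 f"
  shows "partial i (partial j (partial k f)) = Const (third_deriv f i j k)"
proof -
  have "sym_tensor d (3 - 1 - 1 - 1) (partial i (partial j (partial k f)))"
    by (intro sym_tensor_partial assms)
  then show ?thesis using sym_tensor_0D unfolding third_deriv_def by simp
qed

lemma partial2_cubic: assumes f: "sym_tensor d 3 f"
  shows "partial i (partial j f) = lform d (\<lambda>k. third_deriv f k i j)"
proof -
  have "sym_tensor d (3 - 1 - 1) (partial i (partial j f))" by (intro sym_tensor_partial f)
  then have "sym_tensor d 1 (partial i (partial j f))" by (simp add: One_nat_def)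
  from euler[OF this] show ?thesis by (simp add: partial3_cubic[OF f] lform_def mult.commute)
qed

lemma ev_cubic: assumes f: "sym_tensor d 3 f"
  shows "6 * ev x f = (\<Sum>i<d. \<Sum>j<d. \<Sum>k<d. third_deriv f k j i * x i * x j * x k)"
proof -
  have 1: "3 * ev x f = (\<Sum>i<d. x i * ev x (partial i f))"
    using arg_cong[OF euler[OF f], of "ev x"] by (simp add: ev.hom_sum ev.hom_mult ev.hom_numeral)
  have 2: "2 * ev x (partial i f) = (\<Sum>j<d. x j * ev x (partial j (partial i f)))" for i
    using arg_cong[OF euler[OF sym_tensor_partial[OF f, of i]], of "ev x"] by (simp add: ev.hom_sum ev.hom_mult ev.hom_numeral)
  have "6 * ev x f = 2 * (3 * ev x f)" by simp
  also have "\<dots> = (\<Sum>i<d. x i * (2 * ev x (partial i f)))" unfolding 1 by (simp add: sum_distrib_left mult.left_commute)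
  also have "\<dots> = (\<Sum>i<d. x i * (\<Sum>j<d. x j * (\<Sum>k<d. third_deriv f k j i * x k)))"
    unfolding 2 partial2_cubic[OF f] ev_lform ..
  finally show ?thesis by (simp add: sum_distrib_left mult.assoc mult.left_commute)
qed

lemma ev_Hess_cubic: assumes f: "sym_tensor d 3 f"
  shows "ev x (Hess d f) = det (mat d d (\<lambda>(i, j). \<Sum>k<d. third_deriv f k i j * x k))"
proof -
  have "map_mat (ev x) (hess_mat d f) = mat d d (\<lambda>(i, j). \<Sum>k<d. third_deriv f k i j * x k)"
    by (rule eq_matI) (auto simp: hess_mat_def partial2_cubic[OF f] ev_lform)
  then show ?thesis by (metis Hess_det ev.hom_det)
qed

lemma third_deriv_LS: assumes f: "sym_tensor d 3 f" and ijk: "i < d" "j < d" "k < d"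
  shows "third_deriv (lin_subst d P f) i j k = (\<Sum>a<d. \<Sum>b<d. \<Sum>c<d. P $$ (a, k) * P $$ (b, j) * P $$ (c, i) * third_deriv f c b a)"
proof -
  have "partial i (partial j (partial k (lin_subst d P f)))
    = (\<Sum>a<d. \<Sum>b<d. \<Sum>c<d. Const (P $$ (a, k)) * (Const (P $$ (b, j)) * (Const (P $$ (c, i)) * Const (third_deriv f c b a))))"
    using ijk by (simp add: chain_rule partial_sum partial_Const_mult sum_distrib_left partial3_cubic[OF f])
  then show ?thesis
    unfolding third_deriv_def[of "lin_subst d P f"] by (simp add: lookup_sum lookup_Const mult.assoc flip: Const_mult)
qed

section \<open>Nilpotent matrices\<close>

text \<open>
  By Schur's theorem the matrix is similar to an upper triangular one, whose diagonal consists of the roots of the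
  characteristic polynomial \<open>z^n\<close>; a strictly triangular matrix moves the diagonal up by one with every factor.\<close>
lemma nilpotent_of_char_poly:
  fixes N :: "complex mat"
  assumes N: "N \<in> carrier_mat n n" and d: "\<And>z. det (z \<cdot>\<^sub>m 1\<^sub>m n - N) = z ^ n"
  shows "N ^\<^sub>m n = 0\<^sub>m n n"
proof -
  have cp: "char_poly N = monom 1 n"
  proof (rule poly_eq_poly_eq_iff[THEN iffD1], rule ext)
    fix z
    have "poly (char_poly N) z = det (z \<cdot>\<^sub>m 1\<^sub>m n - N)"
      unfolding char_poly_def by (rule poly_det_cong[of _ n]) (use N in \<open>auto simp: char_poly_matrix_def\<close>)
    then show "poly (char_poly N) z = poly (monom 1 n) z" by (simp add: d poly_monom)
  qed
  have "(\<Prod>a\<leftarrow>replicate m (0::complex). [:- a, 1:]) = monom 1 m" for m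
    by (induction m) (simp_all add: monom_Suc monom_0 flip: one_pCons)
  then have cp': "char_poly N = (\<Prod>a\<leftarrow>replicate n 0. [:- a, 1:])" using cp by simp
  obtain B P Q where sd: "schur_decomposition N (replicate n 0) = (B, P, Q)" by (metis prod_cases3)
  have S: "similar_mat_wit N B P Q" "upper_triangular B" "diag_mat B = replicate n 0"
    using schur_decomposition[OF N cp' sd] by auto
  have BPQ: "B \<in> carrier_mat n n" "P \<in> carrier_mat n n" "Q \<in> carrier_mat n n"
    using S(1) N unfolding similar_mat_wit_def Let_def by auto
  have B0: "B $$ (i, j) = 0" if "i < n" "j < n" "j < i + 1" for i j
  proof (cases "i = j")
    case True
    then have "B $$ (i, j) = diag_mat B ! i" using that BPQ by (simp add: diag_mat_def)
    then show ?thesis using S(3) that by simp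
  next
    case False
    then show ?thesis using S(2) that BPQ(1) by (auto simp: upper_triangular_def)
  qed
  have pow: "(B ^\<^sub>m k) $$ (i, j) = 0" if "i < n" "j < n" "j < i + k" for i j k
    using that
  proof (induction k arbitrary: i j)
    case (Suc k)
    have Bk: "B ^\<^sub>m k \<in> carrier_mat n n" using BPQ by simp
    have "(B ^\<^sub>m Suc k) $$ (i, j) = (\<Sum>l = 0..<n. (B ^\<^sub>m k) $$ (i, l) * B $$ (l, j))"
      using Suc.prems Bk BPQ(1) by (simp add: scalar_prod_def)
    also have "\<dots> = 0"
    proof (rule sum.neutral, rule ballI)
      fix l assume l: "l \<in> {0..<n}"
      show "(B ^\<^sub>m k) $$ (i, l) * B $$ (l, j) = 0"
      proof (cases "l < i + k")
        case True
        then show ?thesis using Suc.IH[of i l] l Suc.prems by simp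
      next
        case False
        then show ?thesis using B0[of l j] l Suc.prems by simp
      qed
    qed
    finally show ?case .
  qed (use BPQ in auto)
  have "B ^\<^sub>m n = 0\<^sub>m n n" by (rule eq_matI) (use BPQ pow in auto)
  then show ?thesis using similar_mat_wit_pow_id[OF S(1), of n] BPQ by simp
qed

section \<open>Hankel cubics\<close>

lemma sum_lessThan_4: "(\<Sum>i<4. F i) = F 0 + F 1 + F 2 + (F (3::nat) :: 'a::comm_monoid_add)"
proof -
  have "{..<4::nat} = {0, 1, 2, 3}" by auto
  then show ?thesis by (simp add: add.assoc)
qed

text \<open>
  The pattern of the Hessian matrix of a Hankel cubic.\<close>
lemma det_Hankel_pattern:
  fixes H :: "nat \<Rightarrow> nat \<Rightarrow> complex"
  assumes "H 1 0 = H 0 1" "H 2 0 = H 0 2" "H 3 0 = H 0 3" "H 1 1 = H 0 2" "H 1 2 = H 0 3" "H 2 1 = H 0 3"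
    "H 1 3 = 0" "H 3 1 = 0" "H 3 2 = H 2 3"
  shows "det (mat 4 4 (\<lambda>(i, j). H i j)) =
      H 3 3 * (H 0 0 * H 0 2 * H 2 2 - H 0 0 * H 0 3 ^ 2 - H 0 1 ^ 2 * H 2 2 + 2 * H 0 1 * H 0 2 * H 0 3 - H 0 2 ^ 3)
      - H 2 3 ^ 2 * (H 0 0 * H 0 2 - H 0 1 ^ 2) + 2 * H 2 3 * H 0 3 * (H 0 2 ^ 2 - H 0 1 * H 0 3)
      - H 0 3 ^ 2 * (H 0 2 * H 2 2 - H 0 3 ^ 2)"
  by (simp add: det_mat_4 assms power2_eq_square power3_eq_cube algebra_simps)

text \<open>
  The tensor entries with an index 0 or 1 are moments \<open>m (i + j + k)\<close>; the entries \<open>k1, ..., k4\<close> with indices in \<open>{2, 3}\<close> are unknown.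
  The Hessian does not depend on \<open>x_1\<close>. Its \<open>x_1\<^sup>3\<close>-coefficient on \<open>x_0 = 0\<close> contains only \<open>k3\<close> and \<open>k4\<close>, which therefore vanish; then a difference
  on \<open>x_0 = 0\<close> isolates \<open>k2\<close>, and one at \<open>x_0 = 1\<close> isolates \<open>k1\<close>. The form that is left is the normal form in
  suitable linear combinations of the variables.\<close>
lemma Hankel_cubic_GL_equiv:
  assumes g: "sym_tensor 4 3 g"
    and t0: "\<And>j k. j < 4 \<Longrightarrow> k < 4 \<Longrightarrow> third_deriv g 0 j k = m (j + k)"
    and t1: "\<And>j k. j < 4 \<Longrightarrow> k < 4 \<Longrightarrow> third_deriv g 1 j k = m (j + k + 1)"
    and m: "\<And>k. 4 \<le> k \<Longrightarrow> m k = 0" "m 3 \<noteq> 0"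
    and H: "\<And>x. ev x (Hess 4 g) = C * (x 0 + a * x 2 + e * x 3) ^ 4"
  shows "GL_equiv 4 g (nf4 1 1 (m 3 / 6))" "C \<noteq> 0"
proof -
  have m0: "m 4 = 0" "m 5 = 0" "m 6 = 0" "m 7 = 0" by (simp_all add: m)
  define k1 k2 k3 k4 where k: "k1 = third_deriv g 2 2 2" "k2 = third_deriv g 2 2 3" "k3 = third_deriv g 2 3 3" "k4 = third_deriv g 3 3 3"
  have T0: "third_deriv g 0 i j = m (i + j)" "third_deriv g i 0 j = m (i + j)" "third_deriv g i j 0 = m (i + j)"
   and T1: "third_deriv g 1 i j = m (i + j + 1)" "third_deriv g i 1 j = m (i + j + 1)" "third_deriv g i j 1 = m (i + j + 1)"
    if "i < 4" "j < 4" for i j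
    using t0[OF that] t1[OF that] third_deriv_sym[of g] by metis+
  have target2: "third_deriv g 2 2 2 = k1" "third_deriv g 2 2 3 = k2" "third_deriv g 2 3 2 = k2" "third_deriv g 3 2 2 = k2" "third_deriv g 2 3 3 = k3" "third_deriv g 3 2 3 = k3" "third_deriv g 3 3 2 = k3" "third_deriv g 3 3 3 = k4"
    unfolding k using third_deriv_sym[of g] by metis+
  define h where "h x i j = (\<Sum>k<4. third_deriv g k i j * x k)" for x i j
  have hs: "h x 0 0 = m 0 * x 0 + m 1 * x 1 + m 2 * x 2 + m 3 * x 3"
    "h x 0 1 = m 1 * x 0 + m 2 * x 1 + m 3 * x 2" "h x 1 0 = m 1 * x 0 + m 2 * x 1 + m 3 * x 2"
    "h x 0 2 = m 2 * x 0 + m 3 * x 1" "h x 2 0 = m 2 * x 0 + m 3 * x 1" "h x 1 1 = m 2 * x 0 + m 3 * x 1"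
    "h x 0 3 = m 3 * x 0" "h x 3 0 = m 3 * x 0" "h x 1 2 = m 3 * x 0" "h x 2 1 = m 3 * x 0"
    "h x 1 3 = 0" "h x 3 1 = 0"
    "h x 2 2 = k1 * x 2 + k2 * x 3" "h x 2 3 = k2 * x 2 + k3 * x 3" "h x 3 2 = k2 * x 2 + k3 * x 3" "h x 3 3 = k3 * x 2 + k4 * x 3" for x
    by (simp_all add: h_def sum_lessThan_4 T0 T1 target2 m0 flip: numeral_2_eq_2)
  define E where "E x0 x1 x2 x3 = ev (\<lambda>i. [x0, x1, x2, x3] ! i) (Hess 4 g)" for x0 x1 x2 x3
  have n: "[x0, x1, x2, x3] ! 0 = x0" "[x0, x1, x2, x3] ! 1 = x1" "[x0, x1, x2, x3] ! 2 = x2" "[x0, x1, x2, x3] ! 3 = x3"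
    for x0 x1 x2 x3 :: complex by (simp_all add: One_nat_def numeral_2_eq_2 numeral_3_eq_3)
  have EH: "E x0 x1 x2 x3 = C * (x0 + a * x2 + e * x3) ^ 4" for x0 x1 x2 x3
    unfolding E_def H n ..
  have ind: "E x0 s x2 x3 = E x0 t x2 x3" for x0 s t x2 x3 unfolding EH ..
  have ED: "E x0 x1 x2 x3 = det (mat 4 4 (\<lambda>(i, j). h (\<lambda>i. [x0, x1, x2, x3] ! i) i j))" for x0 x1 x2 x3
    unfolding E_def ev_Hess_cubic[OF g] h_def ..
  have Ef: "E x0 x1 x2 x3 =
    (let a = m 0 * x0 + m 1 * x1 + m 2 * x2 + m 3 * x3; b = m 1 * x0 + m 2 * x1 + m 3 * x2; c = m 2 * x0 + m 3 * x1; d = m 3 * x0;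
       p = k1 * x2 + k2 * x3; q = k2 * x2 + k3 * x3; r = k3 * x2 + k4 * x3
     in r * (a * c * p - a * d ^ 2 - b ^ 2 * p + 2 * b * c * d - c ^ 3) - q ^ 2 * (a * c - b ^ 2)
        + 2 * q * d * (c ^ 2 - b * d) - d ^ 2 * (c * p - d ^ 2))" for x0 x1 x2 x3
    unfolding ED by (subst det_Hankel_pattern) (simp_all only: hs n Let_def)
  show C: "C \<noteq> 0"
  proof -
    have "E 1 0 0 0 = m 3 ^ 4" unfolding Ef Let_def by (simp flip: power_add)
    then show ?thesis using m(2) EH[of 1 0 0 0] by auto
  qed
  have E0: "E 0 t x2 x3 = (k3 * x2 + k4 * x3) * ((m 1 * t + (m 2 * x2 + m 3 * x3)) * (m 3 * t) * (k1 * x2 + k2 * x3)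
      - (m 2 * t + m 3 * x2) ^ 2 * (k1 * x2 + k2 * x3) - (m 3 * t) ^ 3)
      - (k2 * x2 + k3 * x3) ^ 2 * ((m 1 * t + (m 2 * x2 + m 3 * x3)) * (m 3 * t) - (m 2 * t + m 3 * x2) ^ 2)" for t x2 x3
    unfolding Ef Let_def by (simp add: add.assoc)
  have k34: "k3 * x2 + k4 * x3 = 0" for x2 x3
  proof -
    have third_difference: "F 2 - F (- 2) - 2 * (F 1 - F (- 1)) = - 12 * l ^ 3 * r"
      if "\<And>t. F t = r * ((i * t + a) * (l * t) * p - (j * t + b) ^ 2 * p - (l * t) ^ 3) - q ^ 2 * ((i * t + a) * (l * t) - (j * t + b) ^ 2)"
      for F :: "complex \<Rightarrow> complex" and i j l a b p q r
      unfolding that by (simp add: power2_eq_square power3_eq_cube algebra_simps)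
    have "- 12 * m 3 ^ 3 * (k3 * x2 + k4 * x3) = 0"
      unfolding third_difference[of "\<lambda>t. E 0 t x2 x3", OF E0, symmetric] EH by simp
    then show ?thesis using m(2) by simp
  qed
  have k34: "k3 = 0" "k4 = 0" using k34[of 1 0] k34[of 0 1] by simp_all
  have k2: "k2 = 0"
  proof -
    (* With this value of x_3 the linear coefficient in x_1 does not involve m 2. *)
    define z where "z = m 2 / m 3 + 1"
    have z: "m 2 + m 3 * z = 2 * m 2 + m 3" using m(2) by (simp add: z_def field_simps)
    have "2 * k2 ^ 2 * m 3 ^ 2 = - (E 0 1 1 z - E 0 (- 1) 1 z)"
      unfolding E0 k34 mult_1_right mult_zero_left add_0_right z by (simp add: power2_eq_square algebra_simps)
    also have "\<dots> = 0" unfolding EH by simp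
    finally show ?thesis using m(2) by simp
  qed
  have k1: "k1 = 0"
  proof -
    have "m 3 ^ 3 * k1 = - (E 1 1 1 0 - E 1 0 1 0)"
      unfolding Ef Let_def k34 k2 by (simp add: power2_eq_square power3_eq_cube algebra_simps)
    also have "\<dots> = 0" unfolding EH by simp
    finally show ?thesis using m(2) by simp
  qed
  define R where "R = mat 4 4 (\<lambda>(i::nat, j::nat). [[1, 0, 0, 0], [0, 1, 0, 0], [0, m 2 / 2, m 3, 0], [m 0 / 6, m 1 / 2, m 2 / 2, m 3 / 2]] ! i ! j)"
  have R: "R \<in> carrier_mat 4 4" by (simp add: R_def)
  have "g = lin_subst 4 R (nf4 1 1 (m 3 / 6))"
  proof (rule ev_inj)
    fix x
    have r: "(\<Sum>j<4. R $$ (0, j) * x j) = x 0" "(\<Sum>j<4. R $$ (1, j) * x j) = x 1"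
      "(\<Sum>j<4. R $$ (2, j) * x j) = m 2 / 2 * x 1 + m 3 * x 2"
      "(\<Sum>j<4. R $$ (3, j) * x j) = m 0 / 6 * x 0 + m 1 / 2 * x 1 + m 2 / 2 * x 2 + m 3 / 2 * x 3"
      by (simp_all add: sum_lessThan_4 R_def One_nat_def numeral_2_eq_2 numeral_3_eq_3)
    have "6 * ev x g = 6 * ev x (lin_subst 4 R (nf4 1 1 (m 3 / 6)))"
      unfolding ev_LS[OF sym_tensor_nf4] unfolding nf4_def ev.hom_add ev.hom_mult ev.hom_power ev_Const ev_Var r ev_cubic[OF g]
      unfolding sum_lessThan_4
      by (simp add: T0 T1 target2 m0 k1 k2 k34 flip: numeral_2_eq_2) (simp add: power2_eq_square power3_eq_cube algebra_simps)
    then show "ev x g = ev x (lin_subst 4 R (nf4 1 1 (m 3 / 6)))" by simp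
  qed
  moreover have "Hess 4 g \<noteq> 0"
  proof
    assume "Hess 4 g = 0"
    then have "E 1 0 0 0 = 0" by (simp add: E_def)
    then show False using C unfolding EH by simp
  qed
  ultimately show "GL_equiv 4 g (nf4 1 1 (m 3 / 6))" using GL_equivI[OF R] by blast
qed

section \<open>Quaternary cubics containing the plane at infinity\<close>

text \<open>
  A kernel vector with \<open>v3 \<noteq> 0\<close> makes the form depend only on \<open>x - (v1/v3) z\<close> and \<open>y - (v2/v3) z\<close>.\<close>
lemma ternary_quadratic_splits_pivot:
  fixes a b c d e f v1 v2 v3 :: complex
  assumes v: "v3 \<noteq> 0" "a * v1 + d * v2 + e * v3 = 0" "d * v1 + b * v2 + f * v3 = 0" "e * v1 + f * v2 + c * v3 = 0"
  shows "\<exists>p1 p2 p3 q1 q2 q3. \<forall>x y z. a * x ^ 2 + b * y ^ 2 + c * z ^ 2 + 2 * d * x * y + 2 * e * x * z + 2 * f * y * z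
    = (p1 * x + p2 * y + p3 * z) * (q1 * x + q2 * y + q3 * z)"
proof -
  define r s where "r = v1 / v3" "s = v2 / v3"
  then have rs: "v1 = r * v3" "v2 = s * v3" using v(1) by auto
  have "v3 * (e + a * r + d * s) = 0" "v3 * (f + d * r + b * s) = 0" "v3 * (c + e * r + f * s) = 0"
    using v(2-4) unfolding rs by (simp_all add: algebra_simps)
  then have "e + a * r + d * s = 0" "f + d * r + b * s = 0" "c + e * r + f * s = 0" using v(1) by simp_all
  then have "e = - (a * r + d * s)" "f = - (d * r + b * s)" "c = - (e * r + f * s)"
    by (simp_all only: add.assoc add_eq_0_iff2)
  note efc = this(3) this(1,2)
  obtain p q p' q' where s: "a = p * p'" "2 * d = p * q' + q * p'" "b = q * q'" using binary_quadratic_splits .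
  have "a * x ^ 2 + b * y ^ 2 + c * z ^ 2 + 2 * d * x * y + 2 * e * x * z + 2 * f * y * z
    = (p * x + q * y + (- (p * r + q * s)) * z) * (p' * x + q' * y + (- (p' * r + q' * s)) * z)" for x y z
  proof -
    have "a * x ^ 2 + b * y ^ 2 + c * z ^ 2 + 2 * d * x * y + 2 * e * x * z + 2 * f * y * z
      = a * (x - r * z) ^ 2 + 2 * d * (x - r * z) * (y - s * z) + b * (y - s * z) ^ 2" unfolding efc by (simp add: power2_eq_square algebra_simps)
    also have "\<dots> = (p * (x - r * z) + q * (y - s * z)) * (p' * (x - r * z) + q' * (y - s * z))"
      unfolding s by (simp add: power2_eq_square algebra_simps)
    also have "\<dots> = (p * x + q * y + (- (p * r + q * s)) * z) * (p' * x + q' * y + (- (p' * r + q' * s)) * z)"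
      by (simp add: algebra_simps)
    finally show ?thesis .
  qed
  then show ?thesis by blast
qed

text \<open>
  A singular ternary quadratic form is a form in two variables, hence a product of linear forms.\<close>
lemma ternary_quadratic_splits:
  fixes a b c d e f :: complex
  assumes "a * b * c + 2 * d * e * f - a * f ^ 2 - b * e ^ 2 - c * d ^ 2 = 0"
  obtains p1 p2 p3 q1 q2 q3 where "\<And>x y z. a * x ^ 2 + b * y ^ 2 + c * z ^ 2 + 2 * d * x * y + 2 * e * x * z + 2 * f * y * z
    = (p1 * x + p2 * y + p3 * z) * (q1 * x + q2 * y + q3 * z)"
proof -
  define S where "S = mat 3 3 (\<lambda>(i::nat, j::nat). [[a, d, e], [d, b, f], [e, f, c]] ! i ! j)"
  have S: "S \<in> carrier_mat 3 3" by (simp add: S_def)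
  have "det S = a * (b * c - f * f) - d * (d * c - f * e) + e * (d * f - b * e)"
    unfolding S_def det_mat_3 by (simp add: One_nat_def numeral_2_eq_2)
  also have "\<dots> = 0" using assms by (simp add: power2_eq_square algebra_simps)
  finally obtain v where v: "v \<in> carrier_vec 3" "v \<noteq> 0\<^sub>v 3" "S *\<^sub>v v = 0\<^sub>v 3" using det_0_iff_vec_prod_zero[OF S] by blast
  have row: "(S *\<^sub>v v) $ i = S $$ (i, 0) * v $ 0 + S $$ (i, 1) * v $ 1 + S $$ (i, 2) * v $ 2" if "i < 3" for i
  proof -
    have "{0..<3::nat} = {0, 1, 2}" by auto
    then show ?thesis using that v(1) S by (simp add: scalar_prod_def add.assoc)
  qed
  have "a * v $ 0 + d * v $ 1 + e * v $ 2 = 0" "d * v $ 0 + b * v $ 1 + f * v $ 2 = 0" "e * v $ 0 + f * v $ 1 + c * v $ 2 = 0"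
    using row[of 0] row[of 1] row[of 2] unfolding v(3) by (simp_all add: S_def One_nat_def numeral_2_eq_2)
  note k = this
  have "v $ 0 \<noteq> 0 \<or> v $ 1 \<noteq> 0 \<or> v $ 2 \<noteq> 0"
  proof (rule ccontr)
    assume n: "\<not> ?thesis"
    have "v = 0\<^sub>v 3"
    proof (rule eq_vecI)
      fix i :: nat assume i: "i < dim_vec (0\<^sub>v 3 :: complex vec)"
      then have "i = 0 \<or> i = 1 \<or> i = 2" by auto
      then show "v $ i = 0\<^sub>v 3 $ i" using n by auto
    qed (use v(1) in simp)
    then show False using v(2) by simp
  qed
  then show thesis
  proof (elim disjE)
    assume "v $ 2 \<noteq> 0"
    from ternary_quadratic_splits_pivot[OF this k] show ?thesis using that by blast
  next
    assume n: "v $ 1 \<noteq> 0"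
    have "\<exists>p1 p2 p3 q1 q2 q3. \<forall>x y z. a * x ^ 2 + c * y ^ 2 + b * z ^ 2 + 2 * e * x * y + 2 * d * x * z + 2 * f * y * z
      = (p1 * x + p2 * y + p3 * z) * (q1 * x + q2 * y + q3 * z)"
      by (rule ternary_quadratic_splits_pivot[OF n, of a "v $ 0" e "v $ 2" d c f b]) (use k in \<open>simp_all add: add.commute add.left_commute\<close>)
    then obtain p1 p2 p3 q1 q2 q3 where h: "\<And>x y z. a * x ^ 2 + c * y ^ 2 + b * z ^ 2 + 2 * e * x * y + 2 * d * x * z + 2 * f * y * z
      = (p1 * x + p2 * y + p3 * z) * (q1 * x + q2 * y + q3 * z)" by blast
    show ?thesis
    proof (rule that[of p1 p3 p2 q1 q3 q2])
      fix x y z show "a * x ^ 2 + b * y ^ 2 + c * z ^ 2 + 2 * d * x * y + 2 * e * x * z + 2 * f * y * z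
        = (p1 * x + p3 * y + p2 * z) * (q1 * x + q3 * y + q2 * z)" using h[of x z y] by (simp add: algebra_simps)
    qed
  next
    assume n: "v $ 0 \<noteq> 0"
    have "\<exists>p1 p2 p3 q1 q2 q3. \<forall>x y z. b * x ^ 2 + c * y ^ 2 + a * z ^ 2 + 2 * f * x * y + 2 * d * x * z + 2 * e * y * z
      = (p1 * x + p2 * y + p3 * z) * (q1 * x + q2 * y + q3 * z)"
      by (rule ternary_quadratic_splits_pivot[OF n, of b "v $ 1" f "v $ 2" d c e a]) (use k in \<open>simp_all add: add.commute add.left_commute\<close>)
    then obtain p1 p2 p3 q1 q2 q3 where h: "\<And>x y z. b * x ^ 2 + c * y ^ 2 + a * z ^ 2 + 2 * f * x * y + 2 * d * x * z + 2 * e * y * z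
      = (p1 * x + p2 * y + p3 * z) * (q1 * x + q2 * y + q3 * z)" by blast
    show ?thesis
    proof (rule that[of p3 p1 p2 q3 q1 q2])
      fix x y z show "a * x ^ 2 + b * y ^ 2 + c * z ^ 2 + 2 * d * x * y + 2 * e * x * z + 2 * f * y * z
        = (p3 * x + p1 * y + p2 * z) * (q3 * x + q1 * y + q2 * z)" using h[of y z x] by (simp add: algebra_simps)
    qed
  qed
qed

text \<open>
  A symmetric matrix with a distinguished first row: the determinant is affine in the corner entry and a quadratic form,
  given by the adjugate of the remaining block, in the rest of that row.\<close>
lemma det_bordered:
  fixes H :: "nat \<Rightarrow> nat \<Rightarrow> complex"
  assumes "H 1 0 = H 0 1" "H 2 0 = H 0 2" "H 3 0 = H 0 3" "H 2 1 = H 1 2" "H 3 1 = H 1 3" "H 3 2 = H 2 3"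
  shows "det (mat 4 4 (\<lambda>(i, j). H i j)) =
    H 0 0 * (H 1 1 * H 2 2 * H 3 3 + 2 * H 1 2 * H 1 3 * H 2 3 - H 1 1 * H 2 3 ^ 2 - H 2 2 * H 1 3 ^ 2 - H 3 3 * H 1 2 ^ 2)
    - ((H 2 2 * H 3 3 - H 2 3 ^ 2) * H 0 1 ^ 2 + (H 1 1 * H 3 3 - H 1 3 ^ 2) * H 0 2 ^ 2 + (H 1 1 * H 2 2 - H 1 2 ^ 2) * H 0 3 ^ 2
      + 2 * (H 1 3 * H 2 3 - H 1 2 * H 3 3) * H 0 1 * H 0 2 + 2 * (H 1 2 * H 2 3 - H 1 3 * H 2 2) * H 0 1 * H 0 3
      + 2 * (H 1 2 * H 1 3 - H 2 3 * H 1 1) * H 0 2 * H 0 3)"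
  by (simp add: det_mat_4 assms power2_eq_square algebra_simps)

text \<open>
  The adjugate form of a symmetric 3 by 3 matrix \<open>S\<close>, evaluated at \<open>S y\<close>, is \<open>det S\<close> times the form of \<open>S\<close> at \<open>y\<close>; the second part is
  the parallelogram law.\<close>
lemma adjugate_form:
  fixes a1 a2 a3 b1 b2 b3 :: complex
  defines "G \<equiv> \<lambda>u v w. (a2 * a3 - b3 ^ 2) * u ^ 2 + (a1 * a3 - b2 ^ 2) * v ^ 2 + (a1 * a2 - b1 ^ 2) * w ^ 2
      + 2 * (b2 * b3 - b1 * a3) * u * v + 2 * (b1 * b3 - b2 * a2) * u * w + 2 * (b1 * b2 - b3 * a1) * v * w"
    and "D \<equiv> a1 * a2 * a3 + 2 * b1 * b2 * b3 - a1 * b3 ^ 2 - a2 * b2 ^ 2 - a3 * b1 ^ 2"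
  shows "G (a1 * x + b1 * y + b2 * z) (b1 * x + a2 * y + b3 * z) (b2 * x + b3 * y + a3 * z)
      = D * (a1 * x ^ 2 + a2 * y ^ 2 + a3 * z ^ 2 + 2 * b1 * x * y + 2 * b2 * x * z + 2 * b3 * y * z)"
    and "G (r + u) (s + v) (t + w) + G (r - u) (s - v) (t - w) - 2 * G r s t = 2 * G u v w"
proof -
  define s1 s2 s3 where s: "s1 = a1 * x + b1 * y + b2 * z" "s2 = b1 * x + a2 * y + b3 * z" "s3 = b2 * x + b3 * y + a3 * z"
  have "(a2 * a3 - b3 ^ 2) * s1 + (b2 * b3 - b1 * a3) * s2 + (b1 * b3 - b2 * a2) * s3 = D * x"
    "(b2 * b3 - b1 * a3) * s1 + (a1 * a3 - b2 ^ 2) * s2 + (b1 * b2 - b3 * a1) * s3 = D * y"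
    "(b1 * b3 - b2 * a2) * s1 + (b1 * b2 - b3 * a1) * s2 + (a1 * a2 - b1 ^ 2) * s3 = D * z"
    unfolding s D_def by (simp_all add: power2_eq_square algebra_simps)
  note adj = this
  have "G s1 s2 s3 = s1 * ((a2 * a3 - b3 ^ 2) * s1 + (b2 * b3 - b1 * a3) * s2 + (b1 * b3 - b2 * a2) * s3)
      + s2 * ((b2 * b3 - b1 * a3) * s1 + (a1 * a3 - b2 ^ 2) * s2 + (b1 * b2 - b3 * a1) * s3)
      + s3 * ((b1 * b3 - b2 * a2) * s1 + (b1 * b2 - b3 * a1) * s2 + (a1 * a2 - b1 ^ 2) * s3)"
    unfolding G_def by (simp add: power2_eq_square algebra_simps)
  also have "\<dots> = D * (s1 * x + s2 * y + s3 * z)" unfolding adj by (simp add: algebra_simps)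
  also have "s1 * x + s2 * y + s3 * z = a1 * x ^ 2 + a2 * y ^ 2 + a3 * z ^ 2 + 2 * b1 * x * y + 2 * b2 * x * z + 2 * b3 * y * z"
    unfolding s by (simp add: power2_eq_square algebra_simps)
  finally show "G (a1 * x + b1 * y + b2 * z) (b1 * x + a2 * y + b3 * z) (b2 * x + b3 * y + a3 * z)
      = D * (a1 * x ^ 2 + a2 * y ^ 2 + a3 * z ^ 2 + 2 * b1 * x * y + 2 * b2 * x * z + 2 * b3 * y * z)" unfolding s .
  show "G (r + u) (s + v) (t + w) + G (r - u) (s - v) (t - w) - 2 * G r s t = 2 * G u v w"
    unfolding G_def by (simp add: power2_eq_square algebra_simps)
qed

text \<open>
  Here \<open>f = x_0 Q\<close>. At \<open>x_0 = 1\<close> the Hessian is a bordered determinant around twice the constant matrix \<open>S\<close> of \<open>Q\<close> on \<open>x_0 = 0\<close>, whose border is affine in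
  \<open>(x, y, z)\<close>. The Hessian is constant there, and its second central difference is a multiple of \<open>det S\<close> times the restricted form by
  \<open>adjugate_form\<close>. So \<open>det S = 0\<close>, as otherwise \<open>S\<close> would be zero, and the restricted form is a product of two linear forms.\<close>
lemma cone_pencil_GL_equiv:
  assumes f: "sym_tensor 4 3 f" and H: "Hess 4 f = Const c * Var 0 ^ 4" "c \<noteq> 0" and r: "r0 f = 0"
  shows "GL_equiv 4 f (nf4 1 1 0)"
proof -
  obtain Q where Q: "f = Var 0 * Q" "sym_tensor 4 2 Q" using r0_eq_0_divide[OF f r] by auto
  obtain A where A: "A \<in> carrier_mat 4 4" "A\<^sup>T = A" "Q = (\<Sum>i<4. \<Sum>j<4. Const (A $$ (i, j)) * Var i * Var j)"
    using quadratic_form[OF Q(2)] .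
  have As: "A $$ (1,0) = A $$ (0,1)" "A $$ (2,0) = A $$ (0,2)" "A $$ (3,0) = A $$ (0,3)"
    "A $$ (2,1) = A $$ (1,2)" "A $$ (3,1) = A $$ (1,3)" "A $$ (3,2) = A $$ (2,3)"
    using A(1) by (subst A(2)[symmetric], simp)+
  have evf: "ev x f = x 0 * (\<Sum>i<4. \<Sum>j<4. A $$ (i, j) * x i * x j)" for x
    unfolding Q(1) A(3) by (simp add: ev.hom_mult ev.hom_sum)
  have pp: "ev x (partial i (partial j f)) = (if i = 0 \<and> j = 0 then 4 * (\<Sum>k<4. A $$ (0, k) * x k) + 2 * A $$ (0,0) * x 0
      else if i = 0 then 2 * (\<Sum>k<4. A $$ (j, k) * x k) + 2 * A $$ (0, j) * x 0
      else if j = 0 then 2 * (\<Sum>k<4. A $$ (i, k) * x k) + 2 * A $$ (0, i) * x 0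
      else 2 * A $$ (i, j) * x 0)" if ij: "i < 4" "j < 4" for x i j
  proof -
    have "i = 0 \<or> i = 1 \<or> i = 2 \<or> i = 3" "j = 0 \<or> j = 1 \<or> j = 2 \<or> j = 3" using ij by linarith+
    then show ?thesis unfolding Q(1) A(3) sum_lessThan_4
      by (elim disjE; simp add: partial_add partial_mult partial_Const_mult partial_Var As ev.hom_add ev.hom_mult;
        simp add: algebra_simps ev.hom_numeral)
  qed
  define a1 a2 a3 b1 b2 b3 where a: "a1 = A $$ (1,1)" "a2 = A $$ (2,2)" "a3 = A $$ (3,3)" "b1 = A $$ (1,2)" "b2 = A $$ (1,3)" "b3 = A $$ (2,3)"
  define d0 where "d0 = a1 * a2 * a3 + 2 * b1 * b2 * b3 - a1 * b3 ^ 2 - a2 * b2 ^ 2 - a3 * b1 ^ 2"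
  define E where "E x y z = ev (\<lambda>i. [1, x, y, z] ! i) (Hess 4 f)" for x y z
  have n: "[1, x1, x2, x3] ! 0 = 1" "[1, x1, x2, x3] ! 1 = x1" "[1, x1, x2, x3] ! 2 = x2" "[1, x1, x2, x3] ! 3 = x3"
    for x1 x2 x3 :: complex by (simp_all add: One_nat_def numeral_2_eq_2 numeral_3_eq_3)
  have Ec: "E x y z = c" for x y z unfolding E_def H(1) by (simp add: ev.hom_mult ev.hom_power)
  have d0: "d0 * (a1 * x ^ 2 + a2 * y ^ 2 + a3 * z ^ 2 + 2 * b1 * x * y + 2 * b2 * x * z + 2 * b3 * y * z) = 0" for x y z
  proof -
    have HM: "ev x (Hess 4 f) = det (mat 4 4 (\<lambda>(i, j). ev x (partial i (partial j f))))" for x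
    proof -
      have "map_mat (ev x) (hess_mat 4 f) = mat 4 4 (\<lambda>(i, j). ev x (partial i (partial j f)))"
        by (rule eq_matI) (auto simp: hess_mat_def)
      then show ?thesis by (metis Hess_det ev.hom_det)
    qed
    define G where "G = (\<lambda>u v w. (a2 * a3 - b3 ^ 2) * u ^ 2 + (a1 * a3 - b2 ^ 2) * v ^ 2 + (a1 * a2 - b1 ^ 2) * w ^ 2
      + 2 * (b2 * b3 - b1 * a3) * u * v + 2 * (b1 * b3 - b2 * a2) * u * w + 2 * (b1 * b2 - b3 * a1) * v * w)"
    define s0 where "s0 x y z = 4 * (A $$ (0,0) + A $$ (0,1) * x + A $$ (0,2) * y + A $$ (0,3) * z) + 2 * A $$ (0,0)" for x y z
    define w1 w2 w3 where w: "w1 = (\<lambda>x y z. 2 * A $$ (0,1) + (a1 * x + b1 * y + b2 * z))"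
      "w2 = (\<lambda>x y z. 2 * A $$ (0,2) + (b1 * x + a2 * y + b3 * z))"
      "w3 = (\<lambda>x y z. 2 * A $$ (0,3) + (b2 * x + b3 * y + a3 * z))"
    have e: "E x y z = 8 * (s0 x y z * d0) - 16 * G (w1 x y z) (w2 x y z) (w3 x y z)" for x y z
    proof -
      define p where "p i j = ev (\<lambda>i. [1, x, y, z] ! i) (partial i (partial j f))" for i j
      have p: "p 0 0 = s0 x y z" "p 0 1 = 2 * w1 x y z" "p 1 0 = 2 * w1 x y z" "p 0 2 = 2 * w2 x y z" "p 2 0 = 2 * w2 x y z"
        "p 0 3 = 2 * w3 x y z" "p 3 0 = 2 * w3 x y z" "p 1 1 = 2 * a1" "p 2 2 = 2 * a2" "p 3 3 = 2 * a3" "p 1 2 = 2 * b1" "p 2 1 = 2 * b1"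
        "p 1 3 = 2 * b2" "p 3 1 = 2 * b2" "p 2 3 = 2 * b3" "p 3 2 = 2 * b3"
        by (simp_all add: p_def pp sum_lessThan_4 n As w s0_def a algebra_simps)
      have "E x y z = det (mat 4 4 (\<lambda>(i, j). p i j))" unfolding E_def HM p_def ..
      also have "\<dots> = 8 * (s0 x y z * d0) - 16 * G (w1 x y z) (w2 x y z) (w3 x y z)"
        by (subst det_bordered) (simp_all only: p G_def d0_def, simp add: power2_eq_square algebra_simps)
      finally show ?thesis .
    qed
    let ?u = "a1 * x + b1 * y + b2 * z" and ?v = "b1 * x + a2 * y + b3 * z" and ?w = "b2 * x + b3 * y + a3 * z"
    have s0: "s0 x y z + s0 (- x) (- y) (- z) = 2 * s0 0 0 0" unfolding s0_def by simp
    have "0 = E x y z + E (- x) (- y) (- z) - 2 * E 0 0 0" unfolding Ec by simp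
    also have "\<dots> = 8 * d0 * (s0 x y z + s0 (- x) (- y) (- z) - 2 * s0 0 0 0)
        - 16 * (G (w1 x y z) (w2 x y z) (w3 x y z) + G (w1 (- x) (- y) (- z)) (w2 (- x) (- y) (- z)) (w3 (- x) (- y) (- z))
          - 2 * G (w1 0 0 0) (w2 0 0 0) (w3 0 0 0))"
      unfolding e by (simp add: algebra_simps)
    also have "G (w1 x y z) (w2 x y z) (w3 x y z) + G (w1 (- x) (- y) (- z)) (w2 (- x) (- y) (- z)) (w3 (- x) (- y) (- z))
          - 2 * G (w1 0 0 0) (w2 0 0 0) (w3 0 0 0)
        = G (2 * A $$ (0,1) + ?u) (2 * A $$ (0,2) + ?v) (2 * A $$ (0,3) + ?w)
          + G (2 * A $$ (0,1) - ?u) (2 * A $$ (0,2) - ?v) (2 * A $$ (0,3) - ?w) - 2 * G (2 * A $$ (0,1)) (2 * A $$ (0,2)) (2 * A $$ (0,3))"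
      unfolding w by (simp add: algebra_simps)
    also have "\<dots> = 2 * G ?u ?v ?w" unfolding G_def by (rule adjugate_form(2))
    also have "G ?u ?v ?w = d0 * (a1 * x ^ 2 + a2 * y ^ 2 + a3 * z ^ 2 + 2 * b1 * x * y + 2 * b2 * x * z + 2 * b3 * y * z)"
      unfolding G_def d0_def by (rule adjugate_form(1))
    finally show ?thesis using s0 by simp
  qed
  have "d0 = 0"
  proof (rule ccontr)
    assume ne: "d0 \<noteq> 0"
    have "a1 = 0" "a2 = 0" "a3 = 0" using ne d0[of 1 0 0] d0[of 0 1 0] d0[of 0 0 1] by simp_all
    moreover from this have "b1 = 0" "b2 = 0" using ne d0[of 1 1 0] d0[of 1 0 1] by simp_all
    ultimately show False using ne by (simp add: d0_def)
  qed
  then obtain p1 p2 p3 q1 q2 q3 where s: "\<And>x y z. a1 * x ^ 2 + a2 * y ^ 2 + a3 * z ^ 2 + 2 * b1 * x * y + 2 * b2 * x * z + 2 * b3 * y * z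
    = (p1 * x + p2 * y + p3 * z) * (q1 * x + q2 * y + q3 * z)"
    using ternary_quadratic_splits[of a1 a2 a3 b1 b2 b3] unfolding d0_def by metis
  define R where "R = mat 4 4 (\<lambda>(i::nat, j::nat). [[1, 0, 0, 0], [0, p1, p2, p3], [0, q1, q2, q3], [A $$ (0,0), 2 * A $$ (0,1), 2 * A $$ (0,2), 2 * A $$ (0,3)]] ! i ! j)"
  have R: "R \<in> carrier_mat 4 4" by (simp add: R_def)
  have "f = lin_subst 4 R (nf4 1 1 0)"
  proof (rule ev_inj)
    fix x
    have r: "(\<Sum>j<4. R $$ (0, j) * x j) = x 0" "(\<Sum>j<4. R $$ (1, j) * x j) = p1 * x 1 + p2 * x 2 + p3 * x 3"
      "(\<Sum>j<4. R $$ (2, j) * x j) = q1 * x 1 + q2 * x 2 + q3 * x 3"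
      "(\<Sum>j<4. R $$ (3, j) * x j) = A $$ (0,0) * x 0 + 2 * A $$ (0,1) * x 1 + 2 * A $$ (0,2) * x 2 + 2 * A $$ (0,3) * x 3"
      by (simp_all add: sum_lessThan_4 R_def One_nat_def numeral_2_eq_2 numeral_3_eq_3)
    have "ev x f = x 0 * (x 0 * (A $$ (0,0) * x 0 + 2 * A $$ (0,1) * x 1 + 2 * A $$ (0,2) * x 2 + 2 * A $$ (0,3) * x 3)
      + (a1 * x 1 ^ 2 + a2 * x 2 ^ 2 + a3 * x 3 ^ 2 + 2 * b1 * x 1 * x 2 + 2 * b2 * x 1 * x 3 + 2 * b3 * x 2 * x 3))"
      unfolding evf sum_lessThan_4 As a by (simp add: power2_eq_square algebra_simps)
    also have "\<dots> = ev x (lin_subst 4 R (nf4 1 1 0))"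
      unfolding ev_LS[OF sym_tensor_nf4] unfolding nf4_def ev.hom_add ev.hom_mult ev.hom_power ev_Const ev_Var r s by (simp add: power2_eq_square algebra_simps)
    finally show "ev x f = ev x (lin_subst 4 R (nf4 1 1 0))" .
  qed
  moreover have "Hess 4 f \<noteq> 0" using H Var_neq_0 by simp
  ultimately show ?thesis using GL_equivI[OF R] by blast
qed

section \<open>The Hankel basis\<close>

text \<open>
  The second-derivative matrix of a cubic at the point \<open>v\<close>.\<close>
definition contraction :: "nat \<Rightarrow> cpoly \<Rightarrow> complex vec \<Rightarrow> complex mat" where
  "contraction d f v = mat d d (\<lambda>(i, j). \<Sum>k<d. third_deriv f k i j * v $ k)"

lemma contraction_carrier [simp]: "contraction d f v \<in> carrier_mat d d" by (simp add: contraction_def)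

text \<open>
  The third-derivative tensor is symmetric.\<close>
lemma contraction_vec_swap:
  assumes "v \<in> carrier_vec d" "w \<in> carrier_vec d" shows "contraction d f v *\<^sub>v w = contraction d f w *\<^sub>v v"
proof (rule eq_vecI)
  fix i assume i: "i < dim_vec (contraction d f w *\<^sub>v v)"
  have "(\<Sum>j<d. (\<Sum>k<d. third_deriv f k i j * v $ k) * w $ j) = (\<Sum>j<d. (\<Sum>k<d. third_deriv f k i j * w $ k) * v $ j)"
    unfolding sum_distrib_right
    by (subst sum.swap) (intro sum.cong refl, metis third_deriv_sym mult.assoc mult.commute)
  then show "(contraction d f v *\<^sub>v w) $ i = (contraction d f w *\<^sub>v v) $ i"
    using i assms by (simp add: contraction_def scalar_prod_def atLeast0LessThan)
qed (simp add: contraction_def)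

lemma contraction_transpose: "(contraction d f v)\<^sup>T = contraction d f v"
  by (rule eq_matI) (simp_all add: contraction_def third_deriv_sym(2)[of f])

lemma contraction_self_adjoint:
  assumes "v \<in> carrier_vec d" "w \<in> carrier_vec d"
  shows "(contraction d f u *\<^sub>v v) \<bullet> w = v \<bullet> (contraction d f u *\<^sub>v w)"
  using transpose_vec_mult_scalar[OF contraction_carrier assms(2,1), of f u] unfolding contraction_transpose
  by (metis assms comm_scalar_prod contraction_carrier mult_mat_vec_carrier)

lemma scalar_prod_contraction:
  assumes "u \<in> carrier_vec d" "v \<in> carrier_vec d" "w \<in> carrier_vec d"
  shows "v \<bullet> (contraction d f u *\<^sub>v w) = (\<Sum>a<d. \<Sum>b<d. \<Sum>c<d. w $ a * v $ b * u $ c * third_deriv f c b a)"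
proof -
  have "v \<bullet> (contraction d f u *\<^sub>v w) = (\<Sum>b<d. v $ b * (\<Sum>a<d. (\<Sum>c<d. third_deriv f c b a * u $ c) * w $ a))"
    using assms by (simp add: contraction_def scalar_prod_def atLeast0LessThan)
  also have "\<dots> = (\<Sum>b<d. \<Sum>a<d. \<Sum>c<d. w $ a * v $ b * u $ c * third_deriv f c b a)"
    by (simp add: sum_distrib_left sum_distrib_right mult.assoc mult.left_commute mult.commute)
  finally show ?thesis by (subst sum.swap)
qed

lemma det_contraction: assumes "sym_tensor d 3 f"
  shows "det (contraction d f v) = ev (\<lambda>i. v $ i) (Hess d f)"
  by (simp add: contraction_def ev_Hess_cubic[OF assms])

text \<open>
  With \<open>M = contraction 4 f\<close> and \<open>N = M(e)^{-1} M(u)\<close> the equation \<open>det (M (z e - u)) = c z^4\<close> shows that \<open>N\<close> is nilpotent. It is self-adjoint for the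
  bilinear form \<open>M(e)\<close>, so this form takes the values \<open>m (j + k)\<close> on the vectors \<open>p k = N^k e\<close>, and \<open>p 1 = u\<close>. The form \<open>M(u)\<close> is then also given by
  \<open>m\<close>, with index shifted by one; moreover \<open>m k = 0\<close> for \<open>k \<ge> 4\<close>, and \<open>m 3 = 6 f(u) \<noteq> 0\<close>. So \<open>f\<close> is a Hankel cubic in these coordinates.\<close>
lemma regular_point_GL_equiv:
  assumes f: "sym_tensor 4 3 f" and H: "Hess 4 f = Const c * Var 0 ^ 4" "c \<noteq> 0"
    and u: "u \<in> carrier_vec 4" "u $ 0 = 0" "ev (\<lambda>i. u $ i) f \<noteq> 0"
  shows "\<exists>b. b \<noteq> 0 \<and> GL_equiv 4 f (nf4 1 1 b)"
proof -
  let ?M = "contraction 4 f" and ?e = "unit_vec 4 0 :: complex vec"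
  have e: "?e \<in> carrier_vec 4" "?e $ 0 = 1" by simp_all
  have detM: "det (?M v) = c * (v $ 0) ^ 4" for v
    unfolding det_contraction[OF f] H(1) by (simp add: ev.hom_mult ev.hom_power)
  have "det (?M ?e) \<noteq> 0" unfolding detM e using H(2) by simp
  then obtain I where I: "I \<in> carrier_mat 4 4" "?M ?e * I = 1\<^sub>m 4" "det I \<noteq> 0"
    using ex_inverse[OF contraction_carrier] by blast
  have I': "I * ?M ?e = 1\<^sub>m 4" using mat_mult_left_right_inverse[OF contraction_carrier I(1,2)] .
  define N where "N = I * ?M u"
  have N: "N \<in> carrier_mat 4 4" using I(1) by (simp add: N_def)
  have MN: "?M ?e * N = ?M u"
    unfolding N_def using I by (subst assoc_mult_mat[symmetric, of _ 4 4 _ 4 _ 4]) (simp_all add: left_mult_one_mat[of _ 4 4])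
  have "N ^\<^sub>m 4 = 0\<^sub>m 4 4"
  proof (rule nilpotent_of_char_poly[OF N])
    fix z
    have "?M ?e * (z \<cdot>\<^sub>m 1\<^sub>m 4 - N) = z \<cdot>\<^sub>m ?M ?e - ?M u"
      using N by (subst mult_minus_distrib_mat[of _ 4 4 _ 4]) (simp_all add: MN mult_smult_distrib[of _ 4 4 _ 4] right_mult_one_mat[of _ 4 4])
    also have "\<dots> = ?M (z \<cdot>\<^sub>v ?e - u)"
      by (rule eq_matI) (use u(1) in \<open>simp_all add: contraction_def sum_lessThan_4 algebra_simps\<close>)
    finally have "det (?M ?e) * det (z \<cdot>\<^sub>m 1\<^sub>m 4 - N) = det (?M (z \<cdot>\<^sub>v ?e - u))"
      using N by (subst det_mult[symmetric, of _ 4]) (simp_all add: minus_carrier_mat)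
    then show "det (z \<cdot>\<^sub>m 1\<^sub>m 4 - N) = z ^ 4" using u H(2) by (simp add: detM)
  qed
  define p where "p k = ((\<lambda>v. N *\<^sub>v v) ^^ k) ?e" for k
  have p: "p k \<in> carrier_vec 4" for k
    by (induction k) (use N in \<open>auto simp: p_def\<close>)
  have pS: "p (Suc k) = N *\<^sub>v p k" for k by (simp add: p_def)
  have p0: "p 0 = ?e" by (simp add: p_def)
  have p1: "p 1 = u"
  proof -
    have "p 1 = I *\<^sub>v (?M u *\<^sub>v ?e)" using I(1) by (simp add: One_nat_def pS p0 N_def assoc_mult_mat_vec[of _ 4 4 _ 4])
    also have "\<dots> = I *\<^sub>v (?M ?e *\<^sub>v u)" using contraction_vec_swap[OF u(1) e(1), of f] by (simp only:)
    also have "\<dots> = (I * ?M ?e) *\<^sub>v u" using I(1) u(1) by (simp add: assoc_mult_mat_vec[of _ 4 4 _ 4])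
    finally show ?thesis using u(1) by (simp add: I')
  qed
  have comm: "(N ^\<^sub>m k) *\<^sub>v (N *\<^sub>v v) = N *\<^sub>v (N ^\<^sub>m k *\<^sub>v v)" if "v \<in> carrier_vec 4" for k v
    using that
  proof (induction k arbitrary: v)
    case (Suc k)
    then show ?case using N by (simp add: assoc_mult_mat_vec[of _ 4 4 _ 4])
  qed (use N in simp)
  have pN: "p k = N ^\<^sub>m k *\<^sub>v ?e" for k
    by (induction k) (use N comm[OF e(1)] in \<open>simp_all add: p0 pS assoc_mult_mat_vec[of _ 4 4 _ 4]\<close>)
  have pz: "p (4 + k) = 0\<^sub>v 4" for k
  proof (induction k)
    case 0 show ?case using N unfolding pN \<open>N ^\<^sub>m 4 = 0\<^sub>m 4 4\<close> Nat.add_0_right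
      by (intro eq_vecI) (simp_all add: scalar_prod_def)
  next
    case (Suc k)
    have "p (4 + Suc k) = N *\<^sub>v p (4 + k)" using pS[of "4 + k"] by (simp only: add_Suc_right)
    then show ?case using N Suc by (intro eq_vecI) (simp_all add: scalar_prod_def)
  qed
  define m where "m k = ?e \<bullet> (?M ?e *\<^sub>v p k)" for k
  have mz: "m k = 0" if "4 \<le> k" for k
  proof -
    have "?M ?e *\<^sub>v 0\<^sub>v 4 = 0\<^sub>v 4" by (intro eq_vecI) (simp_all add: contraction_def scalar_prod_def)
    then show ?thesis using pz[of "k - 4"] that unfolding m_def by simp
  qed
  have adj: "?M ?e *\<^sub>v p (Suc k) = ?M u *\<^sub>v p k" for k
    using N p[of k] by (simp add: pS MN flip: assoc_mult_mat_vec[of _ 4 4 _ 4])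
  have b: "p j \<bullet> (?M ?e *\<^sub>v p k) = m (j + k)" for j k
  proof (induction j arbitrary: k)
    case 0 show ?case by (simp add: m_def p0)
  next
    case (Suc j)
    have "p (Suc j) \<bullet> (?M ?e *\<^sub>v p k) = (?M ?e *\<^sub>v p (Suc j)) \<bullet> p k" by (rule contraction_self_adjoint[OF p p, symmetric])
    also have "\<dots> = p j \<bullet> (?M u *\<^sub>v p k)" unfolding adj by (rule contraction_self_adjoint[OF p p])
    also have "\<dots> = m (j + Suc k)" unfolding adj[symmetric] by (rule Suc.IH)
    finally show ?case by simp
  qed
  define P where "P = mat 4 4 (\<lambda>(i, j). p j $ i)"
  have P: "P \<in> carrier_mat 4 4" by (simp add: P_def)
  define g where "g = lin_subst 4 P f"
  have g: "sym_tensor 4 3 g" unfolding g_def by (rule sym_tensor_LS[OF f])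
  have tg: "third_deriv g i j k = p j \<bullet> (?M (p i) *\<^sub>v p k)" if "i < 4" "j < 4" "k < 4" for i j k
    unfolding g_def third_deriv_LS[OF f that] scalar_prod_contraction[OF p p p] using that by (simp add: P_def)
  have t0: "third_deriv g 0 j k = m (j + k)" if "j < 4" "k < 4" for j k
    using tg[of 0 j k] that by (simp add: p0 b)
  have t1: "third_deriv g 1 j k = m (j + k + 1)" if "j < 4" "k < 4" for j k
    using tg[of 1 j k] that b[of j "Suc k"] by (simp add: p1 flip: adj) (simp add: One_nat_def)
  have m3: "m 3 \<noteq> 0"
  proof -
    have "6 * ev (\<lambda>i. u $ i) f = u \<bullet> (?M u *\<^sub>v u)"
      unfolding ev_cubic[OF f] scalar_prod_contraction[OF u(1) u(1) u(1)] by (simp add: mult.assoc mult.left_commute mult.commute)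
    also have "\<dots> = m (1 + Suc 1)" unfolding b[symmetric] adj p1 ..
    also have "1 + Suc 1 = (3::nat)" by simp
    finally show ?thesis using u(3) by auto
  qed
  have HC: "ev x (Hess 4 g) = (det P ^ 2 * c) * (x 0 + p 2 $ 0 * x 2 + p 3 $ 0 * x 3) ^ 4" for x
  proof -
    have "sym_tensor 4 (0 + 4 * 1) (Const c * Var 0 ^ 4)" by (intro sym_tensor_mult sym_tensor_Const sym_tensor_power sym_tensor_Var) simp
    then have "ev x (Hess 4 g) = det P ^ 2 * (c * (\<Sum>j<4. P $$ (0, j) * x j) ^ 4)"
      unfolding g_def Hess_LS[OF P] H(1) by (simp add: ev.hom_mult ev.hom_power ev_LS)
    also have "(\<Sum>j<4. P $$ (0, j) * x j) = x 0 + p 2 $ 0 * x 2 + p 3 $ 0 * x 3"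
      by (simp add: sum_lessThan_4 P_def p0 p1 u(2))
    finally show ?thesis by (simp add: mult.assoc)
  qed
  have r: "GL_equiv 4 g (nf4 1 1 (m 3 / 6))" "det P ^ 2 * c \<noteq> 0"
    using Hankel_cubic_GL_equiv[OF g t0 t1 mz m3 HC] by blast+
  then have "GL_equiv 4 f (nf4 1 1 (m 3 / 6))" using GL_equiv_LS_cancel[OF _ P _ f] unfolding g_def by auto
  then show ?thesis using m3 by (intro exI[of _ "m 3 / 6"]) simp
qed

text \<open>
  The two cases are whether \<open>f\<close> vanishes on the plane \<open>x_0 = 0\<close> of its Hessian.\<close>
lemma quaternary_power_imp_GL_equiv:
  assumes f: "sym_tensor 4 3 f" and H: "power_of_linear_form 4 4 (Hess 4 f)"
  shows "\<exists>a b c. a * b \<noteq> 0 \<and> GL_equiv 4 f (nf4 a b c)"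
proof -
  have "power_of_linear_form 4 (4 * (3 - 2)) (Hess 4 f)" using H by simp
  then obtain B c where B: "B \<in> carrier_mat 4 4" "det B \<noteq> 0" "c \<noteq> 0" "Hess 4 (lin_subst 4 B f) = Const c * Var 0 ^ 4"
    by (rule hess_power_normalize) simp
  define g where "g = lin_subst 4 B f"
  have g: "sym_tensor 4 3 g" unfolding g_def by (rule sym_tensor_LS[OF f])
  have "\<exists>a b c. a * b \<noteq> 0 \<and> GL_equiv 4 g (nf4 a b c)"
  proof (cases "r0 g = 0")
    case True
    then show ?thesis using cone_pencil_GL_equiv[OF g B(4)[folded g_def] B(3)]
      by (intro exI[of _ 1] exI[of _ 0]) simp
  next
    case False
    then obtain x where x: "ev x (r0 g) \<noteq> 0" using ev_inj0 by blast
    define u where "u = vec 4 (\<lambda>i. if i = 0 then 0 else x i)"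
    have "ev x (r0 g) = ev (\<lambda>i. if i = 0 then 0 else x i) g"
      by (rule hom_eqI[OF comm_ring_hom_comp[OF ev.comm_ring_hom_axioms r0.comm_ring_hom_axioms] ev.comm_ring_hom_axioms])
        (simp_all add: r0_Var)
    also have "\<dots> = ev (\<lambda>i. u $ i) g" by (rule ev_cong[OF g]) (simp add: u_def)
    finally have "\<exists>b. b \<noteq> 0 \<and> GL_equiv 4 g (nf4 1 1 b)"
      using regular_point_GL_equiv[OF g B(4)[folded g_def] B(3), of u] x by (simp add: u_def)
    then show ?thesis by (metis mult_1 one_neq_zero)
  qed
  then show ?thesis using GL_equiv_LS_cancel[OF _ B(1,2) f] unfolding g_def by blast
qed

section \<open>The classification\<close>

theorem theorem5:
  shows
   "(\<forall>d n f. 1 \<le> d \<and> d \<le> 3 \<and> 2 \<le> n \<and> sym_tensor d n f \<longrightarrow>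
       (persistent d n f \<longleftrightarrow> power_of_linear_form d (d * (n - 2)) (Hess d f)))
  \<and> (\<forall>n f. 2 \<le> n \<and> sym_tensor 2 n f \<longrightarrow>
       isobaric 2 1 (Var 0 ^ (n - 1) * Var 1) \<and>
       (GL_equiv 2 f (Var 0 ^ (n - 1) * Var 1)
          \<longleftrightarrow> power_of_linear_form 2 (2 * (n - 2)) (Hess 2 f)) \<and>
       (power_of_linear_form 2 (2 * (n - 2)) (Hess 2 f) \<longleftrightarrow> persistent 2 n f))
  \<and> (\<forall>n f. 2 \<le> n \<and> sym_tensor 3 n f \<longrightarrow>
       isobaric 3 2 (Var 0 ^ (n - 1) * Var 2 + Var 0 ^ (n - 2) * Var 1 ^ 2) \<and>
       (GL_equiv 3 f (Var 0 ^ (n - 1) * Var 2 + Var 0 ^ (n - 2) * Var 1 ^ 2)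
          \<longleftrightarrow> power_of_linear_form 3 (3 * (n - 2)) (Hess 3 f)) \<and>
       (power_of_linear_form 3 (3 * (n - 2)) (Hess 3 f) \<longleftrightarrow> persistent 3 n f))
  \<and> (\<forall>a b c.
       isobaric 4 3 (Const a * Var 0 ^ 2 * Var 3 + Const b * Var 0 * Var 1 * Var 2
                     + Const c * Var 1 ^ 3))
  \<and> (\<forall>f. sym_tensor 4 3 f \<longrightarrow>
       ((\<exists>a b c. a * b \<noteq> 0 \<and>
           GL_equiv 4 f (Const a * Var 0 ^ 2 * Var 3 + Const b * Var 0 * Var 1 * Var 2
                         + Const c * Var 1 ^ 3))
          \<longleftrightarrow> power_of_linear_form 4 4 (Hess 4 f)) \<and>
       (power_of_linear_form 4 4 (Hess 4 f) \<longleftrightarrow> persistent 4 3 f))"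
proof -
  have nf: "Var 0 ^ (n - 1) * Var 1 = nf 2 n" "Var 0 ^ (n - 1) * Var 2 + Var 0 ^ (n - 2) * Var 1 ^ 2 = nf 3 n" for n
    by (simp_all add: nf_def)
  have iff: "persistent d n f \<longleftrightarrow> power_of_linear_form d (d * (n - 2)) (Hess d f)"
    if "d = 2 \<or> d = 3" "2 \<le> n" "sym_tensor d n f" for d n f
    using that persistent_imp_power GL_equiv_nf_iff_power GL_equiv_nf_persistent by metis
  have iso: "isobaric 2 1 (nf 2 n)" "isobaric 3 2 (nf 3 n)" if "2 \<le> n" for n
    using isobaric_nf[of 2 n] isobaric_nf[of 3 n] that by (simp_all add: One_nat_def)
  have "persistent d n f \<longleftrightarrow> power_of_linear_form d (d * (n - 2)) (Hess d f)"
    if h: "1 \<le> d" "d \<le> 3" "2 \<le> n" "sym_tensor d n f" for d n f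
  proof (cases "d = 1")
    case True
    obtain c where c: "f = Const c * Var 0 ^ n" using sym_tensor_1_monomial h(4) unfolding True by blast
    show ?thesis unfolding True c using univariate_persistent_iff[OF h(3)] univariate_power_iff[OF h(3)] by blast
  next
    case False
    then have "d = 2 \<or> d = 3" using h by linarith
    then show ?thesis using iff h by blast
  qed
  moreover have "\<forall>n f. 2 \<le> n \<and> sym_tensor 2 n f \<longrightarrow> isobaric 2 1 (nf 2 n) \<and>
       (GL_equiv 2 f (nf 2 n) \<longleftrightarrow> power_of_linear_form 2 (2 * (n - 2)) (Hess 2 f)) \<and>
       (power_of_linear_form 2 (2 * (n - 2)) (Hess 2 f) \<longleftrightarrow> persistent 2 n f)"
    using iso iff GL_equiv_nf_iff_power by blast
  moreover have "\<forall>n f. 2 \<le> n \<and> sym_tensor 3 n f \<longrightarrow> isobaric 3 2 (nf 3 n) \<and>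
       (GL_equiv 3 f (nf 3 n) \<longleftrightarrow> power_of_linear_form 3 (3 * (n - 2)) (Hess 3 f)) \<and>
       (power_of_linear_form 3 (3 * (n - 2)) (Hess 3 f) \<longleftrightarrow> persistent 3 n f)"
    using iso iff GL_equiv_nf_iff_power by blast
  moreover have "\<forall>f. sym_tensor 4 3 f \<longrightarrow>
       ((\<exists>a b c. a * b \<noteq> 0 \<and> GL_equiv 4 f (nf4 a b c)) \<longleftrightarrow> power_of_linear_form 4 4 (Hess 4 f)) \<and>
       (power_of_linear_form 4 4 (Hess 4 f) \<longleftrightarrow> persistent 4 3 f)"
    using persistent_3_iff quaternary_power_imp_GL_equiv GL_equiv_nf4_imp_power by blast
  ultimately show ?thesis
    using isobaric_nf4 unfolding nf nf4_def[symmetric] by blast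
qed

end
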